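(* For every $C>0$ there exists a function $\delta_C:(1,\infty)\to[0,\infty)$, depending only on $C$, with $\delta_C(A)\to0$ as $A\to\infty$, such that the following holds. Let $G=\langle a_1,\ldots,a_m\mid R\rangle$ be a finitely presented group with $m\geq2$, let $\lambda$ be the maximal length of a relation in $R$, and suppose that every minimal van Kampen diagram $D$ over this presentation satisfies the isoperimetric inequality $|\partial D|\geq C\,\mathcal{A}(D)$ (so that $G$ is hyperbolic). For an integer $\ell\ge 0$ let $W_\ell$ be the set of reduced words of length $\ell$ in the letters $a_1^{\pm1},\ldots,a_m^{\pm1}$ which are equal to $e$ in $G$. Suppose that, for some $A>1$ and some $\eta\geq1/2$, for every $\ell$ with $A\lambda/4\leq\ell\leq A\lambda$ one has $$|W_\ell|\leq(2m-1)^{\eta\ell}.$$ Then for every $\ell\geq A\lambda/4$, $$|W_\ell|\leq(2m-1)^{\eta\ell(1+\delta_C(A))}.$$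
   Context: For a van Kampen diagram $D$ over a presentation (in the standard sense of combinatorial group theory; filaments, i.e. edges not on the boundary of any face, are allowed), $|\partial D|$ denotes its boundary length, that is, the length of its boundary word. Its area is $$\mathcal{A}(D)=\sum_{f\text{ face of }D}|\partial f|,$$ where $|\partial f|$ is the boundary length of the face $f$. A van Kampen diagram is minimal if it has minimal area among all van Kampen diagrams with the same boundary word. *)

theory Defs
  imports Complex_Main "HOL-Algebra.Group" "HOL-Combinatorics.Cycles"
    "HOL-Combinatorics.Orbits"
begin

section \<open>Words and presented groups\<close>

text \<open>The letter \<open>(i, True)\<close> stands for the generator with index \<open>i < m\<close> and
  \<open>(i, False)\<close> for its formal inverse.\<close>

type_synonym letter = "nat \<times> bool"
type_synonym word = "letter list"

definition letters :: "nat \<Rightarrow> letter set" where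
  "letters m = {..<m} \<times> UNIV"

definition words :: "nat \<Rightarrow> word set" where
  "words m = lists (letters m)"

definition letter_inv :: "letter \<Rightarrow> letter" where
  "letter_inv x = (fst x, \<not> snd x)"

definition word_inv :: "word \<Rightarrow> word" where
  "word_inv w = rev (map letter_inv w)"

definition reduced :: "word \<Rightarrow> bool" where
  "reduced w \<longleftrightarrow> successively (\<lambda>x y. y \<noteq> letter_inv x) w"

inductive_set pres_rel :: "nat \<Rightarrow> word set \<Rightarrow> (word \<times> word) set"
  for m :: nat and R :: "word set" where
  refl: "w \<in> words m \<Longrightarrow> (w, w) \<in> pres_rel m R"
| sym: "(v, w) \<in> pres_rel m R \<Longrightarrow> (w, v) \<in> pres_rel m R"
| trans: "(u, v) \<in> pres_rel m R \<Longrightarrow> (v, w) \<in> pres_rel m R \<Longrightarrow> (u, w) \<in> pres_rel m R"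
| cancel: "u \<in> words m \<Longrightarrow> v \<in> words m \<Longrightarrow> x \<in> letters m \<Longrightarrow>
    (u @ [x, letter_inv x] @ v, u @ v) \<in> pres_rel m R"
| relator: "u \<in> words m \<Longrightarrow> v \<in> words m \<Longrightarrow> r \<in> R \<Longrightarrow>
    (u @ r @ v, u @ v) \<in> pres_rel m R"

text \<open>The group with generators indexed by \<open>{..<m}\<close> and set of relators \<open>R\<close>; this is
  meaningful for \<open>R \<subseteq> words m\<close>.\<close>

definition presented_group :: "nat \<Rightarrow> word set \<Rightarrow> word set monoid" where
  "presented_group m R =
     \<lparr>carrier = words m // pres_rel m R,
      monoid.mult = (\<lambda>X Y. \<Union>x\<in>X. \<Union>y\<in>Y. pres_rel m R `` {x @ y}),
      one = pres_rel m R `` {[]}\<rparr>"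

definition word_val :: "nat \<Rightarrow> word set \<Rightarrow> word \<Rightarrow> word set" where
  "word_val m R w = pres_rel m R `` {w}"

definition trivial_words :: "nat \<Rightarrow> word set \<Rightarrow> nat \<Rightarrow> word set" where
  "trivial_words m R l =
     {w \<in> words m. reduced w \<and> length w = l \<and> word_val m R w = \<one>\<^bsub>presented_group m R\<^esub>}"

text \<open>The inserted \<open>0\<close> only matters for the empty set of relators (free groups).\<close>

definition max_relator_length :: "word set \<Rightarrow> nat" where
  "max_relator_length R = Max (insert 0 (length ` R))"

lemma words_simps [simp]:
  "[] \<in> words m"
  "x # w \<in> words m \<longleftrightarrow> x \<in> letters m \<and> w \<in> words m"
  "v @ w \<in> words m \<longleftrightarrow> v \<in> words m \<and> w \<in> words m"
  by (auto simp: words_def)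

lemma letter_inv_simps [simp]:
  "letter_inv (letter_inv x) = x"
  "letter_inv x \<in> letters m \<longleftrightarrow> x \<in> letters m"
  by (cases x, simp add: letter_inv_def letters_def)+

lemma word_inv_in_words [simp]: "word_inv w \<in> words m \<longleftrightarrow> w \<in> words m"
  by (induction w) (auto simp: word_inv_def)

lemma pres_rel_subset:
  assumes "R \<subseteq> words m" shows "pres_rel m R \<subseteq> words m \<times> words m"
proof -
  have "v \<in> words m \<and> w \<in> words m" if "(v, w) \<in> pres_rel m R" for v w
    using that by induction (use assms in auto)
  then show ?thesis by auto
qed

lemma equiv_pres_rel:
  assumes "R \<subseteq> words m" shows "equiv (words m) (pres_rel m R)"
proof (rule equivI)
  show "pres_rel m R \<subseteq> words m \<times> words m"
    using assms by (rule pres_rel_subset)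
  show "refl_on (words m) (pres_rel m R)"
    by (rule refl_onI) (rule pres_rel.refl)
  show "sym (pres_rel m R)"
    by (rule symI) (rule pres_rel.sym)
  show "trans (pres_rel m R)"
    by (rule transI) (rule pres_rel.trans)
qed

lemma pres_rel_context:
  assumes "(v, w) \<in> pres_rel m R" "a \<in> words m" "b \<in> words m"
  shows "(a @ v @ b, a @ w @ b) \<in> pres_rel m R"
  using assms
proof induction
  case (refl w)
  then show ?case by (auto intro: pres_rel.refl)
next
  case (sym v w)
  then show ?case by (auto intro: pres_rel.sym)
next
  case (trans u v w)
  then show ?case by (blast intro: pres_rel.trans)
next
  case (cancel u v x)
  then show ?case using pres_rel.cancel[of "a @ u" m "v @ b" x R] by simp
next
  case (relator u v r)
  then show ?case using pres_rel.relator[of "a @ u" m "v @ b" r R] by simp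
qed

lemma pres_rel_append:
  assumes "R \<subseteq> words m" "(v, w) \<in> pres_rel m R" "(v', w') \<in> pres_rel m R"
  shows "(v @ v', w @ w') \<in> pres_rel m R"
proof -
  have "v' \<in> words m" "w \<in> words m" using assms pres_rel_subset by blast+
  then have "(v @ v', w @ v') \<in> pres_rel m R" "(w @ v', w @ w') \<in> pres_rel m R"
    using pres_rel_context[OF assms(2), of "[]" v'] pres_rel_context[OF assms(3), of w "[]"]
    by auto
  then show ?thesis by (rule pres_rel.trans)
qed

lemma pres_rel_word_inv:
  assumes "w \<in> words m" shows "(word_inv w @ w, []) \<in> pres_rel m R"
  using assms
proof (induction w)
  case Nil
  then show ?case by (auto simp: word_inv_def intro: pres_rel.refl)
next
  case (Cons x w)
  then have "(word_inv w @ [letter_inv x, letter_inv (letter_inv x)] @ w, word_inv w @ w)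
      \<in> pres_rel m R"
    by (intro pres_rel.cancel) auto
  with Cons show ?case by (auto simp: word_inv_def intro: pres_rel.trans)
qed

lemma word_val_eq_iff:
  assumes "R \<subseteq> words m" "v \<in> words m" "w \<in> words m"
  shows "word_val m R v = word_val m R w \<longleftrightarrow> (v, w) \<in> pres_rel m R"
  unfolding word_val_def using equiv_pres_rel[OF assms(1)] assms(2,3) by (rule eq_equiv_class_iff)

lemma carrier_presented_group: "carrier (presented_group m R) = word_val m R ` words m"
  by (auto simp: presented_group_def word_val_def quotient_def)

lemma one_presented_group: "\<one>\<^bsub>presented_group m R\<^esub> = word_val m R []"
  by (simp add: presented_group_def word_val_def)

lemma mult_presented_group:
  assumes "R \<subseteq> words m" "v \<in> words m" "w \<in> words m"
  shows "word_val m R v \<otimes>\<^bsub>presented_group m R\<^esub> word_val m R w = word_val m R (v @ w)"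
proof -
  have "word_val m R (x @ y) = word_val m R (v @ w)"
    if "x \<in> word_val m R v" "y \<in> word_val m R w" for x y
  proof -
    have *: "(v, x) \<in> pres_rel m R" "(w, y) \<in> pres_rel m R"
      using that by (auto simp: word_val_def)
    then have "(v @ w, x @ y) \<in> pres_rel m R" by (rule pres_rel_append[OF assms(1)])
    then have "(x @ y, v @ w) \<in> pres_rel m R" by (rule pres_rel.sym)
    moreover have "x @ y \<in> words m" using * pres_rel_subset[OF assms(1)] by auto
    ultimately show ?thesis using word_val_eq_iff[OF assms(1)] assms by auto
  qed
  then have "(\<Union>x\<in>word_val m R v. \<Union>y\<in>word_val m R w. word_val m R (x @ y)) =
      (\<Union>x\<in>word_val m R v. \<Union>y\<in>word_val m R w. word_val m R (v @ w))"
    by (intro SUP_cong HOL.refl)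
  moreover have "v \<in> word_val m R v" "w \<in> word_val m R w"
    unfolding word_val_def using assms(2,3) by (blast intro: pres_rel.refl)+
  then have "(\<Union>x\<in>word_val m R v. \<Union>y\<in>word_val m R w. word_val m R (v @ w)) = word_val m R (v @ w)"
    by blast
  ultimately show ?thesis
    by (simp add: presented_group_def word_val_def)
qed

lemma group_presented_group:
  assumes "R \<subseteq> words m" shows "group (presented_group m R)"
proof (rule groupI)
  fix X assume "X \<in> carrier (presented_group m R)"
  then obtain w where w: "w \<in> words m" "X = word_val m R w"
    by (auto simp: carrier_presented_group)
  then have "word_val m R (word_inv w) \<otimes>\<^bsub>presented_group m R\<^esub> X = \<one>\<^bsub>presented_group m R\<^esub>"
    using pres_rel_word_inv[of w m R] assms
    by (simp add: mult_presented_group one_presented_group word_val_eq_iff)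
  then show "\<exists>Y\<in>carrier (presented_group m R).
      Y \<otimes>\<^bsub>presented_group m R\<^esub> X = \<one>\<^bsub>presented_group m R\<^esub>"
    using w by (auto simp: carrier_presented_group)
qed (use assms in \<open>auto simp: carrier_presented_group mult_presented_group one_presented_group\<close>)

section \<open>Van Kampen diagrams\<close>

text \<open>
  A finite connected and simply connected planar 2-complex is the same thing as a cell structure
  on the sphere with one distinguished (outer) face. The cell structure is encoded by a
  combinatorial map on the set of oriented edges (darts): \<open>dinv\<close> reverses a dart and \<open>dnext\<close> sends
  a dart \<open>d\<close> to the dart following it on the boundary of the face to the left of \<open>d\<close>. Thus faces
  are the orbits of \<open>dnext\<close>, edges the orbits of \<open>dinv\<close>, and, since \<open>dnext (dinv d)\<close> is the next
  dart with the same origin as \<open>d\<close>, vertices are the orbits of \<open>dnext \<circ> dinv\<close>.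
  The dart \<open>dbase\<close> lies on the outer face and is the starting point of the boundary word.
  The diagram consisting of a single vertex has no darts.
\<close>

record diagram =
  darts :: "nat set"
  dinv :: "nat \<Rightarrow> nat"
  dnext :: "nat \<Rightarrow> nat"
  dlabel :: "nat \<Rightarrow> letter"
  dbase :: nat

definition dfaces :: "diagram \<Rightarrow> nat set set" where
  "dfaces D = orbit (dnext D) ` darts D"

definition dedges :: "diagram \<Rightarrow> nat set set" where
  "dedges D = orbit (dinv D) ` darts D"

definition dvertices :: "diagram \<Rightarrow> nat set set" where
  "dvertices D = orbit (dnext D \<circ> dinv D) ` darts D"

definition dconnected :: "diagram \<Rightarrow> bool" where
  "dconnected D \<longleftrightarrow>
     (\<forall>x\<in>darts D. \<forall>y\<in>darts D. (x, y) \<in> {(z, z'). z' = dinv D z \<or> z' = dnext D z}\<^sup>*)"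

text \<open>Euler's formula on the sphere; \<open>dfaces\<close> includes the outer face.\<close>

definition dplanar :: "diagram \<Rightarrow> bool" where
  "dplanar D \<longleftrightarrow> card (dvertices D) + card (dfaces D) = card (dedges D) + 2"

text \<open>The word read along a face, starting with the dart \<open>d\<close>; \<open>support p d\<close> is the list of the
  elements of the cycle of \<open>p\<close> through \<open>d\<close>, in order.\<close>

definition dword :: "diagram \<Rightarrow> nat \<Rightarrow> word" where
  "dword D d = map (dlabel D) (support (dnext D) d)"

definition boundary_word :: "diagram \<Rightarrow> word" where
  "boundary_word D = (if darts D = {} then [] else dword D (dbase D))"

text \<open>The faces of the diagram proper, that is, without the outer face.\<close>

definition inner_faces :: "diagram \<Rightarrow> nat set set" where
  "inner_faces D = dfaces D - {orbit (dnext D) (dbase D)}"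

definition vk_diagram :: "nat \<Rightarrow> word set \<Rightarrow> diagram \<Rightarrow> bool" where
  "vk_diagram m R D \<longleftrightarrow>
     finite (darts D) \<and>
     dinv D permutes darts D \<and>
     dnext D permutes darts D \<and>
     (\<forall>d\<in>darts D. dinv D d \<noteq> d \<and> dinv D (dinv D d) = d) \<and>
     (darts D \<noteq> {} \<longrightarrow> dbase D \<in> darts D \<and> dconnected D \<and> dplanar D) \<and>
     (\<forall>d\<in>darts D. dlabel D d \<in> letters m \<and> dlabel D (dinv D d) = letter_inv (dlabel D d)) \<and>
     (\<forall>f\<in>inner_faces D. \<exists>d\<in>f. dword D d \<in> R \<or> word_inv (dword D d) \<in> R)"

definition boundary_length :: "diagram \<Rightarrow> nat" where
  "boundary_length D = length (boundary_word D)"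

text \<open>The boundary length of a face is its number of darts, so an edge both of whose sides lie on
  the face counts twice.\<close>

definition area :: "diagram \<Rightarrow> nat" where
  "area D = (\<Sum>f\<in>inner_faces D. card f)"

definition minimal_diagram :: "nat \<Rightarrow> word set \<Rightarrow> diagram \<Rightarrow> bool" where
  "minimal_diagram m R D \<longleftrightarrow>
     vk_diagram m R D \<and>
     (\<forall>D'. vk_diagram m R D' \<and> boundary_word D' = boundary_word D \<longrightarrow> area D \<le> area D')"

end

theory Submission
  imports Defs
begin

text \<open>
  The idea is to cut a van Kampen diagram of boundary length \<open>l\<close> along a path of length
  \<open>O(sqrt (\<lambda> * l))\<close> into two parts, each of them containing at least about a quarter of the
  boundary. A path of length \<open>O(\<lambda> * log (l / \<lambda>))\<close> would also exist, but the square root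
  suffices and follows from an inequality of Besicovitch type: if the boundary is divided into four
  arcs, the product of the distances between opposite arcs is at most the sum of the squares of the
  face lengths plus \<open>l\<close>, hence at most \<open>\<lambda> * area + l \<le> (1 / C + 1) * \<lambda> * l\<close>. With \<open>f1\<close> and \<open>f2\<close> the
  distances in \<open>G\<close> to two adjacent arcs, for every pair of levels \<open>(t, s)\<close> some face (or boundary
  edge) meets both the level \<open>t\<close> of \<open>f1\<close> and the level \<open>s\<close> of \<open>f2\<close>; otherwise the number of edges
  with \<open>f2 \<le> s\<close> that cross the level \<open>t\<close> would be even along every inner face and odd along the
  outer face.

  A trivial word is thus encoded by two shorter ones, a short path, and cancelled subwords; the
  latter are harmless because \<open>\<eta> \<ge> 1 / 2\<close>. This bounds the exponent at length \<open>l\<close> by the exponent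
  at lengths up to \<open>7 / 8 * l\<close> times \<open>1 + O(sqrt (\<lambda> / l))\<close>, and the product of these factors over
  a geometric sequence of lengths starting at \<open>A * \<lambda>\<close> is \<open>1 + O(1 / sqrt A)\<close>.
\<close>

section \<open>Trees in combinatorial maps\<close>

text \<open>The hypothesis speaks of minimal diagrams, and all the topology of a diagram is
  connectedness and Euler's formula. Two bridges are needed: every trivial word must bound a
  diagram, and a diagram must map to the Cayley graph. A spanning tree and a complementary tree of
  faces serve both. Under Euler's formula they contain every edge, so the labels integrate to a
  potential in \<open>G\<close>; conversely, vanishing integral cohomology forces Euler's formula.
  The two words produced by a cut need not be reduced, so cancellations must be counted. A
  conjugation adds two letters and multiplies the count by about \<open>2 * m - 1\<close>, which is
  the rate 1/2 per letter; a cancelled pair leaves about \<open>2 * m - 1\<close> choices and thus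
  costs nothing when \<open>\<eta> \<ge> 1 / 2\<close>. Instead of multiplying factors over a
  sequence of lengths, the induction uses the closed rate
  \<open>exp (512 * c * (2 / sqrt A - sqrt (\<lambda> / l)))\<close> with
  \<open>c = sqrt (1 + 1 / C)\<close>. It is at least 1 from \<open>A * \<lambda> / 4\<close> on and
  at most \<open>exp (1024 * c / sqrt A)\<close>, which becomes
  \<open>1 + \<delta> A\<close>.\<close>

lemma orbit_permutes:
  assumes "finite X" "f permutes X"
  shows self_in_orbit_permutes: "x \<in> orbit f x"
    and orbit_eq_permutes: "y \<in> orbit f x \<Longrightarrow> orbit f y = orbit f x"
proof -
  have p: "permutation f" using assms by (auto simp: permutation_permutes)
  then show "x \<in> orbit f x" by (rule permutation_self_in_orbit)
  show "y \<in> orbit f x \<Longrightarrow> orbit f y = orbit f x"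
    by (rule orbit_cyclic_eq3[OF cyclic_on_orbit'[OF p]])
qed

text \<open>\<open>S\<close> is the union of the \<open>\<sigma>\<close>-orbits reached from \<open>r\<close> by a tree whose edges \<open>T\<close> lie in \<open>M\<close>.
  It is used both for spanning trees (orbits of \<open>dnext \<circ> dinv\<close>) and for the complementary trees of
  the dual graph (orbits of \<open>dnext\<close>).\<close>

inductive grow :: "('a \<Rightarrow> 'a) \<Rightarrow> ('a \<Rightarrow> 'a) \<Rightarrow> 'a set \<Rightarrow> 'a \<Rightarrow> 'a set \<Rightarrow> 'a set \<Rightarrow> bool"
  for \<sigma> \<alpha> M r where
  root: "grow \<sigma> \<alpha> M r (orbit \<sigma> r) {}"
| step: "grow \<sigma> \<alpha> M r S T \<Longrightarrow> d \<in> S \<Longrightarrow> d \<in> M \<Longrightarrow> \<alpha> d \<notin> S \<Longrightarrow>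
    grow \<sigma> \<alpha> M r (S \<union> orbit \<sigma> (\<alpha> d)) (insert d (insert (\<alpha> d) T))"

locale dart_perm =
  fixes X :: "'a set" and \<sigma> \<alpha> :: "'a \<Rightarrow> 'a"
  assumes finite_X: "finite X" and perm: "\<sigma> permutes X"
    and inv_in [simp]: "d \<in> X \<Longrightarrow> \<alpha> d \<in> X"
    and inv_neq [simp]: "d \<in> X \<Longrightarrow> \<alpha> d \<noteq> d"
    and inv_inv [simp]: "d \<in> X \<Longrightarrow> \<alpha> (\<alpha> d) = d"
begin

lemmas self_orbit [simp] = self_in_orbit_permutes[OF finite_X perm]
lemmas orbit_eq = orbit_eq_permutes[OF finite_X perm]

lemma orbit_sub: "d \<in> X \<Longrightarrow> orbit \<sigma> d \<subseteq> X"
  by (rule permutes_orbit_subset[OF perm])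

lemma perm_in [simp]: "d \<in> X \<Longrightarrow> \<sigma> d \<in> X"
  by (simp add: permutes_in_image[OF perm])

lemma grow_sub:
  assumes "grow \<sigma> \<alpha> M r S T" "r \<in> X" "M \<subseteq> X" "\<alpha> ` M \<subseteq> M"
  shows "S \<subseteq> X \<and> T \<subseteq> S \<and> T \<subseteq> M \<and> (\<forall>d\<in>T. \<alpha> d \<in> T) \<and> orbit \<sigma> r \<subseteq> S \<and> (\<forall>d\<in>S. orbit \<sigma> d \<subseteq> S)"
  using assms
proof induction
  case root
  then show ?case using orbit_sub orbit_eq by auto
next
  case (step S T d)
  then have IH: "S \<subseteq> X \<and> T \<subseteq> S \<and> T \<subseteq> M \<and> (\<forall>d\<in>T. \<alpha> d \<in> T) \<and> orbit \<sigma> r \<subseteq> S \<and> (\<forall>d\<in>S. orbit \<sigma> d \<subseteq> S)"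
    by blast
  have "d \<in> X" using step IH by blast
  then have "orbit \<sigma> (\<alpha> d) \<subseteq> X" using orbit_sub by simp
  moreover have "\<forall>e\<in>orbit \<sigma> (\<alpha> d). orbit \<sigma> e \<subseteq> orbit \<sigma> (\<alpha> d)" using orbit_eq by blast
  moreover have "\<alpha> d \<in> M" using step by blast
  ultimately show ?case using IH step \<open>d \<in> X\<close> by auto
qed

lemma grow_facts:
  assumes "grow \<sigma> \<alpha> M r S T" "r \<in> X" "M \<subseteq> X" "\<alpha> ` M \<subseteq> M"
  shows "S \<subseteq> X" "T \<subseteq> S" "T \<subseteq> M" "\<forall>d\<in>T. \<alpha> d \<in> T" "r \<in> S" "\<forall>d\<in>S. orbit \<sigma> d \<subseteq> S"
proof -
  note sub = grow_sub[OF assms]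
  show "S \<subseteq> X" "T \<subseteq> S" "T \<subseteq> M" "\<forall>d\<in>T. \<alpha> d \<in> T" "\<forall>d\<in>S. orbit \<sigma> d \<subseteq> S"
    using sub by - (elim conjE, assumption)+
  have "orbit \<sigma> r \<subseteq> S" using sub by - (elim conjE, assumption)
  then show "r \<in> S" by (rule subsetD) simp
qed

lemma grow_disjoint:
  assumes "grow \<sigma> \<alpha> M r S T" "r \<in> X" "M \<subseteq> X" "\<alpha> ` M \<subseteq> M" "e \<in> X" "e \<notin> S"
  shows "orbit \<sigma> e \<inter> S = {}"
proof -
  have "e \<in> S" if "z \<in> orbit \<sigma> e" "z \<in> S" for z
  proof -
    have "orbit \<sigma> z \<subseteq> S" using grow_sub[OF assms(1-4)] that(2) by simp
    then show ?thesis using orbit_eq[OF that(1)] self_orbit[of e] by blast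
  qed
  then show ?thesis using assms(6) by auto
qed

text \<open>A tree has one vertex more than edges, and every edge counts twice in \<open>T\<close>,
  as two darts.\<close>

lemma grow_card:
  assumes "grow \<sigma> \<alpha> M r S T" "r \<in> X" "M \<subseteq> X" "\<alpha> ` M \<subseteq> M"
  shows "card T + 2 = 2 * card (orbit \<sigma> ` S)"
  using assms
proof induction
  case root
  have "orbit \<sigma> ` orbit \<sigma> r = {orbit \<sigma> r}" using orbit_eq self_orbit by blast
  then show ?case by simp
next
  case (step S T d)
  note sub = grow_sub[OF step.hyps(1) step.prems]
  have "d \<in> X" using sub step by blast
  have *: "orbit \<sigma> ` orbit \<sigma> (\<alpha> d) = {orbit \<sigma> (\<alpha> d)}" using orbit_eq self_orbit by blast
  have "orbit \<sigma> (\<alpha> d) \<notin> orbit \<sigma> ` S"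
  proof
    assume "orbit \<sigma> (\<alpha> d) \<in> orbit \<sigma> ` S"
    then obtain e where "e \<in> S" "orbit \<sigma> (\<alpha> d) = orbit \<sigma> e" by blast
    then have "\<alpha> d \<in> S" using sub self_orbit[of "\<alpha> d"] by auto
    then show False using step.hyps(4) by simp
  qed
  moreover have "S \<subseteq> X" "T \<subseteq> S" "d \<in> T \<Longrightarrow> \<alpha> d \<in> T" using sub by auto
  then have "finite S" "finite T" "\<alpha> d \<notin> T" "d \<notin> T"
    using finite_X step.hyps(4) by (auto intro: finite_subset)
  ultimately have "card (orbit \<sigma> ` (S \<union> orbit \<sigma> (\<alpha> d))) = Suc (card (orbit \<sigma> ` S))"
    by (simp add: image_Un *)
  moreover have "d \<noteq> \<alpha> d" using inv_neq[OF \<open>d \<in> X\<close>] by simp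
  ultimately show ?case using step.IH step.prems \<open>finite T\<close> \<open>\<alpha> d \<notin> T\<close> \<open>d \<notin> T\<close> by simp
qed

lemma grow_maximal:
  assumes "r \<in> X" "M \<subseteq> X" "\<alpha> ` M \<subseteq> M"
  obtains S T where "grow \<sigma> \<alpha> M r S T" "\<And>d. d \<in> S \<Longrightarrow> d \<in> M \<Longrightarrow> \<alpha> d \<in> S"
proof -
  let ?P = "\<lambda>n. \<exists>S T. grow \<sigma> \<alpha> M r S T \<and> card S = n"
  have "grow \<sigma> \<alpha> M r (orbit \<sigma> r) {}" by (rule grow.root)
  then have "?P (card (orbit \<sigma> r))" by blast
  moreover have "n \<le> card X" if "?P n" for n
  proof -
    from that obtain S T where "grow \<sigma> \<alpha> M r S T" "card S = n" by blast
    then show ?thesis using grow_sub[OF _ assms, of S T] card_mono[OF finite_X, of S] by simp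
  qed
  ultimately obtain n where n: "?P n" "\<forall>k. ?P k \<longrightarrow> k \<le> n"
    using Nat.ex_has_greatest_nat[of ?P _ "card X"] by blast
  then obtain S T where g: "grow \<sigma> \<alpha> M r S T" "card S = n" by blast
  have "\<alpha> d \<in> S" if d: "d \<in> S" "d \<in> M" for d
  proof (rule ccontr)
    assume "\<alpha> d \<notin> S"
    then have g': "grow \<sigma> \<alpha> M r (S \<union> orbit \<sigma> (\<alpha> d)) (insert d (insert (\<alpha> d) T))"
      using g d by (intro grow.step)
    then have "finite (S \<union> orbit \<sigma> (\<alpha> d))"
      using grow_sub[OF g' assms] finite_X by (meson finite_subset)
    moreover have "S \<subset> S \<union> orbit \<sigma> (\<alpha> d)" using \<open>\<alpha> d \<notin> S\<close> self_orbit by blast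
    ultimately have "card S < card (S \<union> orbit \<sigma> (\<alpha> d))" by (rule psubset_card_mono)
    then show False using n(2) g' g(2) by fastforce
  qed
  then show thesis using g that by blast
qed

text \<open>The tree is peeled from its leaves: the last orbit added contains only one dart of \<open>T\<close>.\<close>

lemma grow_peel:
  assumes "grow \<sigma> \<alpha> M r S T" "r \<in> X" "M \<subseteq> X" "\<alpha> ` M \<subseteq> M"
    and "\<And>d. d \<in> X \<Longrightarrow> d \<notin> T \<Longrightarrow> good d"
    and sym: "\<And>d. d \<in> X \<Longrightarrow> good d \<Longrightarrow> good (\<alpha> d)"
    and last: "\<And>d. d \<in> X \<Longrightarrow> d \<notin> orbit \<sigma> r \<Longrightarrow> (\<And>e. e \<in> orbit \<sigma> d \<Longrightarrow> e \<noteq> d \<Longrightarrow> good e) \<Longrightarrow> good d"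
    and "d \<in> X"
  shows "good d"
  using assms(1-5,8)
proof (induction arbitrary: d)
  case root
  then show ?case by simp
next
  case (step S T c)
  note sub = grow_sub[OF step.hyps(1) step.prems(1-3)]
  have "c \<in> X" using sub step by blast
  have disj: "orbit \<sigma> (\<alpha> c) \<inter> S = {}"
    by (rule grow_disjoint[OF step.hyps(1) step.prems(1-3)]) (use \<open>c \<in> X\<close> step in auto)
  have "good (\<alpha> c)"
  proof (rule last)
    show "\<alpha> c \<in> X" using \<open>c \<in> X\<close> by simp
    show "\<alpha> c \<notin> orbit \<sigma> r" using sub step by blast
    fix e assume e: "e \<in> orbit \<sigma> (\<alpha> c)" "e \<noteq> \<alpha> c"
    then have "e \<in> X" using orbit_sub \<open>\<alpha> c \<in> X\<close> by blast
    then show "good e" using step.prems(4) e disj sub step.hyps(2) by blast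
  qed
  then have "good c" using sym[of "\<alpha> c"] \<open>c \<in> X\<close> by simp
  show ?case
  proof (rule step.IH[OF step.prems(1-3)])
    show "good e" if "e \<in> X" "e \<notin> T" for e
      using step.prems(4)[OF that(1)] that \<open>good c\<close> \<open>good (\<alpha> c)\<close> by blast
  qed (rule step.prems(5))
qed

text \<open>Each orbit other than the root is balanced by the dart leading to its parent. Starting
  with the orbit added last, the value of this dart is forced by the rest of the orbit; the change
  at the opposite dart is left to the parent, so that only the root orbit may stay
  unbalanced.\<close>

lemma grow_solve:
  fixes \<psi>0 :: "'a \<Rightarrow> int"
  assumes "grow \<sigma> \<alpha> M r S T" "r \<in> X" "M \<subseteq> X" "\<alpha> ` M \<subseteq> M"
    and "\<And>d. d \<in> X \<Longrightarrow> \<psi>0 (\<alpha> d) = - \<psi>0 d"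
  obtains \<psi> where "\<And>d. d \<in> X \<Longrightarrow> \<psi> (\<alpha> d) = - \<psi> d" "\<And>d. d \<notin> T \<Longrightarrow> \<psi> d = \<psi>0 d"
    "\<And>d. d \<in> S \<Longrightarrow> d \<notin> orbit \<sigma> r \<Longrightarrow> (\<Sum>e\<in>orbit \<sigma> d. \<psi> e) = 0"
  using assms
proof (induction arbitrary: \<psi>0 thesis)
  case root
  show ?case by (rule root.prems(1)[of \<psi>0]) (use root.prems(5) in auto)
next
  case (step S T c)
  note sub = grow_sub[OF step.hyps(1) step.prems(2-4)]
  have "c \<in> X" using sub step by blast
  let ?O = "orbit \<sigma> (\<alpha> c)"
  have disj: "?O \<inter> S = {}"
    by (rule grow_disjoint[OF step.hyps(1) step.prems(2-4)]) (use \<open>c \<in> X\<close> step in auto)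
  define z where "z = (\<Sum>e\<in>?O - {\<alpha> c}. \<psi>0 e)"
  define \<psi>1 where "\<psi>1 = \<psi>0(c := z, \<alpha> c := - z)"
  have "\<psi>1 (\<alpha> d) = - \<psi>1 d" if "d \<in> X" for d
  proof -
    have "\<alpha> d = c \<longleftrightarrow> d = \<alpha> c" "\<alpha> d = \<alpha> c \<longleftrightarrow> d = c"
      using that \<open>c \<in> X\<close> inv_inv by metis+
    then show ?thesis using step.prems(5) that \<open>c \<in> X\<close> by (auto simp: \<psi>1_def)
  qed
  then obtain \<psi> where \<psi>: "\<And>d. d \<in> X \<Longrightarrow> \<psi> (\<alpha> d) = - \<psi> d" "\<And>d. d \<notin> T \<Longrightarrow> \<psi> d = \<psi>1 d"
    "\<And>d. d \<in> S \<Longrightarrow> d \<notin> orbit \<sigma> r \<Longrightarrow> (\<Sum>e\<in>orbit \<sigma> d. \<psi> e) = 0"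
    using step.IH[of \<psi>1] step.prems(2-4) by blast
  have fin: "finite ?O" using orbit_sub[of "\<alpha> c"] \<open>c \<in> X\<close> finite_X finite_subset by auto
  have "(\<Sum>e\<in>?O. \<psi> e) = (\<Sum>e\<in>?O. \<psi>1 e)"
    using \<psi>(2) disj sub by (intro sum.cong) blast+
  also have "\<dots> = \<psi>1 (\<alpha> c) + (\<Sum>e\<in>?O - {\<alpha> c}. \<psi>1 e)"
    using fin by (intro sum.remove) auto
  also have "(\<Sum>e\<in>?O - {\<alpha> c}. \<psi>1 e) = z"
    unfolding z_def using disj step.hyps(2) by (intro sum.cong) (auto simp: \<psi>1_def)
  finally have O: "(\<Sum>e\<in>?O. \<psi> e) = 0" by (simp add: \<psi>1_def)
  show ?case
  proof (rule step.prems(1))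
    show "\<psi> (\<alpha> d) = - \<psi> d" if "d \<in> X" for d using \<psi>(1) that .
    show "\<psi> d = \<psi>0 d" if "d \<notin> insert c (insert (\<alpha> c) T)" for d
      using \<psi>(2) that by (auto simp: \<psi>1_def)
    show "(\<Sum>e\<in>orbit \<sigma> d. \<psi> e) = 0" if "d \<in> S \<union> ?O" "d \<notin> orbit \<sigma> r" for d
      using \<psi>(3) O orbit_eq that by (cases "d \<in> S") auto
  qed
qed

lemma grow_const:
  assumes "grow \<sigma> \<alpha> M r S T" "r \<in> X" "M \<subseteq> X" "\<alpha> ` M \<subseteq> M"
    and "\<And>d. d \<in> T \<Longrightarrow> h (\<alpha> d) = h d" and h: "\<And>d. d \<in> X \<Longrightarrow> h (\<sigma> d) = h d"
    and "d \<in> S"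
  shows "h d = h r"
proof -
  have orb: "h e = h c \<and> e \<in> X" if "e \<in> orbit \<sigma> c" "c \<in> X" for e c
    using that by induction (simp_all add: h)
  show ?thesis
    using assms(1-5,7)
  proof (induction arbitrary: d)
    case root
    then show ?case using orb by blast
  next
    case (step S T c)
    have "c \<in> X" using step.hyps grow_sub[OF step.hyps(1) step.prems(1-3)] by blast
    have S: "h e = h r" if "e \<in> S" for e
      using step.IH[OF step.prems(1-3) _ that] step.prems(4) by blast
    show ?case
    proof (cases "d \<in> S")
      case True
      then show ?thesis by (rule S)
    next
      case False
      then have "h d = h (\<alpha> c)" using step.prems(5) orb \<open>c \<in> X\<close> by simp
      also have "\<dots> = h c" using step.prems(4) by blast
      finally show ?thesis using S step.hyps(2) by simp
    qed
  qed
qed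

lemma grow_exhaust:
  assumes "r \<in> X" and conn: "\<And>Y. Y \<subseteq> X \<Longrightarrow> r \<in> Y \<Longrightarrow> \<sigma> ` Y \<subseteq> Y \<Longrightarrow> \<alpha> ` Y \<subseteq> Y \<Longrightarrow> Y = X"
  obtains T where "grow \<sigma> \<alpha> X r X T"
proof -
  have X: "X \<subseteq> X" "\<alpha> ` X \<subseteq> X" by auto
  obtain S T where g: "grow \<sigma> \<alpha> X r S T" "\<And>d. d \<in> S \<Longrightarrow> d \<in> X \<Longrightarrow> \<alpha> d \<in> S"
    using grow_maximal[OF \<open>r \<in> X\<close> X] by blast
  note sub = grow_sub[OF g(1) \<open>r \<in> X\<close> X]
  have "S = X"
  proof (rule conn)
    show "\<sigma> ` S \<subseteq> S" using sub orbit.base[of \<sigma>] by (meson image_subsetI subsetD)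
    show "r \<in> S" using sub self_orbit[of r] by (meson subsetD)
    show "\<alpha> ` S \<subseteq> S" using g(2) sub by (meson image_subsetI subsetD)
    show "S \<subseteq> X" using sub by simp
  qed
  then show thesis using g(1) by (intro that) simp
qed

end

text \<open>The long way around the cycle, from \<open>\<sigma> d\<close> back to \<open>d\<close>,
  uses every step except the one in question.\<close>

lemma orbit_chain:
  assumes "d \<in> orbit \<sigma> d" "\<And>e. e \<in> orbit \<sigma> d \<Longrightarrow> e \<noteq> d \<Longrightarrow> P (\<sigma> e) = P e"
  shows "P (\<sigma> d) = P d"
proof -
  obtain n where n: "(\<sigma> ^^ n) d = d" "n > 0"
    using assms(1) by (auto simp: orbit_altdef) metis
  define k where "k = least_power \<sigma> d"
  have k: "(\<sigma> ^^ k) d = d" "k > 0" unfolding k_def using n by (auto intro: least_powerI)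
  have "P ((\<sigma> ^^ j) d) = P (\<sigma> d)" if "0 < j" "j \<le> k" for j
    using that
  proof (induction j)
    case (Suc j)
    show ?case
    proof (cases "j = 0")
      case False
      then have "(\<sigma> ^^ j) d \<noteq> d" using Suc.prems least_power_le[of j \<sigma> d] k_def by fastforce
      moreover have "(\<sigma> ^^ j) d \<in> orbit \<sigma> d" using False by (auto simp: orbit_altdef)
      ultimately show ?thesis using assms(2) Suc False by simp
    qed simp
  qed simp
  from this[of k] show ?thesis using k by simp
qed

lemma apply_in_orbit_closed_iff:
  assumes "finite X" "f permutes X" "\<forall>d\<in>S. orbit f d \<subseteq> S"
  shows "f x \<in> S \<longleftrightarrow> x \<in> S"
proof
  assume "f x \<in> S"
  then have "orbit f (f x) \<subseteq> S" using assms(3) by simp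
  moreover have "orbit f (f x) = orbit f x"
    using orbit_eq_permutes[OF assms(1,2)] orbit.base by fast
  ultimately show "x \<in> S" using self_in_orbit_permutes[OF assms(1,2), of x] by blast
next
  assume "x \<in> S"
  then show "f x \<in> S" using assms(3) orbit.base[of f x] by fast
qed

section \<open>Combinatorial maps: spanning tree, cotree and Euler's formula\<close>

locale dart_map =
  fixes X :: "'a set" and \<alpha> \<phi> :: "'a \<Rightarrow> 'a" and r :: 'a
  assumes finite_darts: "finite X" and \<alpha>_perm: "\<alpha> permutes X" and \<phi>_perm: "\<phi> permutes X"
    and \<alpha>_neq: "d \<in> X \<Longrightarrow> \<alpha> d \<noteq> d" and \<alpha>_inv: "d \<in> X \<Longrightarrow> \<alpha> (\<alpha> d) = d"
    and r_in: "r \<in> X"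
    and conn: "\<And>Y. Y \<subseteq> X \<Longrightarrow> r \<in> Y \<Longrightarrow> \<phi> ` Y \<subseteq> Y \<Longrightarrow> \<alpha> ` Y \<subseteq> Y \<Longrightarrow> Y = X"
begin

lemma \<alpha>_in [simp]: "\<alpha> d \<in> X \<longleftrightarrow> d \<in> X"
  by (rule permutes_in_image[OF \<alpha>_perm])

lemma \<phi>_in [simp]: "\<phi> d \<in> X \<longleftrightarrow> d \<in> X"
  by (rule permutes_in_image[OF \<phi>_perm])

lemma \<alpha>_inv' [simp]: "\<alpha> (\<alpha> d) = d"
  using \<alpha>_inv \<alpha>_perm by (cases "d \<in> X") (auto simp: permutes_not_in)

lemma \<alpha>_eq_iff [simp]: "\<alpha> x = \<alpha> y \<longleftrightarrow> x = y"
  by (metis \<alpha>_inv')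

sublocale vertex: dart_perm X "\<phi> \<circ> \<alpha>" \<alpha>
  using finite_darts \<alpha>_perm \<phi>_perm \<alpha>_neq \<alpha>_inv
  by unfold_locales (auto intro: permutes_compose simp: permutes_in_image)

sublocale face: dart_perm X \<phi> \<alpha>
  using finite_darts \<alpha>_perm \<phi>_perm \<alpha>_neq \<alpha>_inv
  by unfold_locales (auto simp: permutes_in_image)

lemma \<alpha>_Diff:
  assumes "\<And>d. d \<in> T \<Longrightarrow> \<alpha> d \<in> T"
  shows "\<alpha> ` (X - T) \<subseteq> X - T"
proof -
  have "\<alpha> d \<in> X - T" if "d \<in> X - T" for d
  proof -
    have "\<alpha> d \<notin> T"
    proof
      assume "\<alpha> d \<in> T"
      from assms[OF this] show False using that by simp
    qed
    then show ?thesis using that by simp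
  qed
  then show ?thesis by (rule image_subsetI)
qed

text \<open>The edges outside a spanning tree connect all faces, on any surface. Let
  \<open>S\<close> be the union of the faces reached. No edge outside \<open>T\<close> separates
  \<open>S\<close> from its complement. Around a vertex, membership in \<open>S\<close> cannot
  change exactly once, so peeling \<open>T\<close> from its leaves shows that no edge of
  \<open>T\<close> separates either. By connectedness \<open>S\<close> is everything.\<close>

lemma tree_cotree:
  obtains T T' where "grow (\<phi> \<circ> \<alpha>) \<alpha> X r X T" "grow \<phi> \<alpha> (X - T) r X T'"
    "T \<subseteq> X" "T' \<subseteq> X - T" "\<And>d. d \<in> T \<Longrightarrow> \<alpha> d \<in> T" "\<And>d. d \<in> T' \<Longrightarrow> \<alpha> d \<in> T'"
proof -
  have XX: "X \<subseteq> X" "\<alpha> ` X \<subseteq> X" by auto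
  obtain T where T: "grow (\<phi> \<circ> \<alpha>) \<alpha> X r X T"
  proof (rule vertex.grow_exhaust[OF r_in])
    fix Y assume Y: "Y \<subseteq> X" "r \<in> Y" "(\<phi> \<circ> \<alpha>) ` Y \<subseteq> Y" "\<alpha> ` Y \<subseteq> Y"
    have "\<phi> d \<in> Y" if "d \<in> Y" for d
    proof -
      have "\<alpha> d \<in> Y" using Y(4) that by auto
      then have "(\<phi> \<circ> \<alpha>) (\<alpha> d) \<in> Y" using Y(3) by blast
      then show ?thesis by simp
    qed
    then show "Y = X" using Y by (intro conn) auto
  qed
  note subT = vertex.grow_facts[OF T r_in XX]
  have "\<alpha> d \<in> T" if "d \<in> T" for d using subT(4) that by (rule bspec)
  then have \<alpha>T: "\<alpha> d \<in> T \<longleftrightarrow> d \<in> T" for d by (metis \<alpha>_inv')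
  have M: "X - T \<subseteq> X" by (rule Diff_subset)
  have M': "\<alpha> ` (X - T) \<subseteq> X - T" by (rule \<alpha>_Diff) (simp add: \<alpha>T)
  obtain S T' where g: "grow \<phi> \<alpha> (X - T) r S T'" "\<And>d. d \<in> S \<Longrightarrow> d \<in> X - T \<Longrightarrow> \<alpha> d \<in> S"
    using face.grow_maximal[OF r_in M M'] by metis
  note sub = face.grow_facts[OF g(1) r_in M M']
  note S = sub(6)
  have \<phi>S: "\<phi> x \<in> S \<longleftrightarrow> x \<in> S" for x
    by (rule apply_in_orbit_closed_iff[OF finite_darts \<phi>_perm S])
  have good: "d \<in> S \<longleftrightarrow> \<alpha> d \<in> S" if "d \<in> X" for d
  proof (rule vertex.grow_peel[OF T r_in XX _ _ _ that])
    fix d assume d: "d \<in> X" "d \<notin> T"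
    then show "d \<in> S \<longleftrightarrow> \<alpha> d \<in> S" using g(2)[of d] g(2)[of "\<alpha> d"] \<alpha>T by auto
  next
    fix d assume "d \<in> S \<longleftrightarrow> \<alpha> d \<in> S"
    then show "\<alpha> d \<in> S \<longleftrightarrow> \<alpha> (\<alpha> d) \<in> S" by simp
  next
    fix d assume d: "d \<in> X" "\<And>e. e \<in> orbit (\<phi> \<circ> \<alpha>) d \<Longrightarrow> e \<noteq> d \<Longrightarrow> e \<in> S \<longleftrightarrow> \<alpha> e \<in> S"
    have "((\<phi> \<circ> \<alpha>) d \<in> S) = (d \<in> S)"
      by (rule orbit_chain[where \<sigma> = "\<phi> \<circ> \<alpha>" and P = "\<lambda>e. e \<in> S"]) (use d(2) \<phi>S in simp_all)
    then show "d \<in> S \<longleftrightarrow> \<alpha> d \<in> S" using \<phi>S by simp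
  qed
  have "\<phi> ` S \<subseteq> S" using \<phi>S by auto
  moreover have "\<alpha> ` S \<subseteq> S" using good sub(1) by auto
  ultimately have "S = X" using sub(1) sub(5) by (intro conn)
  then show thesis
    using T g(1) by (intro that) (use subT(3,4) sub(3,4) in auto)
qed

lemma card_darts: "card X = 2 * card (orbit \<alpha> ` X)"
proof -
  have orb: "orbit \<alpha> d = {d, \<alpha> d}" for d
  proof (intro equalityI subsetI)
    fix y assume "y \<in> orbit \<alpha> d"
    then show "y \<in> {d, \<alpha> d}" by induction auto
  next
    fix y assume "y \<in> {d, \<alpha> d}"
    then show "y \<in> orbit \<alpha> d" using orbit.base[of \<alpha> d] orbit.step[of "\<alpha> d" \<alpha> d] by auto
  qed
  have "card X = card (\<Union> (orbit \<alpha> ` X))"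
    by (rule arg_cong[of _ _ card]) (auto simp: orb)
  also have "\<dots> = sum card (orbit \<alpha> ` X)"
  proof (rule card_Union_disjoint)
    show "pairwise disjnt (orbit \<alpha> ` X)"
      by (auto simp: pairwise_def disjnt_def orb)
  qed (auto simp: orb)
  also have "\<dots> = (\<Sum>e\<in>orbit \<alpha> ` X. 2)"
  proof (rule sum.cong)
    fix e assume "e \<in> orbit \<alpha> ` X"
    then obtain d where "d \<in> X" "e = {d, \<alpha> d}" using orb by auto
    moreover have "d \<noteq> \<alpha> d" using \<alpha>_neq[OF \<open>d \<in> X\<close>] by simp
    ultimately show "card e = 2" by simp
  qed simp
  finally show ?thesis by simp
qed

lemma card_tree_cotree:
  assumes "grow (\<phi> \<circ> \<alpha>) \<alpha> X r X T" "grow \<phi> \<alpha> (X - T) r X T'" "\<And>d. d \<in> T \<Longrightarrow> \<alpha> d \<in> T"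
  shows "card T + card T' + 4 = 2 * (card (orbit (\<phi> \<circ> \<alpha>) ` X) + card (orbit \<phi> ` X))"
proof -
  have "\<alpha> ` (X - T) \<subseteq> X - T" by (rule \<alpha>_Diff[OF assms(3)])
  then have "card T' + 2 = 2 * card (orbit \<phi> ` X)"
    by (intro face.grow_card[OF assms(2) r_in]) auto
  moreover have "card T + 2 = 2 * card (orbit (\<phi> \<circ> \<alpha>) ` X)"
    by (intro vertex.grow_card[OF assms(1) r_in]) auto
  ultimately show ?thesis by simp
qed

text \<open>Euler's formula says that spanning tree and cotree together contain every edge.\<close>

lemma euler_iff:
  assumes "grow (\<phi> \<circ> \<alpha>) \<alpha> X r X T" "grow \<phi> \<alpha> (X - T) r X T'" "\<And>d. d \<in> T \<Longrightarrow> \<alpha> d \<in> T"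
    "T \<subseteq> X" "T' \<subseteq> X - T"
  shows "card (orbit (\<phi> \<circ> \<alpha>) ` X) + card (orbit \<phi> ` X) = card (orbit \<alpha> ` X) + 2 \<longleftrightarrow> T \<union> T' = X"
proof -
  have fin: "finite T" "finite T'" using assms(4,5) finite_darts by (auto intro: finite_subset)
  then have "card (T \<union> T') = card T + card T'"
    using assms(5) by (intro card_Un_disjoint) auto
  moreover have "T \<union> T' = X \<longleftrightarrow> card (T \<union> T') = card X"
    using assms(4,5) finite_darts card_subset_eq[of X "T \<union> T'"] by auto
  ultimately show ?thesis
    using card_tree_cotree[OF assms(1-3)] card_darts by auto
qed

text \<open>If an edge lay in neither tree, the cycle that it closes up in the cotree would carry a
  cocycle vanishing on the tree.\<close>

lemma euler_if_cohomology_trivial: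
  assumes H1: "\<And>\<psi> :: 'a \<Rightarrow> int. (\<And>d. d \<in> X \<Longrightarrow> \<psi> (\<alpha> d) = - \<psi> d) \<Longrightarrow>
      (\<And>d. d \<in> X \<Longrightarrow> (\<Sum>e\<in>orbit \<phi> d. \<psi> e) = 0) \<Longrightarrow>
      \<exists>h. \<forall>d\<in>X. h (\<phi> d) = h (\<alpha> d) \<and> h (\<alpha> d) - h d = \<psi> d"
  shows "card (orbit (\<phi> \<circ> \<alpha>) ` X) + card (orbit \<phi> ` X) = card (orbit \<alpha> ` X) + 2"
proof -
  obtain T T' where T: "grow (\<phi> \<circ> \<alpha>) \<alpha> X r X T" "grow \<phi> \<alpha> (X - T) r X T'"
    "T \<subseteq> X" "T' \<subseteq> X - T" "\<And>d. d \<in> T \<Longrightarrow> \<alpha> d \<in> T" "\<And>d. d \<in> T' \<Longrightarrow> \<alpha> d \<in> T'"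
    by (rule tree_cotree) blast
  have M: "X - T \<subseteq> X" "\<alpha> ` (X - T) \<subseteq> X - T" using \<alpha>_Diff[OF T(5)] by auto
  have "e \<in> T \<union> T'" if "e \<in> X" for e
  proof (rule ccontr)
    assume e: "e \<notin> T \<union> T'"
    define \<psi>0 :: "'a \<Rightarrow> int" where "\<psi>0 = (\<lambda>_. 0)(e := 1, \<alpha> e := - 1)"
    have "\<psi>0 (\<alpha> d) = - \<psi>0 d" for d
    proof -
      have "\<alpha> d = e \<longleftrightarrow> d = \<alpha> e" "\<alpha> d = \<alpha> e \<longleftrightarrow> d = e" using \<alpha>_inv' by metis+
      then show ?thesis using \<alpha>_neq[OF \<open>e \<in> X\<close>] by (auto simp: \<psi>0_def)
    qed
    then obtain \<psi> where \<psi>: "\<And>d. d \<in> X \<Longrightarrow> \<psi> (\<alpha> d) = - \<psi> d" "\<And>d. d \<notin> T' \<Longrightarrow> \<psi> d = \<psi>0 d"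
      "\<And>d. d \<in> X \<Longrightarrow> d \<notin> orbit \<phi> r \<Longrightarrow> (\<Sum>e\<in>orbit \<phi> d. \<psi> e) = 0"
      using face.grow_solve[OF T(2) r_in M, of \<psi>0] by metis
    \<comment> \<open>The root face, the only one that \<open>grow_solve\<close> leaves open, is
      balanced as well, because the sum over all darts vanishes by antisymmetry.\<close>
    have "(\<Sum>d\<in>X. \<psi> d) = (\<Sum>d\<in>X. \<psi> (\<alpha> d))"
      using sum.permute[OF \<alpha>_perm, of \<psi>] by (simp add: comp_def)
    also have "\<dots> = - (\<Sum>d\<in>X. \<psi> d)" using \<psi>(1) by (simp add: sum_negf)
    finally have "(\<Sum>d\<in>X. \<psi> d) = 0" by simp
    moreover have "(\<Sum>d\<in>X. \<psi> d) = (\<Sum>f\<in>orbit \<phi> ` X. \<Sum>e\<in>f. \<psi> e)"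
    proof -
      have "X = \<Union> (orbit \<phi> ` X)" using face.orbit_sub face.self_orbit by blast
      moreover have "sum \<psi> (\<Union> (orbit \<phi> ` X)) = (\<Sum>f\<in>orbit \<phi> ` X. \<Sum>e\<in>f. \<psi> e)"
      proof (subst sum.Union_disjoint)
        show "\<forall>A\<in>orbit \<phi> ` X. finite A"
          using face.orbit_sub finite_darts by (auto intro: finite_subset)
        show "\<forall>A\<in>orbit \<phi> ` X. \<forall>B\<in>orbit \<phi> ` X. A \<noteq> B \<longrightarrow> A \<inter> B = {}"
          using face.orbit_eq by (metis disjoint_iff imageE)
      qed simp
      ultimately show ?thesis by simp
    qed
    moreover have "(\<Sum>f\<in>orbit \<phi> ` X. \<Sum>e\<in>f. \<psi> e) = (\<Sum>e\<in>orbit \<phi> r. \<psi> e)"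
    proof -
      have "(\<Sum>f\<in>orbit \<phi> ` X. \<Sum>e\<in>f. \<psi> e) = (\<Sum>f\<in>{orbit \<phi> r}. \<Sum>e\<in>f. \<psi> e)"
        using r_in \<psi>(3) face.orbit_eq finite_darts
        by (intro sum.mono_neutral_right) auto
      then show ?thesis by simp
    qed
    ultimately have "(\<Sum>e\<in>orbit \<phi> d. \<psi> e) = 0" if "d \<in> X" for d
      using \<psi>(3)[OF that] face.orbit_eq[of d r] by (cases "d \<in> orbit \<phi> r") auto
    then obtain h where h: "\<And>d. d \<in> X \<Longrightarrow> h (\<phi> d) = h (\<alpha> d)" "\<And>d. d \<in> X \<Longrightarrow> h (\<alpha> d) - h d = \<psi> d"
      using H1[of \<psi>] \<psi>(1) by blast
    have "\<alpha> e \<notin> T" using e T(5) \<alpha>_inv' by (metis UnCI)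
    \<comment> \<open>\<open>\<psi>\<close> vanishes on the spanning tree, so \<open>h\<close> is
      constant, although it should differ by 1 along \<open>e\<close>.\<close>
    have "h d = h r" if "d \<in> X" for d
    proof (rule vertex.grow_const[OF T(1) r_in _ _ _ _ that])
      show "h (\<alpha> d) = h d" if "d \<in> T" for d
      proof -
        have "d \<in> X" "d \<notin> T'" "d \<noteq> e" "d \<noteq> \<alpha> e" using that T(3,4) e \<open>\<alpha> e \<notin> T\<close> by auto
        then show ?thesis using h(2)[of d] \<psi>(2)[of d] by (simp add: \<psi>0_def)
      qed
      show "h ((\<phi> \<circ> \<alpha>) d) = h d" if "d \<in> X" for d using h(1)[of "\<alpha> d"] that by simp
    qed auto
    then have "\<psi> e = 0" using h(2)[OF \<open>e \<in> X\<close>] \<open>e \<in> X\<close> by simp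
    moreover have "\<psi> e = 1" using \<psi>(2)[of e] e \<alpha>_neq[OF \<open>e \<in> X\<close>] by (simp add: \<psi>0_def)
    ultimately show False by simp
  qed
  then have "T \<union> T' = X" using T(3,4) by auto
  then show ?thesis using euler_iff[OF T(1,2,5,3,4)] by blast
qed

end

section \<open>Potentials on van Kampen diagrams\<close>

lemma support_apply:
  assumes "permutation f" shows "support f (f x) = rotate1 (support f x)"
proof -
  have inj: "inj f" using assms by (simp add: bij_is_inj permutation_bijective)
  have "(f ^^ n) (f x) = f x \<longleftrightarrow> (f ^^ n) x = x" for n
    using inj by (metis funpow_swap1 inj_eq)
  then have "least_power f (f x) = least_power f x"
    using least_power_dvd[OF assms] by (metis dvd_antisym dvd_refl)
  moreover obtain n where n: "least_power f x = Suc n"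
    using least_power_of_permutation(2)[OF assms, of x] gr0_implies_Suc by blast
  moreover have "(f ^^ Suc n) x = x"
    using least_power_of_permutation(1)[OF assms, of x] n by simp
  moreover have "map (\<lambda>i. (f ^^ i) (f x)) [0..<Suc n] = rotate1 (map (\<lambda>i. (f ^^ i) x) [0..<Suc n])"
    if "(f ^^ Suc n) x = x" for n
  proof -
    have "map (\<lambda>i. (f ^^ i) (f x)) [0..<Suc n] = map (\<lambda>i. (f ^^ i) x) [1..<Suc (Suc n)]"
      by (rule nth_equalityI) (auto simp: funpow_swap1 simp del: upt_Suc)
    also have "\<dots> = map (\<lambda>i. (f ^^ i) x) [1..<Suc n] @ [x]"
      using that by simp
    also have "\<dots> = rotate1 (map (\<lambda>i. (f ^^ i) x) (0 # [1..<Suc n]))" by simp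
    also have "0 # [1..<Suc n] = [0..<Suc n]" by (simp add: upt_conv_Cons)
    finally show ?thesis .
  qed
  ultimately show ?thesis by simp
qed

lemma foldr_word_val:
  assumes "R \<subseteq> words m" "w \<in> words m"
  shows "foldr (\<otimes>\<^bsub>presented_group m R\<^esub>) (map (\<lambda>x. word_val m R [x]) w) \<one>\<^bsub>presented_group m R\<^esub>
    = word_val m R w"
  using assms(2)
proof (induction w)
  case Nil
  then show ?case by (simp add: one_presented_group)
next
  case (Cons x w)
  then show ?case using mult_presented_group[OF assms(1), of "[x]" w] by simp
qed

lemma word_val_in_carrier [simp]: "w \<in> words m \<Longrightarrow> word_val m R w \<in> carrier (presented_group m R)"
  by (simp add: carrier_presented_group)

lemma (in group) foldr_mult_closed:
  "set xs \<subseteq> carrier G \<Longrightarrow> foldr (\<otimes>) xs \<one> \<in> carrier G"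
  by (induction xs) auto

lemma (in group) foldr_mult_append:
  "set xs \<subseteq> carrier G \<Longrightarrow> set ys \<subseteq> carrier G \<Longrightarrow>
    foldr (\<otimes>) (xs @ ys) \<one> = foldr (\<otimes>) xs \<one> \<otimes> foldr (\<otimes>) ys \<one>"
  by (induction xs) (auto simp: foldr_mult_closed m_assoc)

lemma (in group) foldr_mult_rotate1:
  assumes "set xs \<subseteq> carrier G" "foldr (\<otimes>) xs \<one> = \<one>"
  shows "foldr (\<otimes>) (rotate1 xs) \<one> = \<one>"
proof (cases xs)
  case (Cons x ys)
  have c: "x \<in> carrier G" "foldr (\<otimes>) ys \<one> \<in> carrier G"
    using assms Cons foldr_mult_closed by auto
  then have "foldr (\<otimes>) ys \<one> \<otimes> x = \<one>" using assms Cons inv_comm by auto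
  moreover have "foldr (\<otimes>) (ys @ [x]) \<one> = foldr (\<otimes>) ys \<one> \<otimes> x"
    using foldr_mult_append[of ys "[x]"] assms(1) Cons c by simp
  ultimately show ?thesis using Cons by simp
qed simp

lemma (in group) telescope:
  assumes "\<And>i. i \<le> n \<Longrightarrow> h i \<in> carrier G" "\<And>i. i < n \<Longrightarrow> g i \<in> carrier G"
    and "\<And>i. k \<le> i \<Longrightarrow> i < n \<Longrightarrow> h (Suc i) = h i \<otimes> g i" and "k \<le> n"
  shows "h k \<otimes> foldr (\<otimes>) (map g [k..<n]) \<one> = h n"
  using assms(4,3)
proof (induction rule: inc_induct)
  case base
  then show ?case using assms(1) by simp
next
  case (step j)
  have "[j..<n] = j # [Suc j..<n]" using step.hyps by (simp add: upt_conv_Cons)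
  moreover have "foldr (\<otimes>) (map g [Suc j..<n]) \<one> \<in> carrier G"
    using assms(2) by (intro foldr_mult_closed) auto
  ultimately have "h j \<otimes> foldr (\<otimes>) (map g [j..<n]) \<one> = h (Suc j) \<otimes> foldr (\<otimes>) (map g [Suc j..<n]) \<one>"
    using step assms(1)[of j] assms(2)[of j] by (simp add: m_assoc)
  also have "\<dots> = h n" using step by simp
  finally show ?case .
qed

text \<open>A tree has no cycles, so there is no consistency to check: the value on a new orbit is
  defined by the edge that attaches it.\<close>

lemma (in dart_perm) grow_potential:
  fixes G (structure)
  assumes "group G" and g: "\<And>d. d \<in> X \<Longrightarrow> g d \<in> carrier G"
    "\<And>d. d \<in> X \<Longrightarrow> g (\<alpha> d) = inv\<^bsub>G\<^esub> (g d)"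
    and "grow \<sigma> \<alpha> M r S T" "r \<in> X" "M \<subseteq> X" "\<alpha> ` M \<subseteq> M"
  shows "\<exists>h. (\<forall>d\<in>S. h d \<in> carrier G \<and> h (\<sigma> d) = h d) \<and> (\<forall>d\<in>T. h (\<alpha> d) = h d \<otimes>\<^bsub>G\<^esub> g d)"
  using assms(4-)
proof induction
  case root
  then show ?case
    using group.is_monoid[OF \<open>group G\<close>] by (intro exI[of _ "\<lambda>_. \<one>\<^bsub>G\<^esub>"]) (simp add: monoid.one_closed)
next
  case (step S T c)
  interpret group G by fact
  note sub = grow_facts[OF step.hyps(1) step.prems]
  obtain h where h: "\<And>d. d \<in> S \<Longrightarrow> h d \<in> carrier G" "\<And>d. d \<in> S \<Longrightarrow> h (\<sigma> d) = h d"
    "\<And>d. d \<in> T \<Longrightarrow> h (\<alpha> d) = h d \<otimes> g d"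
    using step by blast
  let ?O = "orbit \<sigma> (\<alpha> c)"
  have c: "c \<in> X" "c \<in> S" "\<alpha> c \<in> X" "\<alpha> (\<alpha> c) = c" using sub(1) step.hyps(2) by auto
  have disj: "?O \<inter> S = {}"
    by (rule grow_disjoint[OF step.hyps(1) step.prems]) (use c step.hyps in auto)
  define h' where "h' = (\<lambda>e. if e \<in> ?O then h c \<otimes> g c else h e)"
  have hc: "h c \<in> carrier G" "g c \<in> carrier G" "g (\<alpha> c) = inv g c" using h g c by auto
  have S: "h' e = h e" if "e \<in> S" for e using that disj by (auto simp: h'_def)
  have O: "h' e = h c \<otimes> g c" if "e \<in> ?O" for e using that by (simp add: h'_def)
  have \<sigma>S: "\<sigma> e \<in> S" if "e \<in> S" for e using sub(6) that orbit.base[of \<sigma> e] by fast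
  show ?case
  proof (intro exI[of _ h'] conjI ballI)
    fix d assume d: "d \<in> S \<union> ?O"
    show "h' d \<in> carrier G" using d S O h(1) hc by (cases "d \<in> ?O") auto
    show "h' (\<sigma> d) = h' d"
    proof (cases "d \<in> ?O")
      case True
      then have "\<sigma> d \<in> ?O" by (rule orbit.step)
      then show ?thesis using O True by simp
    next
      case False
      then show ?thesis using d S \<sigma>S h(2) by simp
    qed
  next
    fix d assume "d \<in> insert c (insert (\<alpha> c) T)"
    then consider "d = c" | "d = \<alpha> c" | "d \<in> T" by blast
    then show "h' (\<alpha> d) = h' d \<otimes> g d"
    proof cases
      case 1
      then show ?thesis using S[OF c(2)] O[of "\<alpha> c"] by simp
    next
      case 2
      then show ?thesis using S[OF c(2)] O[of "\<alpha> c"] c hc by (simp add: m_assoc)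
    next
      case 3
      then have "d \<in> S" "\<alpha> d \<in> S" using sub(2,4) by auto
      then show ?thesis using S h(3) 3 by simp
    qed
  qed
qed

text \<open>\<open>h d\<close> is the value at the origin of \<open>d\<close>; both
  \<open>\<phi> d\<close> and \<open>\<alpha> d\<close> start where \<open>d\<close> ends. First
  \<open>g\<close> is integrated along a spanning tree. By Euler's formula every other edge lies in
  the cotree, which is peeled from its leaf faces: once the relation holds on all edges of a face
  but one, the trivial product around the face yields the last. The root face is never peeled, which
  is why the condition on faces leaves it out.\<close>

lemma (in dart_map) potential:
  assumes "group G" and g: "\<And>d. d \<in> X \<Longrightarrow> g d \<in> carrier G"
    "\<And>d. d \<in> X \<Longrightarrow> g (\<alpha> d) = inv\<^bsub>G\<^esub> (g d)"
    and euler: "card (orbit (\<phi> \<circ> \<alpha>) ` X) + card (orbit \<phi> ` X) = card (orbit \<alpha> ` X) + 2"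
    and face: "\<And>d. d \<in> X \<Longrightarrow> d \<notin> orbit \<phi> r \<Longrightarrow>
      foldr (\<otimes>\<^bsub>G\<^esub>) (map g (support \<phi> d)) \<one>\<^bsub>G\<^esub> = \<one>\<^bsub>G\<^esub>"
  obtains h where "\<And>d. d \<in> X \<Longrightarrow> h d \<in> carrier G" "\<And>d. d \<in> X \<Longrightarrow> h (\<phi> d) = h (\<alpha> d)"
    "\<And>d. d \<in> X \<Longrightarrow> h (\<alpha> d) = h d \<otimes>\<^bsub>G\<^esub> g d"
proof -
  interpret G: group G by fact
  obtain T T' where T: "grow (\<phi> \<circ> \<alpha>) \<alpha> X r X T" "grow \<phi> \<alpha> (X - T) r X T'"
    "T \<subseteq> X" "T' \<subseteq> X - T" "\<And>d. d \<in> T \<Longrightarrow> \<alpha> d \<in> T" "\<And>d. d \<in> T' \<Longrightarrow> \<alpha> d \<in> T'"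
    by (rule tree_cotree) blast
  have M: "X - T \<subseteq> X" "\<alpha> ` (X - T) \<subseteq> X - T" using \<alpha>_Diff[OF T(5)] by auto
  have un: "T \<union> T' = X" using euler_iff[OF T(1,2,5,3,4)] euler by blast
  have "X \<subseteq> X" "\<alpha> ` X \<subseteq> X" by auto
  then obtain h where h: "\<And>d. d \<in> X \<Longrightarrow> h d \<in> carrier G" "\<And>d. d \<in> X \<Longrightarrow> h ((\<phi> \<circ> \<alpha>) d) = h d"
    "\<And>d. d \<in> T \<Longrightarrow> h (\<alpha> d) = h d \<otimes>\<^bsub>G\<^esub> g d"
    using vertex.grow_potential[where g = g, OF \<open>group G\<close> g T(1) r_in] by blast
  have \<phi>h: "h (\<phi> d) = h (\<alpha> d)" if "d \<in> X" for d using h(2)[of "\<alpha> d"] that by simp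
  have "h (\<alpha> d) = h d \<otimes>\<^bsub>G\<^esub> g d" if "d \<in> X" for d
  proof (rule face.grow_peel[OF T(2) r_in M _ _ _ that])
    fix d assume "d \<in> X" "d \<notin> T'"
    then show "h (\<alpha> d) = h d \<otimes>\<^bsub>G\<^esub> g d" using un h(3) by blast
  next
    fix d assume d: "d \<in> X" "h (\<alpha> d) = h d \<otimes>\<^bsub>G\<^esub> g d"
    then show "h (\<alpha> (\<alpha> d)) = h (\<alpha> d) \<otimes>\<^bsub>G\<^esub> g (\<alpha> d)"
      using h(1) g by (simp add: G.m_assoc)
  next
    fix d assume d: "d \<in> X" "d \<notin> orbit \<phi> r"
      and good: "\<And>e. e \<in> orbit \<phi> d \<Longrightarrow> e \<noteq> d \<Longrightarrow> h (\<alpha> e) = h e \<otimes>\<^bsub>G\<^esub> g e"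
    have p: "permutation \<phi>" using finite_darts \<phi>_perm by (auto simp: permutation_permutes)
    define n where "n = least_power \<phi> d"
    have n: "(\<phi> ^^ n) d = d" "n > 0"
      unfolding n_def using least_power_of_permutation[OF p, of d] by auto
    have in_orb: "(\<phi> ^^ i) d \<in> orbit \<phi> d" for i
      by (rule funpow_in_orbit) simp
    have in_X: "(\<phi> ^^ i) d \<in> X" for i
      using in_orb[of i] face.orbit_sub[OF d(1)] by (rule subsetD[rotated])
    \<comment> \<open>Around the face from the end of \<open>d\<close> back to its origin, along
      every edge except \<open>d\<close> itself.\<close>
    have "h ((\<phi> ^^ 1) d) \<otimes>\<^bsub>G\<^esub> foldr (\<otimes>\<^bsub>G\<^esub>) (map (\<lambda>i. g ((\<phi> ^^ i) d)) [1..<n]) \<one>\<^bsub>G\<^esub> = h ((\<phi> ^^ n) d)"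
    proof (rule G.telescope)
      fix i assume i: "1 \<le> i" "i < n"
      then have "(\<phi> ^^ i) d \<noteq> d" using least_power_le[of i \<phi> d] by (auto simp: n_def)
      then show "h ((\<phi> ^^ Suc i) d) = h ((\<phi> ^^ i) d) \<otimes>\<^bsub>G\<^esub> g ((\<phi> ^^ i) d)"
        using good[OF in_orb] \<phi>h[OF in_X] by simp
    qed (use h g in_X n in auto)
    moreover
    let ?P = "foldr (\<otimes>\<^bsub>G\<^esub>) (map (\<lambda>i. g ((\<phi> ^^ i) d)) [1..<n]) \<one>\<^bsub>G\<^esub>"
    have P: "?P \<in> carrier G" using g in_X by (intro G.foldr_mult_closed) auto
    have "map g (support \<phi> d) = g d # map (\<lambda>i. g ((\<phi> ^^ i) d)) [1..<n]"
      using n(2) unfolding n_def by (simp add: upt_conv_Cons comp_def)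
    then have "g d \<otimes>\<^bsub>G\<^esub> ?P = \<one>\<^bsub>G\<^esub>" using face[OF d] by simp
    then have "?P = inv\<^bsub>G\<^esub> g d" using G.inv_equality G.inv_comm P g d(1) by metis
    ultimately have "h (\<phi> d) \<otimes>\<^bsub>G\<^esub> inv\<^bsub>G\<^esub> g d = h d" using n(1) by simp
    then have "h (\<phi> d) = h d \<otimes>\<^bsub>G\<^esub> g d"
      using h(1) g d(1) G.inv_solve_right by (metis \<phi>_in)
    then show "h (\<alpha> d) = h d \<otimes>\<^bsub>G\<^esub> g d" using \<phi>h d(1) by simp
  qed
  then show thesis using h(1) \<phi>h by (intro that)
qed

lemma set_support:
  assumes "permutation f" shows "set (support f d) = orbit f d"
  unfolding support_set[OF assms] orbit_altdef_permutation[OF assms] by auto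

lemma card_orbit_least_power:
  assumes "permutation f" shows "card (orbit f d) = least_power f d"
  using distinct_card[OF cycle_of_permutation[OF assms, of d]] set_support[OF assms, of d] by simp

lemma relator_val:
  assumes "R \<subseteq> words m" "w \<in> R \<or> word_inv w \<in> R"
  shows "word_val m R w = word_val m R []"
proof -
  have *: "(r, []) \<in> pres_rel m R" if "r \<in> R" for r
    using pres_rel.relator[of "[]" m "[]" r R] that by simp
  show ?thesis
    using assms(2)
  proof
    assume "w \<in> R"
    then show ?thesis using * word_val_eq_iff[OF assms(1), of w "[]"] assms(1) by auto
  next
    assume w: "word_inv w \<in> R"
    then have "w \<in> words m" using assms(1) word_inv_in_words by blast
    then have "(word_inv w @ w, w) \<in> pres_rel m R"
      using pres_rel_append[OF assms(1) *[OF w] pres_rel.refl[of w]] by simp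
    then have "(w, []) \<in> pres_rel m R"
      using pres_rel_word_inv[OF \<open>w \<in> words m\<close>, of R] pres_rel.sym pres_rel.trans by metis
    then show ?thesis using word_val_eq_iff[OF assms(1) \<open>w \<in> words m\<close>, of "[]"] by simp
  qed
qed

lemma word_val_letter_inv:
  assumes "R \<subseteq> words m" "x \<in> letters m"
  shows "word_val m R [letter_inv x] = inv\<^bsub>presented_group m R\<^esub> word_val m R [x]"
proof -
  interpret group "presented_group m R" by (rule group_presented_group[OF assms(1)])
  have "([letter_inv x, x], []) \<in> pres_rel m R"
    using pres_rel.cancel[of "[]" m "[]" "letter_inv x" R] assms(2) by simp
  then have "word_val m R [letter_inv x, x] = word_val m R []"
    using word_val_eq_iff[OF assms(1), of "[letter_inv x, x]" "[]"] assms(2) by simp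
  then have "word_val m R [letter_inv x] \<otimes>\<^bsub>presented_group m R\<^esub> word_val m R [x] = \<one>\<^bsub>presented_group m R\<^esub>"
    using mult_presented_group[OF assms(1), of "[letter_inv x]" "[x]"] assms(2)
    by (simp add: one_presented_group)
  then show ?thesis by (intro inv_equality[symmetric]) (use assms(2) in auto)
qed

locale vk =
  fixes m :: nat and R :: "word set" and D :: diagram
  assumes R: "R \<subseteq> words m" and vk: "vk_diagram m R D" and ne: "darts D \<noteq> {}"
begin

abbreviation X where "X \<equiv> darts D"
abbreviation \<alpha> where "\<alpha> \<equiv> dinv D"
abbreviation \<phi> where "\<phi> \<equiv> dnext D"
abbreviation G where "G \<equiv> presented_group m R"
abbreviation out where "out \<equiv> orbit \<phi> (dbase D)"

lemma fin: "finite X" and perm_\<phi>: "\<phi> permutes X" and base_in: "dbase D \<in> X"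
  and label_in: "d \<in> X \<Longrightarrow> dlabel D d \<in> letters m"
  and label_inv: "d \<in> X \<Longrightarrow> dlabel D (\<alpha> d) = letter_inv (dlabel D d)"
  and faces: "f \<in> inner_faces D \<Longrightarrow> \<exists>d\<in>f. dword D d \<in> R \<or> word_inv (dword D d) \<in> R"
  using vk ne unfolding vk_diagram_def by blast+

sublocale dart_map X \<alpha> \<phi> "dbase D"
proof
  fix Y assume Y: "Y \<subseteq> X" "dbase D \<in> Y" "\<phi> ` Y \<subseteq> Y" "\<alpha> ` Y \<subseteq> Y"
  have "d \<in> Y" if "d \<in> X" for d
  proof -
    have "(dbase D, d) \<in> {(z, z'). z' = \<alpha> z \<or> z' = \<phi> z}\<^sup>*"
      using vk ne that base_in unfolding vk_diagram_def dconnected_def by blast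
    then show ?thesis by induction (use Y in auto)
  qed
  then show "Y = X" using Y(1) by blast
qed (use vk ne in \<open>auto simp: vk_diagram_def\<close>)

lemma permutation_\<phi>: "permutation \<phi>"
  using fin perm_\<phi> by (auto simp: permutation_permutes)

lemma dword_in_words:
  assumes "d \<in> X" shows "dword D d \<in> words m"
proof -
  have "set (dword D d) = dlabel D ` orbit \<phi> d"
    unfolding dword_def by (subst set_map) (simp only: set_support[OF permutation_\<phi>])
  then show ?thesis
    using face.orbit_sub[OF assms] label_in by (auto simp: words_def lists_eq_set)
qed

lemma dword_val:
  assumes "d \<in> X"
  shows "foldr (\<otimes>\<^bsub>G\<^esub>) (map (\<lambda>e. word_val m R [dlabel D e]) (support \<phi> d)) \<one>\<^bsub>G\<^esub>
    = word_val m R (dword D d)"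
  using foldr_word_val[OF R dword_in_words[OF assms]] by (simp add: dword_def comp_def)

text \<open>The relator is read from some dart of the face; moving the starting point conjugates the
  value, which stays trivial.\<close>

lemma inner_face_val:
  assumes "d \<in> X" "d \<notin> out"
  shows "foldr (\<otimes>\<^bsub>G\<^esub>) (map (\<lambda>e. word_val m R [dlabel D e]) (support \<phi> d)) \<one>\<^bsub>G\<^esub> = \<one>\<^bsub>G\<^esub>"
proof -
  interpret group G by (rule group_presented_group[OF R])
  have "orbit \<phi> d \<in> inner_faces D"
    using assms face.self_orbit[of d] by (auto simp: inner_faces_def dfaces_def)
  then obtain e where e: "e \<in> orbit \<phi> d" "dword D e \<in> R \<or> word_inv (dword D e) \<in> R"
    using faces by blast
  have "e \<in> X" using e(1) face.orbit_sub[OF assms(1)] by blast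
  have "d \<in> orbit \<phi> e" using face.orbit_eq[OF e(1)] by simp
  moreover have "foldr (\<otimes>\<^bsub>G\<^esub>) (map (\<lambda>e. word_val m R [dlabel D e]) (support \<phi> (\<phi> c))) \<one>\<^bsub>G\<^esub> = \<one>\<^bsub>G\<^esub>"
    if "foldr (\<otimes>\<^bsub>G\<^esub>) (map (\<lambda>e. word_val m R [dlabel D e]) (support \<phi> c)) \<one>\<^bsub>G\<^esub> = \<one>\<^bsub>G\<^esub>" "c \<in> X" for c
    unfolding support_apply[OF permutation_\<phi>] rotate1_map[symmetric]
  proof (rule foldr_mult_rotate1[OF _ that(1)])
    have "set (support \<phi> c) \<subseteq> X"
      unfolding set_support[OF permutation_\<phi>] by (rule face.orbit_sub[OF that(2)])
    then show "set (map (\<lambda>e. word_val m R [dlabel D e]) (support \<phi> c)) \<subseteq> carrier G"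
      using label_in by auto
  qed
  moreover have "foldr (\<otimes>\<^bsub>G\<^esub>) (map (\<lambda>e. word_val m R [dlabel D e]) (support \<phi> e)) \<one>\<^bsub>G\<^esub> = \<one>\<^bsub>G\<^esub>"
    using dword_val[OF \<open>e \<in> X\<close>] relator_val[OF R e(2)] by (simp add: one_presented_group)
  ultimately have "foldr (\<otimes>\<^bsub>G\<^esub>) (map (\<lambda>e. word_val m R [dlabel D e]) (support \<phi> d)) \<one>\<^bsub>G\<^esub> = \<one>\<^bsub>G\<^esub> \<and> d \<in> X"
    using \<open>e \<in> X\<close> by (induction d rule: orbit.induct) auto
  then show ?thesis by blast
qed

lemma card_inner_face:
  assumes "finite R" "f \<in> inner_faces D"
  shows "card f \<le> max_relator_length R"
proof -
  obtain d where d: "d \<in> f" "dword D d \<in> R \<or> word_inv (dword D d) \<in> R"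
    using faces[OF assms(2)] by blast
  obtain c where "f = orbit \<phi> c" using assms(2) by (auto simp: inner_faces_def dfaces_def)
  then have "f = orbit \<phi> d" using d(1) face.orbit_eq by blast
  then have "card f = length (dword D d)"
    using card_orbit_least_power[OF permutation_\<phi>] by (simp add: dword_def)
  moreover have "length r \<le> max_relator_length R" if "r \<in> R" for r
    unfolding max_relator_length_def using assms(1) that by (intro Max_ge) auto
  moreover have "length (word_inv w) = length w" for w by (simp add: word_inv_def)
  ultimately show ?thesis using d(2) by metis
qed

text \<open>This is the map from the 1-skeleton to the Cayley graph of \<open>G\<close>. A left
  translation moves the base vertex to the identity and respects the edge relation, which multiplies
  on the right.\<close>

lemma vk_potential:
  obtains h where "\<And>d. d \<in> X \<Longrightarrow> h d \<in> carrier G" "\<And>d. d \<in> X \<Longrightarrow> h (\<phi> d) = h (\<alpha> d)"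
    "\<And>d. d \<in> X \<Longrightarrow> h (\<alpha> d) = h d \<otimes>\<^bsub>G\<^esub> word_val m R [dlabel D d]" "h (dbase D) = \<one>\<^bsub>G\<^esub>"
proof -
  interpret group G by (rule group_presented_group[OF R])
  let ?g = "\<lambda>d. word_val m R [dlabel D d]"
  obtain h where h: "\<And>d. d \<in> X \<Longrightarrow> h d \<in> carrier G" "\<And>d. d \<in> X \<Longrightarrow> h (\<phi> d) = h (\<alpha> d)"
    "\<And>d. d \<in> X \<Longrightarrow> h (\<alpha> d) = h d \<otimes>\<^bsub>G\<^esub> ?g d"
  proof (rule potential[where g = ?g, OF is_group])
    show "?g (\<alpha> d) = inv\<^bsub>G\<^esub> ?g d" if "d \<in> X" for d
      using word_val_letter_inv[OF R label_in[OF that]] label_inv[OF that] by simp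
    show "card (orbit (\<phi> \<circ> \<alpha>) ` X) + card (orbit \<phi> ` X) = card (orbit \<alpha> ` X) + 2"
      using vk ne by (auto simp: vk_diagram_def dplanar_def dvertices_def dfaces_def dedges_def)
  qed (use label_in inner_face_val in auto)
  let ?h = "\<lambda>d. inv\<^bsub>G\<^esub> h (dbase D) \<otimes>\<^bsub>G\<^esub> h d"
  show thesis
    by (rule that[of ?h]) (use h label_in base_in in \<open>auto simp: m_assoc\<close>)
qed

lemma boundary_potential:
  assumes h: "\<And>d. d \<in> X \<Longrightarrow> h (\<phi> d) = h (\<alpha> d)"
    "\<And>d. d \<in> X \<Longrightarrow> h (\<alpha> d) = h d \<otimes>\<^bsub>G\<^esub> word_val m R [dlabel D d]" "h (dbase D) = \<one>\<^bsub>G\<^esub>"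
    and "i \<le> length (boundary_word D)"
  shows "h ((\<phi> ^^ i) (dbase D)) = word_val m R (take i (boundary_word D))"
  using assms(4)
proof (induction i)
  case 0
  then show ?case using h(3) by (simp add: one_presented_group)
next
  case (Suc i)
  let ?w = "boundary_word D"
  have w: "?w = dword D (dbase D)" using ne by (simp add: boundary_word_def)
  have d: "(\<phi> ^^ i) (dbase D) \<in> X"
    using face.orbit_sub[OF base_in] funpow_in_orbit[of "dbase D" \<phi> "dbase D" i] by auto
  have "dlabel D ((\<phi> ^^ i) (dbase D)) = ?w ! i" using Suc.prems by (simp add: w dword_def)
  moreover have "take (Suc i) ?w = take i ?w @ [?w ! i]" using Suc.prems by (simp add: take_Suc_conv_app_nth)
  moreover have "?w \<in> words m" unfolding w by (rule dword_in_words[OF base_in])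
  then have "take i ?w \<in> words m" "[?w ! i] \<in> words m"
    using Suc.prems by (auto simp: words_def dest: in_set_takeD)
  ultimately show ?case
    using Suc h(1,2)[OF d] mult_presented_group[OF R, of "take i ?w" "[?w ! i]"] by simp
qed

lemma length_boundary: "length (boundary_word D) = least_power \<phi> (dbase D)"
  using ne by (simp add: boundary_word_def dword_def)

end

section \<open>Cutting diagrams by a Besicovitch inequality\<close>

lemma even_card_involution:
  fixes Y :: "nat set"
  assumes "finite Y" "\<And>d. d \<in> Y \<Longrightarrow> \<alpha> d \<in> Y" "\<And>d. d \<in> Y \<Longrightarrow> \<alpha> d \<noteq> d" "\<And>d. d \<in> Y \<Longrightarrow> \<alpha> (\<alpha> d) = d"
  shows "even (card Y)"
proof -
  let ?Z = "{d \<in> Y. d < \<alpha> d}"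
  have "Y = ?Z \<union> \<alpha> ` ?Z"
  proof (intro equalityI subsetI)
    fix d assume d: "d \<in> Y"
    show "d \<in> ?Z \<union> \<alpha> ` ?Z"
    proof (cases "d < \<alpha> d")
      case False
      then have "\<alpha> d \<in> ?Z" using assms(2-4)[OF d] by auto
      then have "\<alpha> (\<alpha> d) \<in> \<alpha> ` ?Z" by (rule imageI)
      then show ?thesis using assms(4)[OF d] by simp
    qed (use d in simp)
  qed (use assms(2) in auto)
  moreover have "?Z \<inter> \<alpha> ` ?Z = {}" using assms(4) by force
  moreover have "inj_on \<alpha> ?Z" using assms(4) by (intro inj_onI) (metis mem_Collect_eq)
  ultimately have "card Y = card ?Z + card ?Z"
    using assms(1) card_Un_disjoint[of ?Z "\<alpha> ` ?Z"] card_image[of \<alpha> ?Z] by simp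
  then show ?thesis by simp
qed

lemma even_cyclic_changes:
  fixes P :: "'a \<Rightarrow> bool"
  assumes "finite Z" "bij_betw \<phi> Z Z"
  shows "even (card {d \<in> Z. P d \<noteq> P (\<phi> d)})"
proof -
  have "card {d \<in> Z. P (\<phi> d)} = card (\<phi> ` {d \<in> Z. P (\<phi> d)})"
    using assms(2) by (intro card_image[symmetric]) (auto simp: bij_betw_def inj_on_def)
  also have "\<phi> ` {d \<in> Z. P (\<phi> d)} = {d \<in> Z. P d}"
    using assms(2) by (auto simp: bij_betw_def)
  finally have *: "card {d \<in> Z. P (\<phi> d)} = card {d \<in> Z. P d}" .
  have "card {d \<in> Z. P d} = card {d \<in> Z. P d \<and> P (\<phi> d)} + card {d \<in> Z. P d \<and> \<not> P (\<phi> d)}"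
    using assms(1) by (subst card_Un_disjoint[symmetric]) (auto intro: arg_cong[of _ _ card])
  moreover have "card {d \<in> Z. P (\<phi> d)} = card {d \<in> Z. P d \<and> P (\<phi> d)} + card {d \<in> Z. \<not> P d \<and> P (\<phi> d)}"
    using assms(1) by (subst card_Un_disjoint[symmetric]) (auto intro: arg_cong[of _ _ card])
  moreover have "card {d \<in> Z. P d \<noteq> P (\<phi> d)} = card {d \<in> Z. P d \<and> \<not> P (\<phi> d)} + card {d \<in> Z. \<not> P d \<and> P (\<phi> d)}"
    using assms(1) by (subst card_Un_disjoint[symmetric]) (auto intro: arg_cong[of _ _ card])
  ultimately show ?thesis using * by simp
qed

lemma odd_changes_iff:
  fixes P :: "nat \<Rightarrow> bool"
  assumes "a \<le> b"
  shows "odd (card {i \<in> {a..<b}. P i \<noteq> P (Suc i)}) \<longleftrightarrow> P a \<noteq> P b"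
  using assms
proof (induction b rule: dec_induct)
  case (step n)
  let ?I = "{i \<in> {a..<n}. P i \<noteq> P (Suc i)}"
  have I: "i \<in> {a..<Suc n} \<longleftrightarrow> i = n \<or> i \<in> {a..<n}" for i using step.hyps by auto
  show ?case
  proof (cases "P n = P (Suc n)")
    case True
    then have "{i \<in> {a..<Suc n}. P i \<noteq> P (Suc i)} = ?I" unfolding I by blast
    then show ?thesis using step.IH True by simp
  next
    case False
    then have "{i \<in> {a..<Suc n}. P i \<noteq> P (Suc i)} = insert n ?I" unfolding I by blast
    moreover have "n \<notin> ?I" by simp
    ultimately have "card {i \<in> {a..<Suc n}. P i \<noteq> P (Suc i)} = Suc (card ?I)"
      by (simp only: card_insert_disjoint finite_Collect_conjI finite_atLeastLessThan Collect_mem_eq) simp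
    then show ?thesis using step.IH False by auto
  qed
qed simp

text \<open>Level sets of a function on vertices, stated on edges: \<open>f d\<close> belongs to the
  origin of \<open>d\<close> and \<open>f (\<alpha> d)\<close> to its end.\<close>

definition crosses :: "(nat \<Rightarrow> nat) \<Rightarrow> (nat \<Rightarrow> nat) \<Rightarrow> nat \<Rightarrow> nat \<Rightarrow> bool" where
  "crosses \<alpha> f t d \<longleftrightarrow> (f d \<le> t) \<noteq> (f (\<alpha> d) \<le> t)"

context vk
begin

lemma inner_face_sub:
  assumes "f \<in> inner_faces D"
  shows "f \<subseteq> X - out" "d \<in> f \<Longrightarrow> orbit \<phi> d = f"
proof -
  obtain c where c: "c \<in> X" "f = orbit \<phi> c" "f \<noteq> out"
    using assms by (auto simp: inner_faces_def dfaces_def)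
  show *: "orbit \<phi> d = f" if "d \<in> f" for d using face.orbit_eq that c(2) by simp
  have "d \<notin> out" if "d \<in> f" for d using *[OF that] face.orbit_eq[of d "dbase D"] c(3) by auto
  then show "f \<subseteq> X - out" using face.orbit_sub[OF c(1)] c(2) by blast
qed

lemma Union_inner_faces: "\<Union> (inner_faces D) = X - out"
proof -
  have "d \<in> \<Union> (inner_faces D)" if "d \<in> X - out" for d
  proof -
    have "orbit \<phi> d \<in> inner_faces D"
      using that face.self_orbit[of d] by (auto simp: inner_faces_def dfaces_def)
    then show ?thesis using face.self_orbit[of d] by blast
  qed
  then show ?thesis using inner_face_sub(1) by blast
qed

lemma finite_inner_faces: "finite (inner_faces D)"
  using fin by (simp add: inner_faces_def dfaces_def)

lemma even_card_outside:
  assumes "Y \<subseteq> X" "\<And>f. f \<in> inner_faces D \<Longrightarrow> even (card (Y \<inter> f))"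
  shows "even (card (Y - out))"
proof -
  have "Y - out = (\<Union>f\<in>inner_faces D. Y \<inter> f)" using Union_inner_faces assms(1) by blast
  moreover have "card (\<Union>f\<in>inner_faces D. Y \<inter> f) = (\<Sum>f\<in>inner_faces D. card (Y \<inter> f))"
  proof (rule card_UN_disjoint[OF finite_inner_faces])
    show "\<forall>f\<in>inner_faces D. finite (Y \<inter> f)" using assms(1) fin by (auto intro: finite_subset)
    show "\<forall>f\<in>inner_faces D. \<forall>f'\<in>inner_faces D. f \<noteq> f' \<longrightarrow> Y \<inter> f \<inter> (Y \<inter> f') = {}"
    proof (intro ballI impI)
      fix f f' assume "f \<in> inner_faces D" "f' \<in> inner_faces D" "f \<noteq> f'"
      then have "d \<notin> f'" if "d \<in> f" for d
        using inner_face_sub(2)[of f d] inner_face_sub(2)[of f' d] that by auto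
      then show "Y \<inter> f \<inter> (Y \<inter> f') = {}" by auto
    qed
  qed
  ultimately show ?thesis using assms(2) by (simp add: dvd_sum)
qed

text \<open>A discrete form of the fact that curves joining opposite sides of a square meet. On the
  arcs \<open>0..a\<close> and \<open>b..c\<close> the function \<open>f1\<close> stays on one side
  of the level \<open>t\<close>, and on \<open>c..l\<close> the bound \<open>s < f2\<close> excludes
  every edge. So the parity along the outer face is decided on \<open>a..b\<close>, where
  \<open>f1\<close> goes from 0 to above \<open>t\<close> while \<open>f2\<close> is zero.\<close>

lemma crossing:
  fixes f1 f2 :: "nat \<Rightarrow> nat"
  defines "F1 \<equiv> \<lambda>i. f1 ((\<phi> ^^ i) (dbase D))" and "F2 \<equiv> \<lambda>i. f2 ((\<phi> ^^ i) (dbase D))"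
    and "l \<equiv> least_power \<phi> (dbase D)"
  assumes f1: "\<And>d. d \<in> X \<Longrightarrow> f1 (\<phi> d) = f1 (\<alpha> d)"
    and f2: "\<And>d. d \<in> X \<Longrightarrow> f2 (\<phi> d) = f2 (\<alpha> d)"
    and abc: "a \<le> b" "b \<le> c" "c \<le> l"
    and arcs: "\<And>i. i \<le> a \<Longrightarrow> F1 i = 0" "\<And>i. b \<le> i \<Longrightarrow> i \<le> c \<Longrightarrow> t < F1 i"
      "\<And>i. a \<le> i \<Longrightarrow> i \<le> b \<Longrightarrow> F2 i = 0" "\<And>i. c \<le> i \<Longrightarrow> i \<le> l \<Longrightarrow> s < F2 i"
  shows "(\<exists>f\<in>inner_faces D. (\<exists>d\<in>f. crosses \<alpha> f1 t d) \<and> (\<exists>d\<in>f. crosses \<alpha> f2 s d)) \<or>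
    (\<exists>i<l. crosses \<alpha> f1 t ((\<phi> ^^ i) (dbase D)) \<and> crosses \<alpha> f2 s ((\<phi> ^^ i) (dbase D)))"
proof (rule ccontr)
  assume "\<not> ?thesis"
  then have no_face: "\<And>f d e. f \<in> inner_faces D \<Longrightarrow> d \<in> f \<Longrightarrow> e \<in> f \<Longrightarrow> crosses \<alpha> f1 t d \<Longrightarrow>
      \<not> crosses \<alpha> f2 s e"
    and no_out: "\<And>i. i < l \<Longrightarrow> crosses \<alpha> f1 t ((\<phi> ^^ i) (dbase D)) \<Longrightarrow>
      \<not> crosses \<alpha> f2 s ((\<phi> ^^ i) (dbase D))"
    by blast+
  have out: "out = (\<lambda>i. (\<phi> ^^ i) (dbase D)) ` {..<l}"
    using set_support[OF permutation_\<phi>, of "dbase D"] by (simp add: l_def atLeast0LessThan)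
  have "\<not> crosses \<alpha> f2 s d" if "d \<in> X" "crosses \<alpha> f1 t d" for d
  proof (cases "d \<in> out")
    case True
    then show ?thesis using no_out that out by auto
  next
    case False
    then have "d \<in> \<Union> (inner_faces D)" using that Union_inner_faces by simp
    then show ?thesis using no_face that by blast
  qed
  note no_both = this
  txt \<open>This set has an even number of elements in total and in every inner face, but an odd number in
    the outer face.\<close>
  define Y where "Y = {d \<in> X. crosses \<alpha> f1 t d \<and> f2 d \<le> s}"
  have "Y \<subseteq> X" by (auto simp: Y_def)
  then have "finite Y" using fin finite_subset by blast
  \<comment> \<open>\<open>\<alpha>\<close> acts on \<open>Y\<close> without fixed points: an edge
    crossing the level \<open>t\<close> does not cross the level \<open>s\<close>, so both of its
    ends satisfy \<open>f2 \<le> s\<close>.\<close>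
  have "even (card Y)"
  proof (rule even_card_involution[OF \<open>finite Y\<close>])
    fix d assume d: "d \<in> Y"
    then have "\<not> crosses \<alpha> f2 s d" using no_both by (auto simp: Y_def)
    then show "\<alpha> d \<in> Y" using d by (auto simp: Y_def crosses_def)
    show "\<alpha> d \<noteq> d" using \<alpha>_neq d by (auto simp: Y_def)
  qed simp
  moreover have "even (card (Y - out))"
  proof (rule even_card_outside[OF \<open>Y \<subseteq> X\<close>])
    fix f assume f: "f \<in> inner_faces D"
    note fX = inner_face_sub[OF f]
    show "even (card (Y \<inter> f))"
    proof (cases "Y \<inter> f = {}")
      case False
      then obtain d where d: "d \<in> f" "crosses \<alpha> f1 t d" "f2 d \<le> s" by (auto simp: Y_def)
      \<comment> \<open>The face crosses the level \<open>t\<close>, hence nowhere the level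
        \<open>s\<close>. So \<open>f2 \<le> s\<close> holds all around it, and what remains is to
        count the changes of \<open>f1 \<le> t\<close> along a cycle.\<close>
      have "f2 e \<le> s \<and> e \<in> f" if "e \<in> orbit \<phi> d" for e
        using that
      proof induction
        case base
        have "\<not> crosses \<alpha> f2 s d" using no_face[OF f d(1) d(1,2)] .
        then show ?case
          using d fX(1) f2[of d] fX(2)[OF d(1)] orbit.base[of \<phi> d] by (auto simp: crosses_def)
      next
        case (step y)
        then have "\<not> crosses \<alpha> f2 s y" using no_face[OF f d(1) _ d(2)] by blast
        then show ?case
          using step fX(1) f2[of y] fX(2)[OF d(1)] orbit.step[of y \<phi> d] by (auto simp: crosses_def)
      qed
      then have "Y \<inter> f = {e \<in> f. (f1 e \<le> t) \<noteq> (f1 (\<phi> e) \<le> t)}"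
        using fX f1 d(1) by (auto simp: Y_def crosses_def)
      moreover have "even (card {e \<in> f. (f1 e \<le> t) \<noteq> (f1 (\<phi> e) \<le> t)})"
      proof (rule even_cyclic_changes)
        show "finite f" using fX(1) fin by (meson Diff_subset finite_subset)
        moreover have "\<phi> ` f \<subseteq> f"
          using fX(2)[OF d(1)] orbit.step[of _ \<phi> d] by blast
        moreover have "inj_on \<phi> f"
          using permutes_inj[OF perm_\<phi>] by (rule inj_on_subset) simp
        ultimately show "bij_betw \<phi> f f"
          by (simp add: bij_betw_def endo_inj_surj)
      qed
      ultimately show ?thesis by simp
    qed simp
  qed
  moreover have "card Y = card (Y \<inter> out) + card (Y - out)"
    using card_Int_Diff[OF \<open>finite Y\<close>] .
  moreover have "odd (card (Y \<inter> out))"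
  proof -
    have P: "(\<phi> ^^ i) (dbase D) \<in> X" for i
      using face.orbit_sub[OF base_in] funpow_in_orbit[of "dbase D" \<phi> "dbase D" i] by auto
    let ?I = "{i \<in> {a..<b}. (F1 i \<le> t) \<noteq> (F1 (Suc i) \<le> t)}"
    have cr: "crosses \<alpha> f1 t ((\<phi> ^^ i) (dbase D)) \<longleftrightarrow> (F1 i \<le> t) \<noteq> (F1 (Suc i) \<le> t)" for i
      using f1[OF P] by (simp add: crosses_def F1_def)
    have "i \<in> ?I \<longleftrightarrow> i < l \<and> (F1 i \<le> t) \<noteq> (F1 (Suc i) \<le> t) \<and> F2 i \<le> s" for i
    proof -
      consider "i < a" | "a \<le> i" "i < b" | "b \<le> i" "i < c" | "c \<le> i" "i < l" | "l \<le> i" by linarith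
      then show ?thesis
      proof cases
        case 1
        then show ?thesis using arcs(1)[of i] arcs(1)[of "Suc i"] by simp
      next
        case 2
        then show ?thesis using abc arcs(3)[of i] by simp
      next
        case 3
        then show ?thesis using arcs(2)[of i] arcs(2)[of "Suc i"] by simp
      next
        case 4
        then show ?thesis using abc arcs(4)[of i] by simp
      qed (use abc in simp)
    qed
    then have "Y \<inter> out = (\<lambda>i. (\<phi> ^^ i) (dbase D)) ` ?I"
      using P cr by (auto simp: Y_def out F2_def)
    moreover have "inj_on (\<lambda>i. (\<phi> ^^ i) (dbase D)) {..<l}"
      using cycle_of_permutation[OF permutation_\<phi>, of "dbase D"]
      by (simp add: distinct_map l_def atLeast0LessThan)
    then have "inj_on (\<lambda>i. (\<phi> ^^ i) (dbase D)) ?I"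
      by (rule inj_on_subset) (use abc in auto)
    ultimately have "card (Y \<inter> out) = card ?I" by (simp add: card_image)
    moreover have "odd (card ?I)"
      using odd_changes_iff[OF abc(1), of "\<lambda>i. F1 i \<le> t"] arcs(1)[of a] arcs(2)[of b] abc by simp
    ultimately show ?thesis by simp
  qed
  ultimately show False by simp
qed

text \<open>Every pair of levels below \<open>(D1, D2)\<close> is charged to an inner face or a
  boundary edge found by \<open>crossing\<close>. As \<open>f1\<close> and \<open>f2\<close> are
  1-Lipschitz, an edge crosses at most one level of each, the smaller of its two end values; so a
  face \<open>f\<close> receives at most \<open>card f * card f\<close> pairs and a boundary edge at
  most one.\<close>

lemma besicovitch:
  fixes f1 f2 :: "nat \<Rightarrow> nat"
  defines "F1 \<equiv> \<lambda>i. f1 ((\<phi> ^^ i) (dbase D))" and "F2 \<equiv> \<lambda>i. f2 ((\<phi> ^^ i) (dbase D))"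
    and "l \<equiv> least_power \<phi> (dbase D)"
  assumes f1: "\<And>d. d \<in> X \<Longrightarrow> f1 (\<phi> d) = f1 (\<alpha> d)" "\<And>d. d \<in> X \<Longrightarrow> f1 (\<alpha> d) \<le> Suc (f1 d)"
    and f2: "\<And>d. d \<in> X \<Longrightarrow> f2 (\<phi> d) = f2 (\<alpha> d)" "\<And>d. d \<in> X \<Longrightarrow> f2 (\<alpha> d) \<le> Suc (f2 d)"
    and abc: "a \<le> b" "b \<le> c" "c \<le> l"
    and arcs: "\<And>i. i \<le> a \<Longrightarrow> F1 i = 0" "\<And>i. b \<le> i \<Longrightarrow> i \<le> c \<Longrightarrow> D1 \<le> F1 i"
      "\<And>i. a \<le> i \<Longrightarrow> i \<le> b \<Longrightarrow> F2 i = 0" "\<And>i. c \<le> i \<Longrightarrow> i \<le> l \<Longrightarrow> D2 \<le> F2 i"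
  shows "D1 * D2 \<le> (\<Sum>f\<in>inner_faces D. card f * card f) + l"
proof -
  let ?m1 = "\<lambda>d. min (f1 d) (f1 (\<alpha> d))" and ?m2 = "\<lambda>d. min (f2 d) (f2 (\<alpha> d))"
  let ?p = "\<lambda>i. (\<phi> ^^ i) (dbase D)"
  have min_eq: "t = min (g d) (g (\<alpha> d))"
    if "crosses \<alpha> g t d" "\<And>d. d \<in> X \<Longrightarrow> g (\<alpha> d) \<le> Suc (g d)" "d \<in> X" for g t d
    using that(1) that(2)[of d] that(2)[of "\<alpha> d"] that(3) by (auto simp: crosses_def min_def)
  have m1: "t = ?m1 d" if "crosses \<alpha> f1 t d" "d \<in> X" for t d
    using min_eq[OF that(1) f1(2) that(2)] .
  have m2: "t = ?m2 d" if "crosses \<alpha> f2 t d" "d \<in> X" for t d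
    using min_eq[OF that(1) f2(2) that(2)] .
  have P: "?p i \<in> X" for i
    using face.orbit_sub[OF base_in] funpow_in_orbit[of "dbase D" \<phi> "dbase D" i] by auto
  have finf: "finite f" if "f \<in> inner_faces D" for f
    using inner_face_sub(1)[OF that] fin by (meson Diff_subset finite_subset)
  have "{..<D1} \<times> {..<D2} \<subseteq> (\<Union>f\<in>inner_faces D. ?m1 ` f \<times> ?m2 ` f) \<union> (\<lambda>i. (?m1 (?p i), ?m2 (?p i))) ` {..<l}"
    (is "_ \<subseteq> ?A \<union> ?B")
  proof (rule subsetI)
    fix z assume "z \<in> {..<D1} \<times> {..<D2}"
    then obtain t s where z: "z = (t, s)" "t < D1" "s < D2" by auto
    have "(\<exists>f\<in>inner_faces D. (\<exists>d\<in>f. crosses \<alpha> f1 t d) \<and> (\<exists>d\<in>f. crosses \<alpha> f2 s d)) \<or>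
        (\<exists>i<l. crosses \<alpha> f1 t (?p i) \<and> crosses \<alpha> f2 s (?p i))"
      unfolding l_def
    proof (rule crossing[of f1 f2 a b c t s])
      show "c \<le> least_power \<phi> (dbase D)" using abc(3) by (simp add: l_def)
      show "t < f1 (?p i)" if "b \<le> i" "i \<le> c" for i
        using arcs(2)[OF that] z by (simp add: F1_def)
      show "s < f2 (?p i)" if "c \<le> i" "i \<le> least_power \<phi> (dbase D)" for i
        using arcs(4)[of i] that z by (simp add: F2_def l_def)
    qed (use f1 f2 abc arcs in \<open>simp_all add: F1_def F2_def\<close>)
    then show "z \<in> ?A \<union> ?B"
    proof
      assume "\<exists>f\<in>inner_faces D. (\<exists>d\<in>f. crosses \<alpha> f1 t d) \<and> (\<exists>d\<in>f. crosses \<alpha> f2 s d)"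
      then obtain f d e where f: "f \<in> inner_faces D" "d \<in> f" "e \<in> f" "crosses \<alpha> f1 t d" "crosses \<alpha> f2 s e"
        by blast
      then have "d \<in> X" "e \<in> X" using inner_face_sub(1) by blast+
      then have "t \<in> ?m1 ` f" "s \<in> ?m2 ` f" using m1 m2 f by blast+
      then show ?thesis using f(1) z(1) by blast
    next
      assume "\<exists>i<l. crosses \<alpha> f1 t (?p i) \<and> crosses \<alpha> f2 s (?p i)"
      then obtain i where "i < l" "crosses \<alpha> f1 t (?p i)" "crosses \<alpha> f2 s (?p i)" by blast
      then have "z = (?m1 (?p i), ?m2 (?p i))" "i < l" using m1 m2 P z(1) by blast+
      then show ?thesis by blast
    qed
  qed
  moreover have "finite (?A \<union> ?B)" using finite_inner_faces finf by auto
  ultimately have "card ({..<D1} \<times> {..<D2}) \<le> card (?A \<union> ?B)" by (rule card_mono[rotated])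
  also have "\<dots> \<le> card ?A + card ?B" by (rule card_Un_le)
  also have "card ?B \<le> l" using card_image_le[of "{..<l}"] by simp
  also have "card ?A \<le> (\<Sum>f\<in>inner_faces D. card (?m1 ` f \<times> ?m2 ` f))"
    by (rule card_UN_le[OF finite_inner_faces])
  also have "\<dots> \<le> (\<Sum>f\<in>inner_faces D. card f * card f)"
    using finf by (intro sum_mono) (simp add: card_cartesian_product card_image_le mult_le_mono)
  finally show ?thesis by simp
qed

end

text \<open>The distance of \<open>g\<close> from \<open>S\<close> in the Cayley graph. It is taken
  in the group and not in the diagram because a cut needs only an equality of values in
  \<open>G\<close>, not a path inside the diagram.\<close>

definition gdist :: "nat \<Rightarrow> word set \<Rightarrow> word set set \<Rightarrow> word set \<Rightarrow> nat" where
  "gdist m R S g = (LEAST n. \<exists>x\<in>S. \<exists>p\<in>words m. length p = n \<and>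
     g = x \<otimes>\<^bsub>presented_group m R\<^esub> word_val m R p)"

lemma gdist_le:
  assumes "x \<in> S" "p \<in> words m" "g = x \<otimes>\<^bsub>presented_group m R\<^esub> word_val m R p"
  shows "gdist m R S g \<le> length p"
  unfolding gdist_def using assms by (intro Least_le) blast

lemma gdist_attained:
  assumes R: "R \<subseteq> words m" and "x \<in> S" "S \<subseteq> carrier (presented_group m R)" "g \<in> carrier (presented_group m R)"
  shows "\<exists>x\<in>S. \<exists>p\<in>words m. length p = gdist m R S g \<and>
     g = x \<otimes>\<^bsub>presented_group m R\<^esub> word_val m R p"
proof -
  interpret group "presented_group m R" by (rule group_presented_group[OF R])
  have x: "x \<in> carrier (presented_group m R)" using assms by blast
  then have "inv\<^bsub>presented_group m R\<^esub> x \<otimes>\<^bsub>presented_group m R\<^esub> g \<in> carrier (presented_group m R)"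
    using assms(4) by simp
  then obtain p where p: "p \<in> words m"
    "word_val m R p = inv\<^bsub>presented_group m R\<^esub> x \<otimes>\<^bsub>presented_group m R\<^esub> g"
    by (auto simp: carrier_presented_group)
  then have "g = x \<otimes>\<^bsub>presented_group m R\<^esub> word_val m R p" using x assms(4) by (simp add: m_assoc[symmetric])
  then have "\<exists>n. \<exists>x\<in>S. \<exists>p\<in>words m. length p = n \<and>
     g = x \<otimes>\<^bsub>presented_group m R\<^esub> word_val m R p"
    using p(1) assms(2) by blast
  then show ?thesis unfolding gdist_def by (rule LeastI_ex)
qed

lemma gdist_step:
  assumes R: "R \<subseteq> words m" and S: "S \<noteq> {}" "S \<subseteq> carrier (presented_group m R)"
    and g: "g \<in> carrier (presented_group m R)" and "y \<in> letters m"
  shows "gdist m R S (g \<otimes>\<^bsub>presented_group m R\<^esub> word_val m R [y]) \<le> Suc (gdist m R S g)"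
proof -
  interpret group "presented_group m R" by (rule group_presented_group[OF R])
  obtain x p where p: "x \<in> S" "p \<in> words m" "length p = gdist m R S g"
    "g = x \<otimes>\<^bsub>presented_group m R\<^esub> word_val m R p"
    using gdist_attained[OF R _ S(2) g] S(1) by blast
  have "x \<in> carrier (presented_group m R)" using p(1) S(2) by blast
  then have "g \<otimes>\<^bsub>presented_group m R\<^esub> word_val m R [y] =
      x \<otimes>\<^bsub>presented_group m R\<^esub> word_val m R (p @ [y])"
    using p assms(5) mult_presented_group[OF R, of p "[y]"] by (simp add: m_assoc)
  then have "gdist m R S (g \<otimes>\<^bsub>presented_group m R\<^esub> word_val m R [y]) \<le> length (p @ [y])"
    using p(1,2) assms(5) by (intro gdist_le) auto
  then show ?thesis using p(3) by simp
qed

context vk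
begin

lemma boundary_in_words: "boundary_word D \<in> words m"
  using ne dword_in_words[OF base_in] by (simp add: boundary_word_def)

text \<open>If both pairs of opposite arcs were more than \<open>s\<close> apart in
  \<open>G\<close>, the distances to the first and to the second arc would violate the bound on
  \<open>(s + 1) * (s + 1)\<close> through \<open>besicovitch\<close>. A chord between opposite arcs
  has a full arc on either side, hence the two lower bounds by
  \<open>length w div 4\<close>.\<close>

lemma vk_cut:
  fixes s lam :: nat
  defines "w \<equiv> boundary_word D"
  assumes "\<And>f. f \<in> inner_faces D \<Longrightarrow> card f \<le> lam"
    and s: "lam * area D + length w < (s + 1) * (s + 1)"
  shows "\<exists>i j p. i \<le> j \<and> j \<le> length w \<and> length w div 4 \<le> j - i \<and> length w div 4 \<le> length w - (j - i) \<and>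
    p \<in> words m \<and> length p \<le> s \<and> word_val m R (take j w) = word_val m R (take i w @ p)"
proof -
  interpret group G by (rule group_presented_group[OF R])
  \<comment> \<open>Three arcs have length \<open>l div 4\<close>; the last one,
    \<open>c..l\<close>, takes the remainder of the division.\<close>
  define l a b c where "l = length w" "a = l div 4" "b = 2 * a" "c = 3 * a"
  note defs = this
  have l: "l = least_power \<phi> (dbase D)" by (simp add: defs w_def length_boundary)
  have ww: "w \<in> words m" unfolding w_def by (rule boundary_in_words)
  then have tw: "take i w \<in> words m" for i by (auto simp: words_def dest: in_set_takeD)
  obtain h where h: "\<And>d. d \<in> X \<Longrightarrow> h d \<in> carrier G" "\<And>d. d \<in> X \<Longrightarrow> h (\<phi> d) = h (\<alpha> d)"
    "\<And>d. d \<in> X \<Longrightarrow> h (\<alpha> d) = h d \<otimes>\<^bsub>G\<^esub> word_val m R [dlabel D d]" "h (dbase D) = \<one>\<^bsub>G\<^esub>"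
    by (rule vk_potential) blast
  define V where "V = (\<lambda>i. word_val m R (take i w))"
  have VG: "V i \<in> carrier G" for i using tw by (simp add: V_def)
  have hV: "h ((\<phi> ^^ i) (dbase D)) = V i" if "i \<le> l" for i
    using boundary_potential[OF h(2,3,4), of i] that by (simp add: V_def w_def defs)
  define f where "f = (\<lambda>S d. gdist m R S (h d))"
  have f_vertex: "f S (\<phi> d) = f S (\<alpha> d)" if "d \<in> X" for S d
    using h(2)[OF that] by (simp add: f_def)
  have f_lip: "f S (\<alpha> d) \<le> Suc (f S d)" if "d \<in> X" "S \<noteq> {}" "S \<subseteq> carrier G" for S d
    using gdist_step[OF R that(2,3) h(1)[OF that(1)] label_in[OF that(1)]] h(3)[OF that(1)]
    by (simp add: f_def)
  have f_zero: "f S ((\<phi> ^^ i) (dbase D)) = 0" if "V i \<in> S" "i \<le> l" for S i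
    using gdist_le[of "V i" S "[]" m "V i" R] that hV[OF that(2)] VG[of i]
    by (simp add: f_def one_presented_group[symmetric])
  have short: "\<exists>p\<in>words m. length p \<le> s \<and> (\<exists>i\<in>I. V j = word_val m R (take i w @ p))"
    if "\<not> Suc s \<le> f (V ` I) ((\<phi> ^^ j) (dbase D))" "j \<le> l" "I \<noteq> {}" for I j
  proof -
    have "V ` I \<subseteq> carrier G" using VG by blast
    then have "\<exists>x\<in>V ` I. \<exists>p\<in>words m. length p = f (V ` I) ((\<phi> ^^ j) (dbase D)) \<and> V j = x \<otimes>\<^bsub>G\<^esub> word_val m R p"
      using gdist_attained[OF R _ \<open>V ` I \<subseteq> carrier G\<close> VG[of j]] that(3) hV[OF that(2)]
      unfolding f_def by (metis all_not_in_conv image_is_empty)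
    then obtain i p where "i \<in> I" "p \<in> words m" "length p = f (V ` I) ((\<phi> ^^ j) (dbase D))"
      "V j = V i \<otimes>\<^bsub>G\<^esub> word_val m R p" by blast
    moreover from this have "V j = word_val m R (take i w @ p)"
      using mult_presented_group[OF R tw[of i], of p] by (simp add: V_def)
    moreover have "length p \<le> s" using calculation(3) that(1) by linarith
    ultimately show ?thesis by blast
  qed
  show ?thesis
  proof (rule ccontr)
    assume neg: "\<not> ?thesis"
    have no: False if "i \<le> j" "j \<le> l" "a \<le> j - i" "a \<le> l - (j - i)" "p \<in> words m" "length p \<le> s"
      "V j = word_val m R (take i w @ p)" for i j p
      using neg that unfolding defs V_def by blast
    have far1: "Suc s \<le> f (V ` {..a}) ((\<phi> ^^ j) (dbase D))" if j: "b \<le> j" "j \<le> c" for j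
    proof (rule ccontr)
      assume *: "\<not> ?thesis"
      have "j \<le> l" using j by (simp add: defs)
      then obtain i p where "i \<in> {..a}" "p \<in> words m" "length p \<le> s" "V j = word_val m R (take i w @ p)"
        using short[OF *] by blast
      then show False using j \<open>j \<le> l\<close> by (intro no[of i j p]) (auto simp: defs)
    qed
    have far2: "Suc s \<le> f (V ` {a..b}) ((\<phi> ^^ j) (dbase D))" if j: "c \<le> j" "j \<le> l" for j
    proof (rule ccontr)
      assume *: "\<not> ?thesis"
      have "{a..b} \<noteq> {}" by (simp add: defs)
      then obtain i p where "i \<in> {a..b}" "p \<in> words m" "length p \<le> s" "V j = word_val m R (take i w @ p)"
        using short[OF * j(2)] by blast
      then show False using j by (intro no[of i j p]) (auto simp: defs)
    qed
    have V1: "V ` {..a} \<noteq> {}" "V ` {..a} \<subseteq> carrier G" using VG by auto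
    have V2: "V ` {a..b} \<noteq> {}" "V ` {a..b} \<subseteq> carrier G" using VG by (auto simp: defs)
    have "Suc s * Suc s \<le> (\<Sum>f\<in>inner_faces D. card f * card f) + least_power \<phi> (dbase D)"
    proof (rule besicovitch[of "f (V ` {..a})" "f (V ` {a..b})" a b c])
      show "a \<le> b" "b \<le> c" by (simp_all add: defs)
      show "c \<le> least_power \<phi> (dbase D)" using l by (simp add: defs)
      show "f (V ` {..a}) ((\<phi> ^^ i) (dbase D)) = 0" if "i \<le> a" for i
        using that by (intro f_zero) (auto simp: defs)
      show "f (V ` {a..b}) ((\<phi> ^^ i) (dbase D)) = 0" if "a \<le> i" "i \<le> b" for i
        using that by (intro f_zero) (auto simp: defs)
    qed (use f_vertex f_lip V1 V2 far1 far2 l in auto)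
    also have "(\<Sum>f\<in>inner_faces D. card f * card f) \<le> (\<Sum>f\<in>inner_faces D. lam * card f)"
      using assms(2) by (intro sum_mono) simp
    also have "\<dots> = lam * area D" by (simp add: area_def sum_distrib_left)
    finally show False using s l by (simp add: defs)
  qed
qed

end

section \<open>Existence of van Kampen diagrams\<close>

text \<open>A sphere glued from polygons: \<open>os\<close> lists the darts of the outer face and \<open>fs\<close> those of the
  inner faces. Instead of connectedness and Euler's formula one demands that the first cohomology
  with integer coefficients vanishes. This is stable under folding, which may disconnect the
  surface; at the end, all but the component of the outer face is discarded.\<close>

definition scheme :: "nat \<Rightarrow> word set \<Rightarrow> nat list \<Rightarrow> nat list list \<Rightarrow> (nat \<Rightarrow> nat) \<Rightarrow> (nat \<Rightarrow> letter) \<Rightarrow> bool" where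
  "scheme m R os fs \<alpha> lab \<longleftrightarrow>
     distinct (concat (os # fs)) \<and>
     (\<forall>d\<in>set (concat (os # fs)). \<alpha> d \<in> set (concat (os # fs)) \<and> \<alpha> d \<noteq> d \<and> \<alpha> (\<alpha> d) = d \<and>
       lab d \<in> letters m \<and> lab (\<alpha> d) = letter_inv (lab d)) \<and>
     (\<forall>l\<in>set fs. map lab l \<in> R \<or> word_inv (map lab l) \<in> R) \<and>
     (\<forall>\<psi> :: nat \<Rightarrow> int. (\<forall>d\<in>set (concat (os # fs)). \<psi> (\<alpha> d) = - \<psi> d) \<longrightarrow>
       (\<forall>l\<in>set (os # fs). sum_list (map \<psi> l) = 0) \<longrightarrow>
       (\<exists>h :: nat \<Rightarrow> int. (\<forall>d\<in>set (concat (os # fs)). h (\<alpha> d) = h d + \<psi> d) \<and>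
         (\<forall>l\<in>set (os # fs). map h (rotate1 l) = map (h \<circ> \<alpha>) l)))"

text \<open>Van Kampen's lemma is obtained by showing that this property is invariant under each
  generator of \<open>pres_rel\<close>; no expression of \<open>w\<close> as a product of conjugates
  of relators is ever formed.\<close>

definition bounds :: "nat \<Rightarrow> word set \<Rightarrow> word \<Rightarrow> bool" where
  "bounds m R w \<longleftrightarrow> (\<exists>os fs \<alpha> lab. scheme m R os fs \<alpha> lab \<and> map lab os = w)"

lemma bounds_Nil [simp]: "bounds m R []"
  unfolding bounds_def by (rule exI[of _ "[]"], rule exI[of _ "[]"]) (simp add: scheme_def)

lemma schemeI:
  assumes "distinct (concat (os # fs))"
    and "\<And>d. d \<in> set (concat (os # fs)) \<Longrightarrow> \<alpha> d \<in> set (concat (os # fs)) \<and> \<alpha> d \<noteq> d \<and> \<alpha> (\<alpha> d) = d \<and>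
       lab d \<in> letters m \<and> lab (\<alpha> d) = letter_inv (lab d)"
    and "\<And>l. l \<in> set fs \<Longrightarrow> map lab l \<in> R \<or> word_inv (map lab l) \<in> R"
    and "\<And>\<psi> :: nat \<Rightarrow> int. (\<And>d. d \<in> set (concat (os # fs)) \<Longrightarrow> \<psi> (\<alpha> d) = - \<psi> d) \<Longrightarrow>
       (\<And>l. l \<in> set (os # fs) \<Longrightarrow> sum_list (map \<psi> l) = 0) \<Longrightarrow>
       \<exists>h :: nat \<Rightarrow> int. (\<forall>d\<in>set (concat (os # fs)). h (\<alpha> d) = h d + \<psi> d) \<and>
         (\<forall>l\<in>set (os # fs). map h (rotate1 l) = map (h \<circ> \<alpha>) l)"
  shows "scheme m R os fs \<alpha> lab"
  unfolding scheme_def using assms by blast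

lemma schemeD:
  assumes "scheme m R os fs \<alpha> lab"
  shows "distinct (concat (os # fs))"
    and "d \<in> set (concat (os # fs)) \<Longrightarrow> \<alpha> d \<in> set (concat (os # fs)) \<and> \<alpha> d \<noteq> d \<and> \<alpha> (\<alpha> d) = d \<and>
       lab d \<in> letters m \<and> lab (\<alpha> d) = letter_inv (lab d)"
    and "l \<in> set fs \<Longrightarrow> map lab l \<in> R \<or> word_inv (map lab l) \<in> R"
    and "(\<And>d. d \<in> set (concat (os # fs)) \<Longrightarrow> \<psi> (\<alpha> d) = - \<psi> d) \<Longrightarrow>
       (\<And>l. l \<in> set (os # fs) \<Longrightarrow> sum_list (map \<psi> l) = 0) \<Longrightarrow>
       \<exists>h :: nat \<Rightarrow> int. (\<forall>d\<in>set (concat (os # fs)). h (\<alpha> d) = h d + \<psi> d) \<and>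
         (\<forall>l\<in>set (os # fs). map h (rotate1 l) = map (h \<circ> \<alpha>) l)"
  using assms unfolding scheme_def by blast+

lemma scheme_rotate1:
  assumes "scheme m R os fs \<alpha> lab"
  shows "scheme m R (rotate1 os) fs \<alpha> lab"
proof -
  note S = schemeD[OF assms]
  have set_eq: "set (concat (rotate1 os # fs)) = set (concat (os # fs))" by simp
  have sum_eq: "sum_list (map \<psi> (rotate1 os)) = sum_list (map \<psi> os)" for \<psi> :: "nat \<Rightarrow> int"
    by (cases os) auto
  show ?thesis
  proof (rule schemeI, unfold set_eq)
    show "distinct (concat (rotate1 os # fs))" using S(1) by simp
    fix \<psi> :: "nat \<Rightarrow> int"
    assume "\<And>d. d \<in> set (concat (os # fs)) \<Longrightarrow> \<psi> (\<alpha> d) = - \<psi> d"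
      and sums: "\<And>l. l \<in> set (rotate1 os # fs) \<Longrightarrow> sum_list (map \<psi> l) = 0"
    then obtain h where h: "\<forall>d\<in>set (concat (os # fs)). h (\<alpha> d) = h d + \<psi> d"
        "\<forall>l\<in>set (os # fs). map h (rotate1 l) = map (h \<circ> \<alpha>) l"
      using S(4)[of \<psi>] sum_eq[of \<psi>] by fastforce
    then have "map h (rotate1 (rotate1 os)) = map (h \<circ> \<alpha>) (rotate1 os)"
      by (simp add: rotate1_map[symmetric])
    then show "\<exists>h :: nat \<Rightarrow> int. (\<forall>d\<in>set (concat (os # fs)). h (\<alpha> d) = h d + \<psi> d) \<and>
         (\<forall>l\<in>set (rotate1 os # fs). map h (rotate1 l) = map (h \<circ> \<alpha>) l)"
      using h by (intro exI[of _ h]) auto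
  qed (use S(2,3) in blast)+
qed

lemma bounds_rotate1: "bounds m R w \<Longrightarrow> bounds m R (rotate1 w)"
  unfolding bounds_def using scheme_rotate1 rotate1_map by metis

lemma bounds_rotate: "bounds m R (u @ v) \<Longrightarrow> bounds m R (v @ u)"
proof (induction u arbitrary: v)
  case (Cons x u)
  then have "bounds m R (rotate1 ((x # u) @ v))" by (intro bounds_rotate1)
  then have "bounds m R (u @ (v @ [x]))" by simp
  then show ?case using Cons.IH by fastforce
qed simp

text \<open>A new edge is attached at the base point; \<open>a\<close> leaves it and
  \<open>b\<close> returns. The far end is a new vertex, where the potential is set to fit
  \<open>\<psi> a\<close>.\<close>

lemma bounds_hair:
  assumes "bounds m R w" "x \<in> letters m"
  shows "bounds m R (w @ [x, letter_inv x])"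
proof -
  obtain os fs \<alpha> lab where sch: "scheme m R os fs \<alpha> lab" "map lab os = w"
    using assms(1) by (auto simp: bounds_def)
  note S = schemeD[OF sch(1)]
  let ?X = "set (concat (os # fs))"
  obtain a where a: "a \<notin> ?X" using ex_new_if_finite[of ?X] by auto
  obtain b where b: "b \<notin> insert a ?X" using ex_new_if_finite[of "insert a ?X"] by auto
  define \<alpha>' where "\<alpha>' = \<alpha>(a := b, b := a)"
  define lab' where "lab' = lab(a := x, b := letter_inv x)"
  have old: "\<alpha>' d = \<alpha> d" "lab' d = lab d" "d \<noteq> a" "d \<noteq> b" if "d \<in> ?X" for d
    using that a b by (auto simp: \<alpha>'_def lab'_def)
  have new: "\<alpha>' a = b" "\<alpha>' b = a" "lab' a = x" "lab' b = letter_inv x" "a \<noteq> b"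
    using b by (auto simp: \<alpha>'_def lab'_def)
  have X': "set (concat ((os @ [a, b]) # fs)) = insert a (insert b ?X)" by auto
  have lab_l: "map lab' l = map lab l" if "l \<in> set (os # fs)" for l
    using that old(2) by (intro map_cong) auto
  have "scheme m R (os @ [a, b]) fs \<alpha>' lab'"
  proof (rule schemeI, unfold X')
    show "distinct (concat ((os @ [a, b]) # fs))" using S(1) a b by auto
    show "\<alpha>' d \<in> insert a (insert b ?X) \<and> \<alpha>' d \<noteq> d \<and> \<alpha>' (\<alpha>' d) = d \<and>
       lab' d \<in> letters m \<and> lab' (\<alpha>' d) = letter_inv (lab' d)" if d: "d \<in> insert a (insert b ?X)" for d
    proof (cases "d \<in> ?X")
      case True
      then show ?thesis using S(2)[OF True] old by simp
    next
      case False
      then show ?thesis using d new assms(2) by auto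
    qed
    show "map lab' l \<in> R \<or> word_inv (map lab' l) \<in> R" if "l \<in> set fs" for l
    proof -
      have "map lab' l = map lab l" using that by (intro lab_l) simp
      then show ?thesis using S(3)[OF that] by (simp only:)
    qed
    fix \<psi> :: "nat \<Rightarrow> int"
    assume \<psi>: "\<And>d. d \<in> insert a (insert b ?X) \<Longrightarrow> \<psi> (\<alpha>' d) = - \<psi> d"
      and sums: "\<And>l. l \<in> set ((os @ [a, b]) # fs) \<Longrightarrow> sum_list (map \<psi> l) = 0"
    have ab: "\<psi> b = - \<psi> a" using \<psi>[of a] new by simp
    have "\<exists>h. (\<forall>d\<in>?X. h (\<alpha> d) = h d + \<psi> d) \<and> (\<forall>l\<in>set (os # fs). map h (rotate1 l) = map (h \<circ> \<alpha>) l)"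
    proof (rule S(4))
      show "\<psi> (\<alpha> d) = - \<psi> d" if "d \<in> ?X" for d using \<psi>[of d] old(1)[OF that] that by simp
      show "sum_list (map \<psi> l) = 0" if "l \<in> set (os # fs)" for l
        using sums[of l] sums[of "os @ [a, b]"] that ab by auto
    qed
    then obtain h where h: "\<And>d. d \<in> ?X \<Longrightarrow> h (\<alpha> d) = h d + \<psi> d"
        "\<And>l. l \<in> set (os # fs) \<Longrightarrow> map h (rotate1 l) = map (h \<circ> \<alpha>) l" by blast
    \<comment> \<open>The potential at the base vertex. If the outer face was empty, the new edge is
      a component of its own and any value serves.\<close>
    define z where "z = (if os = [] then 0 else h (hd os))"
    define h' where "h' = h(a := z, b := z + \<psi> a)"
    have h'_old: "h' d = h d" if "d \<in> ?X" for d using old[OF that] by (simp add: h'_def)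
    have h'_new: "h' a = z" "h' b = z + \<psi> a" using new(5) by (auto simp: h'_def)
    have h'\<alpha>: "(h' \<circ> \<alpha>') d = (h \<circ> \<alpha>) d" if "d \<in> ?X" for d
      using old(1)[OF that] h'_old S(2)[OF that] by simp
    have maps: "map h' l = map h l" "map (h' \<circ> \<alpha>') l = map (h \<circ> \<alpha>) l" if "set l \<subseteq> ?X" for l
      using that h'_old h'\<alpha> by (auto simp: subset_iff)
    show "\<exists>h. (\<forall>d\<in>insert a (insert b ?X). h (\<alpha>' d) = h d + \<psi> d) \<and>
         (\<forall>l\<in>set ((os @ [a, b]) # fs). map h (rotate1 l) = map (h \<circ> \<alpha>') l)"
    proof (intro exI[of _ h'] conjI ballI)
      fix d assume "d \<in> insert a (insert b ?X)"
      then consider "d = a" | "d = b" | "d \<in> ?X" by blast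
      then show "h' (\<alpha>' d) = h' d + \<psi> d"
      proof cases
        case 3
        then show ?thesis using h(1)[OF 3] h'_old[OF 3] h'\<alpha>[OF 3] by simp
      qed (use h'_new new ab in simp_all)
    next
      fix l assume "l \<in> set ((os @ [a, b]) # fs)"
      then consider "l = os @ [a, b]" | "l \<in> set fs" by auto
      then show "map h' (rotate1 l) = map (h' \<circ> \<alpha>') l"
      proof cases
        case 1
        show ?thesis
        proof (cases os)
          case Nil
          then show ?thesis using 1 new by simp
        next
          case (Cons c o')
          have sub: "set os \<subseteq> ?X" "set (o' @ [c]) \<subseteq> ?X" using Cons by auto
          have "map h' (o' @ [c]) = map (h' \<circ> \<alpha>') os"
            using h(2)[of os] maps[OF sub(1)] maps[OF sub(2)] Cons by simp
          moreover have "h' a = h' c" using Cons h'_new h'_old[of c] by (simp add: z_def)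
          ultimately show ?thesis using 1 Cons new by simp
        qed
      next
        case 2
        then have sub: "set (rotate1 l) \<subseteq> ?X" "set l \<subseteq> ?X" by auto
        have "map h' (rotate1 l) = map h (rotate1 l)" by (rule maps(1)[OF sub(1)])
        also have "\<dots> = map (h \<circ> \<alpha>) l" using h(2)[of l] 2 by simp
        also have "\<dots> = map (h' \<circ> \<alpha>') l" by (rule maps(2)[OF sub(2), symmetric])
        finally show ?thesis .
      qed
    qed
  qed
  moreover have "map lab' (os @ [a, b]) = w @ [x, letter_inv x]"
    using lab_l[of os] sch(2) new by simp
  ultimately show ?thesis unfolding bounds_def by blast
qed

lemma sum_along_path:
  fixes h \<psi> :: "nat \<Rightarrow> int"
  assumes "xs \<noteq> []" "map h (tl xs @ [n]) = map (h \<circ> \<alpha>) xs" "\<And>d. d \<in> set xs \<Longrightarrow> h (\<alpha> d) = h d + \<psi> d"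
  shows "h n = h (hd xs) + sum_list (map \<psi> xs)"
  using assms
proof (induction xs)
  case (Cons d xs)
  then show ?case by (cases xs) auto
qed simp

text \<open>The end points of the subpath \<open>r\<close> of the outer face are identified, so that \<open>r\<close> becomes the
  boundary of a new inner face.\<close>

lemma bounds_pinch:
  assumes "bounds m R (w @ r)" "r \<in> R \<or> word_inv r \<in> R"
  shows "bounds m R w"
proof -
  obtain xs fs \<alpha> lab where sch: "scheme m R xs fs \<alpha> lab" "map lab xs = w @ r"
    using assms(1) by (auto simp: bounds_def)
  then obtain os cs where xs: "xs = os @ cs" "map lab os = w" "map lab cs = r"
    by (auto simp: map_eq_append_conv)
  note S = schemeD[OF sch(1)]
  have X': "set (concat (os # cs # fs)) = set (concat (xs # fs))" by (auto simp: xs)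
  have "scheme m R os (cs # fs) \<alpha> lab"
  proof (rule schemeI, unfold X')
    show "distinct (concat (os # cs # fs))" using S(1) by (simp add: xs)
    show "map lab l \<in> R \<or> word_inv (map lab l) \<in> R" if "l \<in> set (cs # fs)" for l
      using S(3)[of l] that xs(3) assms(2) by auto
    fix \<psi> :: "nat \<Rightarrow> int"
    assume \<psi>: "\<And>d. d \<in> set (concat (xs # fs)) \<Longrightarrow> \<psi> (\<alpha> d) = - \<psi> d"
      and sums: "\<And>l. l \<in> set (os # cs # fs) \<Longrightarrow> sum_list (map \<psi> l) = 0"
    have "\<exists>h :: nat \<Rightarrow> int. (\<forall>d\<in>set (concat (xs # fs)). h (\<alpha> d) = h d + \<psi> d) \<and>
         (\<forall>l\<in>set (xs # fs). map h (rotate1 l) = map (h \<circ> \<alpha>) l)"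
    proof (rule S(4)[of \<psi>, OF \<psi>])
      show "sum_list (map \<psi> l) = 0" if "l \<in> set (xs # fs)" for l
        using that sums[of l] sums[of os] sums[of cs] by (auto simp: xs)
    qed
    then obtain h :: "nat \<Rightarrow> int" where h: "\<And>d. d \<in> set (concat (xs # fs)) \<Longrightarrow> h (\<alpha> d) = h d + \<psi> d"
        "\<And>l. l \<in> set (xs # fs) \<Longrightarrow> map h (rotate1 l) = map (h \<circ> \<alpha>) l" by blast
    have "map h (rotate1 os) = map (h \<circ> \<alpha>) os \<and> map h (rotate1 cs) = map (h \<circ> \<alpha>) cs"
    proof (cases "os = [] \<or> cs = []")
      case True
      then show ?thesis using h(2)[of xs] xs by auto
    next
      case False
      then have ne: "os \<noteq> []" "cs \<noteq> []" by auto
      then have "rotate1 xs = (tl os @ [hd cs]) @ (tl cs @ [hd os])"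
        by (cases os; cases cs) (auto simp: xs)
      then have "map h (tl os @ [hd cs]) @ map h (tl cs @ [hd os]) = map (h \<circ> \<alpha>) os @ map (h \<circ> \<alpha>) cs"
        using h(2)[of xs] xs by simp
      moreover have "length (map h (tl os @ [hd cs])) = length (map (h \<circ> \<alpha>) os)"
        using ne by (cases os) auto
      ultimately have eqs: "map h (tl os @ [hd cs]) = map (h \<circ> \<alpha>) os" "map h (tl cs @ [hd os]) = map (h \<circ> \<alpha>) cs"
        by (metis append_eq_append_conv)+
      \<comment> \<open>The potential agrees at the two points that are identified, because
        \<open>\<psi>\<close> sums to zero along \<open>os\<close> alone.\<close>
      have "h (hd cs) = h (hd os) + sum_list (map \<psi> os)"
        by (rule sum_along_path[OF ne(1) eqs(1)]) (use h(1) xs in auto)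
      then have "h (hd cs) = h (hd os)" using sums[of os] by simp
      then show ?thesis using eqs ne by (cases os; cases cs) auto
    qed
    then show "\<exists>h :: nat \<Rightarrow> int. (\<forall>d\<in>set (concat (xs # fs)). h (\<alpha> d) = h d + \<psi> d) \<and>
         (\<forall>l\<in>set (os # cs # fs). map h (rotate1 l) = map (h \<circ> \<alpha>) l)"
      using h by (intro exI[of _ h]) auto
  qed (use S(2) in blast)
  then show ?thesis using xs unfolding bounds_def by blast
qed

text \<open>Directed towards their common vertex, the last two outer edges carry the same label, so
  they are glued: \<open>a\<close> and \<open>b\<close> disappear and their former opposites become
  opposite to each other. If \<open>a\<close> and \<open>b\<close> were opposite already, the edge
  is a hair and is simply removed. A cochain on the result is pulled back to the old surface, and
  the potential found there descends.\<close>

lemma bounds_fold: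
  assumes "bounds m R (w @ [x, letter_inv x])"
  shows "bounds m R w"
\<comment> \<open>Folding an outer face of length two would close the sphere; the empty word is
  bounded by the empty scheme instead.\<close>
proof (cases "w = []")
  case False
  obtain xs fs \<alpha> lab where sch: "scheme m R xs fs \<alpha> lab" "map lab xs = w @ [x, letter_inv x]"
    using assms by (auto simp: bounds_def)
  then obtain os a b where xs: "xs = os @ [a, b]" "map lab os = w" "lab a = x" "lab b = letter_inv x"
    by (auto simp: map_eq_append_conv map_eq_Cons_conv)
  then obtain c o' where os: "os = c # o'" using False by (cases os) auto
  note S = schemeD[OF sch(1)]
  let ?X = "set (concat (xs # fs))" and ?Y = "set (concat (os # fs))"
  have XY: "?X = insert a (insert b ?Y)" and ab: "a \<notin> ?Y" "b \<notin> ?Y" "a \<noteq> b"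
    using S(1) by (auto simp: xs)
  have aX: "a \<in> ?X" and bX: "b \<in> ?X" using XY by auto
  define \<alpha>' where "\<alpha>' = (\<lambda>d. if d = \<alpha> a then \<alpha> b else if d = \<alpha> b then \<alpha> a else \<alpha> d)"
  have inv: "\<alpha> d \<in> ?X" "\<alpha> d \<noteq> d" "\<alpha> (\<alpha> d) = d" if "d \<in> ?X" for d using S(2)[OF that] by auto
  have inj: "\<alpha> d = \<alpha> e \<longleftrightarrow> d = e" if "d \<in> ?X" "e \<in> ?X" for d e
    using inv(3)[OF that(1)] inv(3)[OF that(2)] by metis
  have Y: "d \<in> ?Y \<longleftrightarrow> d \<in> ?X \<and> d \<noteq> a \<and> d \<noteq> b" for d using XY ab by blast
  have \<alpha>'_Y: "\<alpha>' d \<in> ?Y" if d: "d \<in> ?Y" for d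
  proof -
    have dX: "d \<in> ?X" "d \<noteq> a" "d \<noteq> b" using d Y by auto
    consider "d = \<alpha> a" | "d = \<alpha> b" "d \<noteq> \<alpha> a" | "d \<noteq> \<alpha> a" "d \<noteq> \<alpha> b" by blast
    then show ?thesis
    proof cases
      case 1
      then have "\<alpha> b \<noteq> a" using dX inv(3)[OF bX] by auto
      then show ?thesis using 1 inv(1,2)[OF bX] Y by (simp add: \<alpha>'_def)
    next
      case 2
      then have "\<alpha> a \<noteq> b" using dX inv(3)[OF aX] by auto
      then show ?thesis using 2 inv(1,2)[OF aX] Y by (simp add: \<alpha>'_def)
    next
      case 3
      then have "\<alpha> d \<noteq> a" "\<alpha> d \<noteq> b" using inv(3)[OF dX(1)] by auto
      then show ?thesis using 3 inv(1)[OF dX(1)] Y by (simp add: \<alpha>'_def)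
    qed
  qed
  have lab\<alpha>: "lab (\<alpha> a) = letter_inv x" "lab (\<alpha> b) = x"
    using S(2)[OF aX] S(2)[OF bX] xs by auto
  have "scheme m R os fs \<alpha>' lab"
  proof (rule schemeI)
    show "distinct (concat (os # fs))" using S(1) by (auto simp: xs)
    show "\<alpha>' d \<in> ?Y \<and> \<alpha>' d \<noteq> d \<and> \<alpha>' (\<alpha>' d) = d \<and>
       lab d \<in> letters m \<and> lab (\<alpha>' d) = letter_inv (lab d)" if d: "d \<in> ?Y" for d
    proof -
      have dX: "d \<in> ?X" "d \<noteq> a" "d \<noteq> b" using d Y by auto
      have "\<alpha> a \<noteq> \<alpha> b" using inj[OF aX bX] ab by simp
      moreover have "\<alpha> d \<noteq> \<alpha> a" "\<alpha> d \<noteq> \<alpha> b" using inj dX aX bX by auto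
      ultimately show ?thesis
        using \<alpha>'_Y[OF d] S(2)[OF dX(1)] lab\<alpha> dX by (auto simp: \<alpha>'_def)
    qed
    show "map lab l \<in> R \<or> word_inv (map lab l) \<in> R" if "l \<in> set fs" for l
      using S(3)[OF that] .
    fix \<psi> :: "nat \<Rightarrow> int"
    assume \<psi>: "\<And>d. d \<in> ?Y \<Longrightarrow> \<psi> (\<alpha>' d) = - \<psi> d"
      and sums: "\<And>l. l \<in> set (os # fs) \<Longrightarrow> sum_list (map \<psi> l) = 0"
    \<comment> \<open>Antisymmetry on the old surface forces this value on \<open>a\<close>, and
      \<open>- z\<close> on \<open>b\<close> leaves the sum along the outer face unchanged. For a
      hair the value is arbitrary.\<close>
    define z where "z = (if \<alpha> a = b then 0 else - \<psi> (\<alpha> a))"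
    define \<psi>' where "\<psi>' = \<psi>(a := z, b := - z)"
    have \<psi>'_Y: "\<psi>' d = \<psi> d" if "d \<in> ?Y" for d using that ab by (auto simp: \<psi>'_def)
    have \<psi>'_ab: "\<psi>' a = z" "\<psi>' b = - z" using ab by (auto simp: \<psi>'_def)
    have ab': "\<alpha> b = a \<longleftrightarrow> \<alpha> a = b" using inv(3)[OF aX] inv(3)[OF bX] by auto
    have \<psi>'_\<alpha>a: "\<psi>' (\<alpha> a) = - z" 
    proof (cases "\<alpha> a = b")
      case False
      then have "\<alpha> a \<in> ?Y" using inv(1,2)[OF aX] Y by simp
      then show ?thesis using False \<psi>'_Y by (simp add: z_def)
    qed (simp add: \<psi>'_ab)
    have \<psi>'_\<alpha>b: "\<psi>' (\<alpha> b) = z" 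
    proof (cases "\<alpha> a = b")
      case False
      then have "\<alpha> a \<in> ?Y" "\<alpha> b \<in> ?Y" using inv(1,2)[OF aX] inv(1,2)[OF bX] Y ab' by auto
      moreover have "\<alpha>' (\<alpha> a) = \<alpha> b" by (simp add: \<alpha>'_def)
      ultimately show ?thesis using False \<psi>'_Y \<psi>[of "\<alpha> a"] by (simp add: z_def)
    qed (use ab' \<psi>'_ab in simp)
    have "\<exists>h. (\<forall>d\<in>?X. h (\<alpha> d) = h d + \<psi>' d) \<and> (\<forall>l\<in>set (xs # fs). map h (rotate1 l) = map (h \<circ> \<alpha>) l)"
    proof (rule S(4))
      fix d assume d: "d \<in> ?X"
      show "\<psi>' (\<alpha> d) = - \<psi>' d"
      proof (cases "d \<in> {a, b, \<alpha> a, \<alpha> b}")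
        case True
        then show ?thesis using \<psi>'_ab \<psi>'_\<alpha>a \<psi>'_\<alpha>b inv(3)[OF aX] inv(3)[OF bX] by auto
      next
        case False
        then have "d \<in> ?Y" "\<alpha>' d = \<alpha> d" using d Y by (auto simp: \<alpha>'_def)
        then show ?thesis using \<psi>[of d] \<alpha>'_Y[of d] \<psi>'_Y by simp
      qed
    next
      fix l assume l: "l \<in> set (xs # fs)"
      have eq: "sum_list (map \<psi>' l) = 0" if "l \<in> set (os # fs)" for l
      proof -
        have "map \<psi>' l = map \<psi> l" using that \<psi>'_Y by (intro map_cong) auto
        then show ?thesis using sums[OF that] by (simp only:)
      qed
      show "sum_list (map \<psi>' l) = 0"
        using l eq[of l] eq[of os] \<psi>'_ab by (auto simp: xs)
    qed
    then obtain h where h: "\<And>d. d \<in> ?X \<Longrightarrow> h (\<alpha> d) = h d + \<psi>' d"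
        "\<And>l. l \<in> set (xs # fs) \<Longrightarrow> map h (rotate1 l) = map (h \<circ> \<alpha>) l" by blast
    have "map h (o' @ [a, b, c]) = map (h \<circ> \<alpha>) (c # o' @ [a, b])"
      using h(2)[of xs] xs os by simp
    then have "map h (o' @ [a]) @ [h b, h c] = map (h \<circ> \<alpha>) (c # o') @ [h (\<alpha> a), h (\<alpha> b)]"
      by simp
    moreover have "length (map h (o' @ [a])) = length (map (h \<circ> \<alpha>) (c # o'))" by simp
    ultimately have o': "map h (o' @ [a]) = map (h \<circ> \<alpha>) (c # o')" and hbc: "[h b, h c] = [h (\<alpha> a), h (\<alpha> b)]"
      by (metis append_eq_append_conv)+
    have hb: "h b = h (\<alpha> a)" and hc: "h c = h (\<alpha> b)" using hbc by simp_all
    \<comment> \<open>The vertices identified by the fold, the origin of \<open>a\<close> and the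
      end of \<open>b\<close>, have the same potential.\<close>
    have ha: "h (\<alpha> b) = h a" using hb h(1)[OF aX] h(1)[OF bX] \<psi>'_ab by simp
    have h\<alpha>: "h (\<alpha>' d) = h (\<alpha> d)" if "d \<in> ?X" for d
      using ha hb inv(3)[OF aX] inv(3)[OF bX] by (auto simp: \<alpha>'_def)
    have sub: "set l \<subseteq> ?X" if "l \<in> set (os # fs)" for l using that XY by auto
    show "\<exists>h. (\<forall>d\<in>?Y. h (\<alpha>' d) = h d + \<psi> d) \<and> (\<forall>l\<in>set (os # fs). map h (rotate1 l) = map (h \<circ> \<alpha>') l)"
    proof (intro exI[of _ h] conjI ballI)
      fix d assume "d \<in> ?Y"
      then show "h (\<alpha>' d) = h d + \<psi> d" using h(1)[of d] h\<alpha>[of d] \<psi>'_Y[of d] Y by simp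
    next
      fix l assume l: "l \<in> set (os # fs)"
      have "map (h \<circ> \<alpha>') l = map (h \<circ> \<alpha>) l" using sub[OF l] h\<alpha> by (intro map_cong) auto
      moreover have "map h (rotate1 l) = map (h \<circ> \<alpha>) l"
      proof (cases "l = os")
        case True
        then show ?thesis using o' ha hc os by simp
      next
        case False
        then show ?thesis using h(2)[of l] l by simp
      qed
      ultimately show "map h (rotate1 l) = map (h \<circ> \<alpha>') l" by simp
    qed
  qed
  then show ?thesis using xs unfolding bounds_def by blast
qed simp

lemma bounds_append_cancel_iff:
  assumes "x \<in> letters m"
  shows "bounds m R (u @ [x, letter_inv x] @ v) \<longleftrightarrow> bounds m R (u @ v)"
proof
  assume "bounds m R (u @ [x, letter_inv x] @ v)"
  then have "bounds m R ((v @ u) @ [x, letter_inv x])"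
    using bounds_rotate[of m R "u @ [x, letter_inv x]" v] by simp
  then show "bounds m R (u @ v)" by (rule bounds_rotate[OF bounds_fold])
next
  assume "bounds m R (u @ v)"
  then have "bounds m R ((v @ u) @ [x, letter_inv x])"
    by (intro bounds_hair bounds_rotate[of m R u v] assms)
  then show "bounds m R (u @ [x, letter_inv x] @ v)"
    using bounds_rotate[of m R v "u @ [x, letter_inv x]"] by simp
qed

lemma bounds_append_inverse:
  assumes "bounds m R w" "r \<in> words m"
  shows "bounds m R (w @ r @ word_inv r)"
  using assms(2)
proof (induction r rule: rev_induct)
  case Nil
  then show ?case using assms(1) by (simp add: word_inv_def)
next
  case (snoc x r)
  then have "bounds m R ((w @ r) @ [x, letter_inv x] @ word_inv r)"
    using bounds_append_cancel_iff[of x m R "w @ r" "word_inv r"] by simp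
  then show ?case by (simp add: word_inv_def)
qed

lemma word_inv_word_inv [simp]: "word_inv (word_inv w) = w"
  by (simp add: word_inv_def rev_map comp_def)

text \<open>To insert a relator \<open>r\<close>, attach \<open>r @ word_inv r\<close> as a hair and
  pinch off the second half as a new face; inner faces may read inverses of relators.\<close>

lemma bounds_append_relator_iff:
  assumes "r \<in> R" "R \<subseteq> words m"
  shows "bounds m R (u @ r @ v) \<longleftrightarrow> bounds m R (u @ v)"
proof
  assume "bounds m R (u @ r @ v)"
  then have "bounds m R ((v @ u) @ r)" using bounds_rotate[of m R "u @ r" v] by simp
  then show "bounds m R (u @ v)" using bounds_pinch assms(1) bounds_rotate by blast
next
  assume "bounds m R (u @ v)"
  then have "bounds m R ((v @ u) @ r @ word_inv r)"
    using assms by (intro bounds_append_inverse bounds_rotate[of m R u v]) auto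
  then have "bounds m R ((v @ u) @ r)"
    using bounds_pinch[of m R "(v @ u) @ r" "word_inv r"] assms(1) by simp
  then show "bounds m R (u @ r @ v)" using bounds_rotate[of m R v "u @ r"] by simp
qed

lemma pres_rel_bounds_iff:
  assumes "(v, w) \<in> pres_rel m R" "R \<subseteq> words m"
  shows "bounds m R v \<longleftrightarrow> bounds m R w"
  using assms(1)
  by induction (simp_all only: bounds_append_cancel_iff bounds_append_relator_iff[OF _ assms(2)])

section \<open>From gluing schemes to van Kampen diagrams\<close>

lemma cyclic_list:
  assumes "permutation f" "map f l = rotate1 l" "distinct l" "l \<noteq> []"
  shows "support f (hd l) = l" "d \<in> set l \<Longrightarrow> orbit f d = set l"
proof -
  let ?n = "length l"
  have pow: "(f ^^ i) (hd l) = l ! i" if "i < ?n" for i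
    using that
  proof (induction i)
    case (Suc i)
    have "f (l ! i) = rotate1 l ! i" using assms(2) Suc.prems by (metis Suc_lessD nth_map)
    then show ?case using Suc by (simp add: nth_rotate1)
  qed (simp add: assms(4) hd_conv_nth)
  have "?n > 0" using assms(4) by simp
  have "f (l ! (?n - 1)) = rotate1 l ! (?n - 1)"
    using assms(2) \<open>?n > 0\<close> by (metis diff_less nth_map zero_less_one)
  then have "f (l ! (?n - 1)) = l ! 0"
    using nth_rotate1[of "?n - 1" l] \<open>?n > 0\<close> by simp
  then have cyc: "(f ^^ ?n) (hd l) = hd l"
    using pow[of "?n - 1"] \<open>?n > 0\<close> assms(4)
    by (metis Suc_diff_1 diff_less funpow.simps(2) hd_conv_nth o_apply zero_less_one)
  have lp: "least_power f (hd l) = ?n"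
  proof (rule antisym)
    show "least_power f (hd l) \<le> ?n" by (rule least_power_le[OF cyc \<open>?n > 0\<close>])
    show "?n \<le> least_power f (hd l)"
    proof (rule ccontr)
      assume "\<not> ?thesis"
      then have lt: "least_power f (hd l) < ?n" by simp
      then have "l ! least_power f (hd l) = l ! 0"
        using pow[OF lt] least_power_of_permutation(1)[OF assms(1), of "hd l"] assms(4)
        by (simp add: hd_conv_nth)
      then have "least_power f (hd l) = 0"
        using assms(3) lt \<open>?n > 0\<close> nth_eq_iff_index_eq by blast
      then show False using least_power_of_permutation(2)[OF assms(1), of "hd l"] by simp
    qed
  qed
  show sup: "support f (hd l) = l"
    unfolding lp using pow by (intro nth_equalityI) auto
  have orb: "orbit f (hd l) = set l" using set_support[OF assms(1), of "hd l"] sup by simp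
  show "orbit f d = set l" if "d \<in> set l"
    using orbit_cyclic_eq3[OF cyclic_on_orbit'[OF assms(1), of "hd l"], of d] that orb by simp
qed

lemma next_in_cycles:
  assumes "distinct (concat ls)"
  obtains f where "\<And>l. l \<in> set ls \<Longrightarrow> map f l = rotate1 l"
proof
  let ?ps = "concat (map (\<lambda>l. zip l (rotate1 l)) ls)"
  let ?f = "\<lambda>d. the (map_of ?ps d)"
  have "map fst ?ps = concat ls" by (induction ls) auto
  then have dist: "distinct (map fst ?ps)" using assms by simp
  fix l assume l: "l \<in> set ls"
  have "?f (l ! i) = rotate1 l ! i" if "i < length l" for i
  proof -
    have "(l ! i, rotate1 l ! i) \<in> set (zip l (rotate1 l))" using that by (force simp: set_zip)
    then have "(l ! i, rotate1 l ! i) \<in> set ?ps" using l by auto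
    then show ?thesis using map_of_is_SomeI[OF dist] by simp
  qed
  then show "map ?f l = rotate1 l" by (intro nth_equalityI) auto
qed

text \<open>Only the component \<open>Y\<close> of the base dart is kept. It is a union of whole
  faces, and a cochain on it extends by zero, so it inherits the vanishing of cohomology, which
  gives Euler's formula by \<open>euler_if_cohomology_trivial\<close>.\<close>

lemma scheme_imp_vk_diagram:
  assumes sch: "scheme m R os fs \<alpha> lab" and ne: "os \<noteq> []"
  shows "\<exists>D. vk_diagram m R D \<and> boundary_word D = map lab os"
proof -
  note S = schemeD[OF sch]
  let ?X = "set (concat (os # fs))"
  obtain f where f: "\<And>l. l \<in> set (os # fs) \<Longrightarrow> map f l = rotate1 l"
    by (rule next_in_cycles[OF S(1)]) blast
  have f_set: "f ` set l = set l" if "l \<in> set (os # fs)" for l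
    using f[OF that] by (metis set_map set_rotate1)
  have f_X: "f ` ?X = ?X"
  proof -
    have "?X = (\<Union>l\<in>set (os # fs). set l)" by simp
    then show ?thesis using f_set by (metis (no_types, lifting) SUP_cong image_UN)
  qed
  then have inj_f: "inj_on f ?X" by (intro eq_card_imp_inj_on) auto
  define Y where "Y = {d. (hd os, d) \<in> {(z, z'). z' = \<alpha> z \<or> z' = f z}\<^sup>*}"
  have base: "hd os \<in> Y" by (simp add: Y_def)
  have base_X: "hd os \<in> ?X" using ne by simp
  have YX: "Y \<subseteq> ?X"
  proof
    fix d assume "d \<in> Y"
    then have "(hd os, d) \<in> {(z, z'). z' = \<alpha> z \<or> z' = f z}\<^sup>*" by (simp add: Y_def)
    then show "d \<in> ?X"
    proof induction
      case (step y z)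
      then show ?case using S(2)[of y] f_X by blast
    qed (rule base_X)
  qed
  have Y_\<alpha>: "\<alpha> d \<in> Y" and Y_f: "f d \<in> Y" if "d \<in> Y" for d
    using that by (auto simp: Y_def intro: rtrancl_into_rtrancl)
  define \<beta> where "\<beta> = (\<lambda>d. if d \<in> Y then \<alpha> d else d)"
  define \<phi> where "\<phi> = (\<lambda>d. if d \<in> Y then f d else d)"
  have \<beta>_Y [simp]: "\<beta> d = \<alpha> d" and \<phi>_Y [simp]: "\<phi> d = f d" if "d \<in> Y" for d
    using that by (auto simp: \<beta>_def \<phi>_def)
  have fin: "finite Y" using YX finite_subset by blast
  have \<alpha>Y: "\<alpha> d \<noteq> d" "\<alpha> (\<alpha> d) = d" "lab d \<in> letters m" "lab (\<alpha> d) = letter_inv (lab d)" if "d \<in> Y" for d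
    using S(2)[of d] that YX by blast+
  have \<phi>_perm: "\<phi> permutes Y"
  proof (rule bij_imp_permutes)
    have "inj_on f Y" using inj_f YX by (rule inj_on_subset)
    moreover have "f ` Y \<subseteq> Y" using Y_f by blast
    ultimately have "bij_betw f Y Y" using fin by (simp add: bij_betw_def endo_inj_surj)
    then show "bij_betw \<phi> Y Y" by (simp add: bij_betw_cong[of Y \<phi> f])
  qed (simp add: \<phi>_def)
  have \<beta>_perm: "\<beta> permutes Y"
  proof (rule bij_imp_permutes)
    have "inj_on \<alpha> Y" using \<alpha>Y(2) by (metis inj_onI)
    moreover have "\<alpha> ` Y \<subseteq> Y" using Y_\<alpha> by blast
    ultimately have "bij_betw \<alpha> Y Y" using fin by (simp add: bij_betw_def endo_inj_surj)
    then show "bij_betw \<beta> Y Y" by (simp add: bij_betw_cong[of Y \<beta> \<alpha>])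
  qed (simp add: \<beta>_def)
  have p: "permutation \<phi>" using fin \<phi>_perm by (auto simp: permutation_permutes)
  interpret dart_map Y \<beta> \<phi> "hd os"
  proof
    fix Z assume Z: "Z \<subseteq> Y" "hd os \<in> Z" "\<phi> ` Z \<subseteq> Z" "\<beta> ` Z \<subseteq> Z"
    have "d \<in> Z" if "d \<in> Y" for d
    proof -
      have "(hd os, d) \<in> {(z, z'). z' = \<alpha> z \<or> z' = f z}\<^sup>*" using that by (simp add: Y_def)
      then show ?thesis
      proof induction
        case (step y z)
        then have "y \<in> Y" "z = \<beta> y \<or> z = \<phi> y" using Z(1) by auto
        then show ?case using step.IH Z(3,4) by blast
      qed (rule Z(2))
    qed
    then show "Z = Y" using Z(1) by blast
  qed (use fin \<phi>_perm \<beta>_perm base \<alpha>Y Y_\<alpha> in auto)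
  have lists: "set l \<subseteq> Y" "map \<phi> l = rotate1 l" "distinct l" "l \<noteq> []" if "l \<in> set (os # fs)" "d \<in> set l" "d \<in> Y" for l d
  proof -
    have l: "distinct l" "l \<noteq> []" using S(1) that(1,2) by (auto simp: distinct_concat_iff)
    \<comment> \<open>\<open>\<phi>\<close> fixes everything outside \<open>Y\<close>, so it cannot
      show that a face meeting \<open>Y\<close> lies in \<open>Y\<close>; \<open>g\<close>, which
      follows \<open>f\<close> on all darts of the scheme, can.\<close>
    define g where "g = (\<lambda>d. if d \<in> ?X then f d else d)"
    have "bij_betw f ?X ?X" using inj_f f_X by (simp only: bij_betw_def)
    moreover have "bij_betw g ?X ?X \<longleftrightarrow> bij_betw f ?X ?X"
      by (rule bij_betw_cong) (simp only: g_def if_True)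
    ultimately have "g permutes ?X"
      by (intro bij_imp_permutes) (simp_all only: g_def if_False)
    then have "permutation g"
      unfolding permutation_permutes by (intro exI[of _ ?X] conjI finite_set)
    moreover have "map g l = rotate1 l"
    proof -
      have "map g l = map f l" using that(1) by (intro map_cong) (auto simp: g_def)
      then show ?thesis using f[OF that(1)] by simp
    qed
    ultimately have "orbit g d = set l" using that(2) l by (intro cyclic_list(2)) auto
    moreover have "d' \<in> Y" if "d' \<in> orbit g d" for d'
      using that \<open>d \<in> Y\<close> by induction (auto simp: g_def Y_f)
    ultimately show "set l \<subseteq> Y" by blast
    then show "map \<phi> l = rotate1 l" 
      using f[OF \<open>l \<in> set (os # fs)\<close>] map_cong[of l l \<phi> f] \<phi>_Y by (simp add: subset_iff)
    show "distinct l" "l \<noteq> []" by fact+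
  qed
  have orb: "orbit \<phi> d = set l" if "l \<in> set (os # fs)" "d \<in> set l" "d \<in> Y" for l d
    by (rule cyclic_list(2)[OF p lists(2-4)[OF that] that(2)])
  have in_list: "\<exists>l\<in>set (os # fs). d \<in> set l" if "d \<in> Y" for d
    using YX that by auto
  have euler: "card (orbit (\<phi> \<circ> \<beta>) ` Y) + card (orbit \<phi> ` Y) = card (orbit \<beta> ` Y) + 2"
  proof (rule euler_if_cohomology_trivial)
    fix \<psi> :: "nat \<Rightarrow> int"
    assume \<psi>: "\<And>d. d \<in> Y \<Longrightarrow> \<psi> (\<beta> d) = - \<psi> d" "\<And>d. d \<in> Y \<Longrightarrow> (\<Sum>e\<in>orbit \<phi> d. \<psi> e) = 0"
    define \<psi>' where "\<psi>' = (\<lambda>d. if d \<in> Y then \<psi> d else 0)"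
    have "\<exists>h. (\<forall>d\<in>?X. h (\<alpha> d) = h d + \<psi>' d) \<and> (\<forall>l\<in>set (os # fs). map h (rotate1 l) = map (h \<circ> \<alpha>) l)"
    proof (rule S(4))
      fix d assume d: "d \<in> ?X"
      show "\<psi>' (\<alpha> d) = - \<psi>' d"
      proof (cases "d \<in> Y")
        case True
        then show ?thesis using \<psi>(1)[of d] Y_\<alpha>[of d] by (simp add: \<psi>'_def)
      next
        case False
        moreover have "\<alpha> d \<notin> Y" using False Y_\<alpha>[of "\<alpha> d"] S(2)[OF d] by auto
        ultimately show ?thesis by (simp add: \<psi>'_def)
      qed
    next
      fix l assume l: "l \<in> set (os # fs)"
      show "sum_list (map \<psi>' l) = 0"
      proof (cases "\<exists>d. d \<in> set l \<and> d \<in> Y")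
        case True
        then obtain d where d: "d \<in> set l" "d \<in> Y" by blast
        have "map \<psi>' l = map \<psi> l"
          using lists(1)[OF l d] by (intro map_cong) (auto simp: \<psi>'_def)
        then have "sum_list (map \<psi>' l) = sum \<psi> (set l)"
          using lists(3)[OF l d] by (simp only: sum_list_distinct_conv_sum_set)
        then show ?thesis using \<psi>(2)[OF d(2)] orb[OF l d] by simp
      next
        case False
        then have "map \<psi>' l = map (\<lambda>_. 0) l" by (intro map_cong) (auto simp: \<psi>'_def)
        then show ?thesis by (simp only: sum_list_0)
      qed
    qed
    then obtain h where h: "\<And>d. d \<in> ?X \<Longrightarrow> h (\<alpha> d) = h d + \<psi>' d"
        "\<And>l. l \<in> set (os # fs) \<Longrightarrow> map h (rotate1 l) = map (h \<circ> \<alpha>) l" by blast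
    show "\<exists>h. \<forall>d\<in>Y. h (\<phi> d) = h (\<beta> d) \<and> h (\<beta> d) - h d = \<psi> d"
    proof (intro exI[of _ h] ballI conjI)
      fix d assume d: "d \<in> Y"
      then obtain l where l: "l \<in> set (os # fs)" "d \<in> set l" using in_list by blast
      have "map (h \<circ> f) l = map (h \<circ> \<alpha>) l"
        using h(2)[OF l(1)] f[OF l(1)] by (simp flip: map_map)
      then show "h (\<phi> d) = h (\<beta> d)" using l(2) d by simp
      show "h (\<beta> d) - h d = \<psi> d" using h(1)[of d] d YX by (simp add: \<psi>'_def subset_iff)
    qed
  qed
  let ?r = "{(z, z'). z' = \<beta> z \<or> z' = \<phi> z}\<^sup>*"
  have from_base: "(hd os, d) \<in> ?r" if "d \<in> Y" for d
  proof -
    have "{d \<in> Y. (hd os, d) \<in> ?r} = Y"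
      by (rule conn) (use base Y_f Y_\<alpha> in \<open>auto intro: rtrancl_into_rtrancl\<close>)
    then show ?thesis using that by blast
  qed
  have to_base: "(d, hd os) \<in> ?r" if "d \<in> Y" for d
  proof -
    have "(\<beta> e, e) \<in> ?r" if "e \<in> Y" for e
      using that Y_\<alpha> \<alpha>Y by (intro r_into_rtrancl) auto
    moreover have "(f e, e) \<in> ?r" if "e \<in> Y" for e
    proof -
      have "(x, y) \<in> ?r" if "y \<in> orbit \<phi> x" for x y
        using that by induction (auto intro: rtrancl_into_rtrancl)
      moreover have "e \<in> orbit \<phi> (\<phi> e)"
        using permutation_orbit_step[OF p, of e] permutation_self_in_orbit[OF p, of e] by simp
      ultimately have "(\<phi> e, e) \<in> ?r" by blast
      then show ?thesis using that by simp
    qed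
    ultimately have "{d \<in> Y. (d, hd os) \<in> ?r} = Y"
      by (intro conn) (use base Y_f Y_\<alpha> in \<open>auto intro: rtrancl_trans\<close>)
    then show ?thesis using that by blast
  qed
  have os: "support \<phi> (hd os) = os" "orbit \<phi> (hd os) = set os"
    using lists(2-4)[of os "hd os"] orb[of os "hd os"] base ne by (auto intro: cyclic_list(1)[OF p])
  define D where "D = \<lparr>darts = Y, dinv = \<beta>, dnext = \<phi>, dlabel = lab, dbase = hd os\<rparr>"
  have D: "darts D = Y" "dinv D = \<beta>" "dnext D = \<phi>" "dlabel D = lab" "dbase D = hd os"
    by (simp_all add: D_def)
  have "vk_diagram m R D"
    unfolding vk_diagram_def D
  proof (intro conjI impI ballI)
    show "dconnected D"
      unfolding dconnected_def D using from_base to_base by (blast intro: rtrancl_trans)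
    show "dplanar D"
      unfolding dplanar_def dvertices_def dfaces_def dedges_def D by (rule euler)
    fix F assume "F \<in> inner_faces D"
    then obtain d where d: "d \<in> Y" "F = orbit \<phi> d" "F \<noteq> set os"
      by (auto simp: inner_faces_def dfaces_def D os)
    then obtain l where l: "l \<in> set (os # fs)" "d \<in> set l" using in_list by blast
    then have F: "F = set l" using orb d by simp
    then have "l \<in> set fs" using l(1) d(3) by auto
    moreover have "support \<phi> (hd l) = l"
      using lists(2-4)[OF l d(1)] by (intro cyclic_list(1)[OF p])
    ultimately have "dword D (hd l) \<in> R \<or> word_inv (dword D (hd l)) \<in> R"
      using S(3)[of l] by (simp only: dword_def D)
    moreover have "hd l \<in> F" using F lists(4)[OF l d(1)] by simp
    ultimately show "\<exists>d\<in>F. dword D d \<in> R \<or> word_inv (dword D d) \<in> R" by blast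
  qed (use fin \<beta>_perm \<phi>_perm base \<alpha>Y Y_\<alpha> in auto)
  moreover have "boundary_word D = map lab os"
    using base os(1) by (auto simp: boundary_word_def dword_def D simp del: map_map)
  ultimately show ?thesis by blast
qed

text \<open>Van Kampen's lemma: the empty word bounds, and \<open>bounds\<close> is invariant under
  \<open>pres_rel\<close>. An empty outer face offers no base dart and is replaced by the one-vertex
  diagram.\<close>

lemma vk_diagram_exists:
  assumes "R \<subseteq> words m" "(w, []) \<in> pres_rel m R"
  shows "\<exists>D. vk_diagram m R D \<and> boundary_word D = w"
proof -
  have "bounds m R w" using pres_rel_bounds_iff[OF assms(2,1)] by simp
  then obtain os fs \<alpha> lab where sch: "scheme m R os fs \<alpha> lab" "map lab os = w"
    by (auto simp: bounds_def)
  show ?thesis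
  proof (cases "os = []")
    case True
    define D where "D = \<lparr>darts = {}, dinv = id, dnext = id, dlabel = (\<lambda>_. (0, True)), dbase = 0\<rparr>"
    have "vk_diagram m R D"
      by (auto simp: vk_diagram_def D_def inner_faces_def dfaces_def permutes_id)
    moreover have "boundary_word D = w" using sch(2) True by (simp add: boundary_word_def D_def)
    ultimately show ?thesis by blast
  qed (use scheme_imp_vk_diagram[OF sch(1)] sch(2) in auto)
qed

lemma minimal_diagram_exists:
  assumes "R \<subseteq> words m" "(w, []) \<in> pres_rel m R"
  shows "\<exists>D. minimal_diagram m R D \<and> boundary_word D = w"
proof -
  let ?P = "\<lambda>D. vk_diagram m R D \<and> boundary_word D = w"
  obtain D0 where "?P D0" using vk_diagram_exists[OF assms] by blast
  from ex_has_least_nat[of ?P D0 area, OF this]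
  obtain D where "?P D" "\<forall>D'. ?P D' \<longrightarrow> area D \<le> area D'" by blast
  then show ?thesis unfolding minimal_diagram_def by blast
qed

section \<open>Counting trivial words\<close>

definition trivial :: "nat \<Rightarrow> word set \<Rightarrow> word \<Rightarrow> bool" where
  "trivial m R w \<longleftrightarrow> w \<in> words m \<and> word_val m R w = \<one>\<^bsub>presented_group m R\<^esub>"

lemma trivial_words_eq: "trivial_words m R l = {w. trivial m R w \<and> reduced w \<and> length w = l}"
  by (auto simp: trivial_words_def trivial_def)

lemma trivial_iff_pres_rel:
  assumes "R \<subseteq> words m" "w \<in> words m"
  shows "trivial m R w \<longleftrightarrow> (w, []) \<in> pres_rel m R"
  using word_val_eq_iff[OF assms, of "[]"] assms(2) by (simp add: trivial_def one_presented_group)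

lemma word_val_append:
  assumes "R \<subseteq> words m" "v \<in> words m" "w \<in> words m"
  shows "word_val m R (v @ w) = word_val m R v \<otimes>\<^bsub>presented_group m R\<^esub> word_val m R w"
  using mult_presented_group[OF assms] by simp

lemma trivial_append_commute:
  assumes R: "R \<subseteq> words m" and "trivial m R (u @ v)" shows "trivial m R (v @ u)"
proof -
  interpret group "presented_group m R" by (rule group_presented_group[OF R])
  show ?thesis using assms(2) inv_comm by (auto simp: trivial_def word_val_append[OF R])
qed

lemma trivial_cancel:
  assumes R: "R \<subseteq> words m" and "x \<in> letters m" "u \<in> words m" "v \<in> words m"
  shows "trivial m R (u @ x # letter_inv x # v) \<longleftrightarrow> trivial m R (u @ v)"
  using pres_rel.cancel[OF assms(3,4,2), of R] assms word_val_eq_iff[OF R, of "u @ x # letter_inv x # v" "u @ v"]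
  by (simp add: trivial_def)

lemma trivial_conj:
  assumes R: "R \<subseteq> words m" and "x \<in> letters m" "trivial m R w"
  shows "trivial m R (x # w @ [letter_inv x])"
  using trivial_cancel[OF R, of "letter_inv x" w "[]"] assms(2,3)
    trivial_append_commute[OF R, of "w @ [letter_inv x]" "[x]"]
  by (simp add: trivial_def)

lemma finite_letters: "finite (letters m)" and card_letters: "card (letters m) = 2 * m"
  by (simp_all add: letters_def card_cartesian_product)

lemma finite_words_length: "finite {w \<in> words m. length w = n}"
  using finite_lists_length_eq[OF finite_letters, of m n]
  by (rule finite_subset[rotated]) (auto simp: words_def)

lemma finite_trivial_words: "finite (trivial_words m R l)"
  by (rule finite_subset[OF _ finite_words_length[of m l]]) (auto simp: trivial_words_def)

lemma reduced_simps [simp]: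
  "reduced []"
  "reduced [x]"
  "reduced (x # w) \<longleftrightarrow> reduced w \<and> (w \<noteq> [] \<longrightarrow> hd w \<noteq> letter_inv x)"
  by (auto simp: reduced_def successively_Cons)

lemma reduced_append:
  "reduced (v @ w) \<longleftrightarrow> reduced v \<and> reduced w \<and> (v \<noteq> [] \<longrightarrow> w \<noteq> [] \<longrightarrow> hd w \<noteq> letter_inv (last v))"
  by (auto simp: reduced_def successively_append_iff)

lemma letter_inv_neq [simp]: "letter_inv x \<noteq> x"
  by (cases x) (simp add: letter_inv_def)

lemma letter_inv_eq_iff [simp]: "letter_inv x = letter_inv y \<longleftrightarrow> x = y"
  by (metis letter_inv_simps(1))

text \<open>Conjugating a trivial word by a reduced word of length \<open>k\<close>: only the innermost letter of the
  conjugator may have two forbidden values.\<close>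

lemma card_conjugates:
  assumes R: "R \<subseteq> words m" and W: "W \<subseteq> trivial_words m R n" and n: "n > 0"
    and r: "\<And>w. w \<in> W \<Longrightarrow> r \<le> card {c \<in> letters m. c \<noteq> letter_inv (hd w) \<and> c \<noteq> last w}"
  shows "r * card W \<le> card {w \<in> trivial_words m R (n + 2). last w = letter_inv (hd w)}"
proof -
  let ?F = "\<lambda>w. {c \<in> letters m. c \<noteq> letter_inv (hd w) \<and> c \<noteq> last w}"
  let ?f = "\<lambda>(w, c). c # w @ [letter_inv c]"
  have finW: "finite W" using W finite_trivial_words finite_subset by blast
  have "r * card W = (\<Sum>w\<in>W. r)" by simp
  also have "\<dots> \<le> (\<Sum>w\<in>W. card (?F w))" using r by (intro sum_mono)
  also have "\<dots> = card (Sigma W ?F)" using finW finite_letters by (simp add: card_SigmaI)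
  also have "\<dots> = card (?f ` Sigma W ?F)"
    by (rule card_image[symmetric]) (auto simp: inj_on_def)
  also have "\<dots> \<le> card {w \<in> trivial_words m R (n + 2). last w = letter_inv (hd w)}"
  proof (rule card_mono)
    show "finite {w \<in> trivial_words m R (n + 2). last w = letter_inv (hd w)}"
      using finite_trivial_words by simp
    show "?f ` Sigma W ?F \<subseteq> {w \<in> trivial_words m R (n + 2). last w = letter_inv (hd w)}"
    proof clarify
      fix w c assume w: "w \<in> W" and c: "c \<in> letters m" "c \<noteq> letter_inv (hd w)" "c \<noteq> last w"
      have tw: "trivial m R w" "reduced w" "length w = n" using w W by (auto simp: trivial_words_eq)
      then have ne: "w \<noteq> []" using n by auto
      have "hd w \<noteq> letter_inv c" using c(2) by auto
      then have "reduced (c # w @ [letter_inv c])"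
        using tw(2) ne c(3) by (auto simp: reduced_append)
      then show "c # w @ [letter_inv c] \<in> trivial_words m R (n + 2) \<and>
          last (c # w @ [letter_inv c]) = letter_inv (hd (c # w @ [letter_inv c]))"
        using trivial_conj[OF R c(1) tw(1)] tw(3) by (simp add: trivial_words_eq)
    qed
  qed
  finally show ?thesis .
qed

text \<open>The first conjugation is only known not to lose words. Afterwards the last letter is the
  inverse of the first, a single letter is forbidden, and each conjugation gives the full factor
  \<open>2 * m - 1\<close>. The factor on the right makes up for the first one.\<close>

lemma padding:
  assumes R: "R \<subseteq> words m" and m: "m \<ge> 2" and n: "n > 0"
  shows "(2 * m - 1) ^ k * card (trivial_words m R n) \<le> (2 * m - 1) * card (trivial_words m R (n + 2 * k))"
proof (cases k)
  case 0
  have "1 \<le> 2 * m - 1" using m by simp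
  then show ?thesis using 0 mult_le_mono1 by fastforce
next
  case (Suc k')
  let ?q = "2 * m - 1"
  let ?K = "\<lambda>n. {w \<in> trivial_words m R n. last w = letter_inv (hd w)}"
  have letters_in: "hd w \<in> letters m" "last w \<in> letters m" if "w \<in> trivial_words m R l" "l > 0" for w l
    using that by (auto simp: trivial_words_def words_def in_lists_conv_set)
  have first: "card (trivial_words m R n) \<le> card (?K (n + 2))"
  proof -
    have "1 * card (trivial_words m R n) \<le> card (?K (n + 2))"
    proof (rule card_conjugates[OF R subset_refl n])
      fix w assume w: "w \<in> trivial_words m R n"
      have "card (letters m - {letter_inv (hd w), last w}) \<ge> card (letters m) - card {letter_inv (hd w), last w}"
        by (rule diff_card_le_card_Diff) simp
      moreover have "card {letter_inv (hd w), last w} \<le> 2" by (simp add: card_insert_if)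
      moreover have "letters m - {letter_inv (hd w), last w} =
          {c \<in> letters m. c \<noteq> letter_inv (hd w) \<and> c \<noteq> last w}" by auto
      ultimately show "1 \<le> card {c \<in> letters m. c \<noteq> letter_inv (hd w) \<and> c \<noteq> last w}"
        using m card_letters[of m] by simp
    qed
    then show ?thesis by simp
  qed
  have next_K: "?q * card (?K l) \<le> card (?K (l + 2))" if "l > 0" for l
  proof (rule card_conjugates[OF R _ that])
    fix w assume w: "w \<in> ?K l"
    have "{c \<in> letters m. c \<noteq> letter_inv (hd w) \<and> c \<noteq> last w} = letters m - {last w}"
      using w by auto
    then show "?q \<le> card {c \<in> letters m. c \<noteq> letter_inv (hd w) \<and> c \<noteq> last w}"
      using letters_in(2)[of w l] w that card_letters[of m] by (simp add: card_Diff_singleton)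
  qed auto
  have "?q ^ j * card (?K (n + 2)) \<le> card (?K (n + 2 + 2 * j))" for j
  proof (induction j)
    case (Suc j)
    have "?q ^ Suc j * card (?K (n + 2)) \<le> ?q * card (?K (n + 2 + 2 * j))"
      using Suc by (simp add: mult.assoc)
    also have "\<dots> \<le> card (?K (n + 2 + 2 * Suc j))"
      using next_K[of "n + 2 + 2 * j"] by (simp add: add.assoc)
    finally show ?case .
  qed simp
  note K = this[of k']
  have "?q ^ k' * card (trivial_words m R n) \<le> ?q ^ k' * card (?K (n + 2))"
    using first by (rule mult_le_mono2)
  also note K
  also have "n + 2 + 2 * k' = n + 2 * k" using Suc by simp
  finally have "?q ^ k' * card (trivial_words m R n) \<le> card (?K (n + 2 * k))" .
  also have "\<dots> \<le> card (trivial_words m R (n + 2 * k))"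
    using finite_trivial_words by (intro card_mono) auto
  finally show ?thesis using Suc by (simp add: mult.assoc)
qed

section \<open>Completing a short word to a trivial one\<close>

definition completions :: "nat \<Rightarrow> word set \<Rightarrow> nat \<Rightarrow> word \<Rightarrow> word set" where
  "completions m R n u = {y \<in> words m. reduced y \<and> length y = n \<and> trivial m R (y @ u)}"

text \<open>The part of \<open>w = x @ y @ z\<close> outside the cut, read cyclically.
  \<open>z\<close> and \<open>x\<close> are reduced only separately, since \<open>w\<close> need not
  be cyclically reduced and letters may cancel where \<open>z\<close> meets
  \<open>x\<close>.\<close>

definition pair_completions :: "nat \<Rightarrow> word set \<Rightarrow> nat \<Rightarrow> nat \<Rightarrow> word \<Rightarrow> (word \<times> word) set" where
  "pair_completions m R i j u = {(z, x). z \<in> words m \<and> x \<in> words m \<and> reduced z \<and> reduced x \<and>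
     length z = j \<and> length x = i \<and> trivial m R (z @ x @ u)}"

lemma finite_completions: "finite (completions m R n u)"
  by (rule finite_subset[OF _ finite_words_length[of m n]]) (auto simp: completions_def)

lemma finite_pair_completions: "finite (pair_completions m R i j u)"
  by (rule finite_subset[OF _ finite_cartesian_product[OF finite_words_length[of m j] finite_words_length[of m i]]])
    (auto simp: pair_completions_def)

context
  fixes m :: nat and R :: "word set" and M :: nat and b :: real
  assumes R: "R \<subseteq> words m" and m: "m \<ge> 2"
    and b: "\<And>n k. n + 2 * k = M \<Longrightarrow> real (2 * m - 1) ^ k * real (card (trivial_words m R n)) \<le> b"
begin

text \<open>The letter \<open>x\<close> moves from the fixed word to the completion: it either
  prolongs the reduced word or cancels its last letter, which is then determined by
  \<open>x\<close>.\<close>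

lemma card_completions_Cons:
  "card (completions m R n (x # u)) \<le>
    card (completions m R (Suc n) u) + (if n = 0 then 0 else card (completions m R (n - 1) u))"
proof -
  let ?E = "completions m R (Suc n) u"
  let ?E' = "if n = 0 then {} else completions m R (n - 1) u"
  have "completions m R n (x # u) \<subseteq> butlast ` ?E \<union> (\<lambda>y. y @ [letter_inv x]) ` ?E'"
  proof
    fix y assume y: "y \<in> completions m R n (x # u)"
    then have x: "x \<in> letters m" by (simp add: completions_def trivial_def)
    show "y \<in> butlast ` ?E \<union> (\<lambda>y. y @ [letter_inv x]) ` ?E'"
    proof (cases "y = [] \<or> x \<noteq> letter_inv (last y)")
      case True
      then have "y @ [x] \<in> ?E" using y x by (auto simp: completions_def reduced_append)
      then have "butlast (y @ [x]) \<in> butlast ` ?E" by (rule imageI)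
      then show ?thesis by simp
    next
      case False
      then obtain y' where y': "y = y' @ [letter_inv x]" by (metis append_butlast_last_id letter_inv_simps(1))
      have "trivial m R (y' @ u) \<longleftrightarrow> trivial m R (y @ x # u)"
        using trivial_cancel[OF R, of "letter_inv x" y' u] y x unfolding y'
        by (auto simp: completions_def trivial_def)
      then have "y' \<in> ?E'" using y y' by (auto simp: completions_def reduced_append)
      then show ?thesis using y' by blast
    qed
  qed
  then have "card (completions m R n (x # u)) \<le> card (butlast ` ?E \<union> (\<lambda>y. y @ [letter_inv x]) ` ?E')"
    by (intro card_mono) (auto simp: finite_completions)
  also have "\<dots> \<le> card (butlast ` ?E) + card ((\<lambda>y. y @ [letter_inv x]) ` ?E')" by (rule card_Un_le)
  also have "\<dots> \<le> card ?E + card ?E'"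
    by (intro add_mono card_image_le) (auto simp: finite_completions)
  finally show ?thesis by (simp split: if_splits)
qed

text \<open>Each letter of \<open>u\<close> leads to two cases, hence \<open>2 ^ length u\<close>.
  The sum \<open>n + 2 * k + length u\<close> stays equal to \<open>M\<close>: a cancellation loses
  two letters in all and raises \<open>k\<close> by one, so the bound \<open>b\<close> for a single
  \<open>M\<close> covers all cases.\<close>

lemma card_completions_le:
  assumes "u \<in> words m" "n + 2 * k + length u = M"
  shows "real (2 * m - 1) ^ k * real (card (completions m R n u)) \<le> 2 ^ length u * b"
  using assms
proof (induction u arbitrary: n k)
  case Nil
  have "completions m R n [] = trivial_words m R n"
    by (auto simp: completions_def trivial_words_eq trivial_def)
  then show ?case using b[of n k] Nil by simp
next
  case (Cons x u)
  let ?q = "real (2 * m - 1)"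
  let ?c = "\<lambda>n. real (card (completions m R n u))"
  have 1: "?q ^ k * ?c (Suc n) \<le> 2 ^ length u * b"
    using Cons.IH[of "Suc n" k] Cons.prems by simp
  have "0 \<le> ?q ^ k * ?c (Suc n)" by simp
  then have nonneg: "0 \<le> 2 ^ length u * b" using 1 by linarith
  have 2: "?q ^ k * (if n = 0 then 0 else ?c (n - 1)) \<le> 2 ^ length u * b"
  proof (cases "n = 0")
    case False
    have "?q ^ k * ?c (n - 1) \<le> ?q ^ Suc k * ?c (n - 1)"
      using m by (intro mult_right_mono power_increasing) auto
    also have "\<dots> \<le> 2 ^ length u * b"
      using Cons.IH[of "n - 1" "Suc k"] Cons.prems False by simp
    finally show ?thesis using False by simp
  qed (use nonneg in simp)
  have "real (card (completions m R n (x # u))) \<le> ?c (Suc n) + (if n = 0 then 0 else ?c (n - 1))"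
    using card_completions_Cons[of n x u] by (auto split: if_splits)
  then have "?q ^ k * real (card (completions m R n (x # u))) \<le>
      ?q ^ k * (?c (Suc n) + (if n = 0 then 0 else ?c (n - 1)))"
    by (intro mult_left_mono) auto
  also have "\<dots> \<le> 2 ^ length u * b + 2 ^ length u * b"
    unfolding distrib_left using 1 2 by (rule add_mono)
  finally show ?case by (simp add: mult_ac)
qed

text \<open>Either \<open>z @ x\<close> is reduced, or the first letter \<open>c\<close> of
  \<open>x\<close> cancels against the last letter of \<open>z\<close>. In the second case
  \<open>c\<close> must be remembered; the next letter of \<open>x\<close>, if there is one,
  excludes one value.\<close>

lemma card_pair_completions_Suc:
  "card (pair_completions m R (Suc i) j u) \<le> card (completions m R (Suc i + j) u) +
    (if j = 0 then 0 else (if i = 0 then 2 * m else 2 * m - 1) * card (pair_completions m R i (j - 1) u))"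
proof -
  let ?E = "completions m R (Suc i + j) u"
  let ?P = "if j = 0 then {} else pair_completions m R i (j - 1) u"
  let ?F = "\<lambda>(z :: word, x). {c \<in> letters m. x \<noteq> [] \<longrightarrow> c \<noteq> letter_inv (hd x)}"
  let ?f = "\<lambda>((z, x), c). (z @ [letter_inv c], c # x)"
  let ?N = "if i = 0 then 2 * m else 2 * m - 1"
  have fin: "finite ?P" by (simp add: finite_pair_completions)
  have finF: "finite (Sigma ?P ?F)" using fin finite_letters by (auto intro!: finite_SigmaI)
  have "pair_completions m R (Suc i) j u \<subseteq> (\<lambda>w. (take j w, drop j w)) ` ?E \<union> ?f ` Sigma ?P ?F"
  proof clarify
    fix z x assume zx: "(z, x) \<in> pair_completions m R (Suc i) j u"
      and no: "(z, x) \<notin> ?f ` Sigma ?P ?F"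
    then obtain c x' where x: "x = c # x'" by (cases x) (auto simp: pair_completions_def)
    have c: "c \<in> letters m" using zx x by (simp add: pair_completions_def)
    have join: "z = [] \<or> c \<noteq> letter_inv (last z)"
    proof (rule ccontr)
      assume "\<not> ?thesis"
      then obtain z' where z': "z = z' @ [letter_inv c]" by (metis append_butlast_last_id letter_inv_simps(1))
      have "trivial m R (z' @ x' @ u) \<longleftrightarrow> trivial m R (z @ x @ u)"
        using trivial_cancel[OF R, of "letter_inv c" z' "x' @ u"] zx c unfolding z' x
        by (auto simp: pair_completions_def trivial_def)
      then have "(z', x') \<in> ?P" using zx x z' by (auto simp: pair_completions_def reduced_append)
      moreover have "c \<in> ?F (z', x')" using zx x c by (auto simp: pair_completions_def)
      ultimately have "?f ((z', x'), c) \<in> ?f ` Sigma ?P ?F" by (intro imageI SigmaI)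
      then show False using no x z' by simp
    qed
    then have "z @ x \<in> ?E" using zx x by (auto simp: pair_completions_def completions_def reduced_append)
    then have "(take j (z @ x), drop j (z @ x)) \<in> (\<lambda>w. (take j w, drop j w)) ` ?E" by (rule imageI)
    then show "(z, x) \<in> (\<lambda>w. (take j w, drop j w)) ` ?E"
      using zx by (simp add: pair_completions_def)
  qed
  then have "card (pair_completions m R (Suc i) j u) \<le>
      card ((\<lambda>w. (take j w, drop j w)) ` ?E \<union> ?f ` Sigma ?P ?F)"
    using finF by (intro card_mono) (auto simp: finite_completions)
  also have "\<dots> \<le> card ((\<lambda>w. (take j w, drop j w)) ` ?E) + card (?f ` Sigma ?P ?F)" by (rule card_Un_le)
  also have "\<dots> \<le> card ?E + card (Sigma ?P ?F)"
    using finF by (intro add_mono card_image_le finite_completions)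
  also have "card (Sigma ?P ?F) \<le> ?N * card ?P"
  proof -
    have "card (?F zx) \<le> ?N" if "zx \<in> ?P" for zx
    proof (cases "i = 0")
      case True
      then show ?thesis
        using card_mono[OF finite_letters, of "?F zx" m] card_letters[of m] by (auto split: prod.splits)
    next
      case False
      obtain z x where zx: "zx = (z, x)" by fastforce
      then have "x \<noteq> []" "letter_inv (hd x) \<in> letters m"
        using that False by (auto simp: pair_completions_def words_def in_lists_conv_set split: if_splits)
      moreover from this have "?F zx = letters m - {letter_inv (hd x)}" using zx by auto
      ultimately show ?thesis using False card_letters[of m] by (simp add: card_Diff_singleton)
    qed
    then have "(\<Sum>zx\<in>?P. card (?F zx)) \<le> (\<Sum>zx\<in>?P. ?N)" by (rule sum_mono)
    moreover have "card (Sigma ?P ?F) = (\<Sum>zx\<in>?P. card (?F zx))"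
      using fin finite_letters by (intro card_SigmaI) auto
    ultimately show ?thesis by (simp add: mult.commute)
  qed
  finally show ?thesis by (simp split: if_splits)
qed

text \<open>A cancelled pair has about \<open>2 * m - 1\<close> possible letters but raises
  \<open>k\<close> by one; these factors balance, so the possible depths of cancellation add up
  instead of multiplying. The factor \<open>2 * m - 1\<close> after \<open>i\<close> leaves room for
  the pair that uses up \<open>x\<close>, which has \<open>2 * m\<close> choices.\<close>

lemma card_pair_completions_le:
  assumes "u \<in> words m" "i + j + 2 * k + length u = M"
  shows "real (2 * m - 1) ^ k * real (card (pair_completions m R i j u)) \<le>
    (1 + real i * real (2 * m - 1)) * (2 ^ length u * b)"
  using assms(2)
proof (induction i arbitrary: j k)
  case 0
  have "pair_completions m R 0 j u = (\<lambda>y. (y, [])) ` completions m R j u"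
    by (auto simp: pair_completions_def completions_def)
  moreover have "card ((\<lambda>y. (y, [] :: word)) ` completions m R j u) = card (completions m R j u)"
    by (rule card_image) (auto simp: inj_on_def)
  ultimately show ?case using card_completions_le[OF assms(1), of j k] 0 by simp
next
  case (Suc i)
  let ?q = "real (2 * m - 1)" and ?B = "2 ^ length u * b"
  let ?c = "\<lambda>j. real (card (pair_completions m R i j u))"
  let ?N = "if i = 0 then 2 * m else 2 * m - 1"
  have q: "?q \<ge> 3" using m by linarith
  have 1: "?q ^ k * real (card (completions m R (Suc i + j) u)) \<le> ?B"
    using card_completions_le[OF assms(1), of "Suc i + j" k] Suc.prems by simp
  have "0 \<le> ?q ^ k * real (card (completions m R (Suc i + j) u))" by simp
  then have nonneg: "0 \<le> ?B" using 1 by linarith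
  have 2: "?q ^ k * (if j = 0 then 0 else real ?N * ?c (j - 1)) \<le> (real i * ?q + ?q) * ?B"
  proof (cases "j = 0")
    case True
    then show ?thesis using nonneg q by simp
  next
    case False
    have IH: "?q ^ Suc k * ?c (j - 1) \<le> (1 + real i * ?q) * ?B"
      using Suc.IH[of "j - 1" "Suc k"] Suc.prems False by simp
    show ?thesis
    proof (cases "i = 0")
      case True
      have "?q ^ k * (real (2 * m) * ?c (j - 1)) \<le> ?q ^ k * (?q * ?q * ?c (j - 1))"
      proof (intro mult_left_mono mult_right_mono)
        have "real (2 * m) = ?q + 1" using m by simp
        also have "\<dots> \<le> ?q * 3" using q by linarith
        also have "\<dots> \<le> ?q * ?q" using q by (intro mult_left_mono) auto
        finally show "real (2 * m) \<le> ?q * ?q" .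
      qed auto
      also have "\<dots> = ?q * (?q ^ Suc k * ?c (j - 1))" by simp
      also have "\<dots> \<le> ?q * ((1 + real i * ?q) * ?B)" using IH by (intro mult_left_mono) auto
      finally show ?thesis using False True by simp
    next
      case i: False
      have "?q ^ k * (?q * ?c (j - 1)) = ?q ^ Suc k * ?c (j - 1)" by simp
      also have "\<dots> \<le> (1 + real i * ?q) * ?B" by (rule IH)
      also have "\<dots> \<le> (real i * ?q + ?q) * ?B" using q nonneg by (intro mult_right_mono) auto
      finally show ?thesis using False i by simp
    qed
  qed
  have "real (card (pair_completions m R (Suc i) j u)) \<le>
      real (card (completions m R (Suc i + j) u)) + (if j = 0 then 0 else real ?N * ?c (j - 1))"
    using of_nat_mono[OF card_pair_completions_Suc[of i j u], where 'a = real]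
    by (simp only: of_nat_add of_nat_mult if_distrib[of real] of_nat_0)
  then have "?q ^ k * real (card (pair_completions m R (Suc i) j u)) \<le>
      ?q ^ k * (real (card (completions m R (Suc i + j) u)) + (if j = 0 then 0 else real ?N * ?c (j - 1)))"
    by (intro mult_left_mono) auto
  also have "\<dots> \<le> ?B + (real i * ?q + ?q) * ?B"
    unfolding distrib_left[of "?q ^ k"] using 1 2 by (rule add_mono)
  also have "\<dots> = (1 + real (Suc i) * ?q) * ?B" by (simp add: algebra_simps)
  finally show ?case .
qed

end

section \<open>The recursive inequality for the number of trivial words\<close>

lemma card_words_le: "card {p \<in> words m. length p \<le> s} \<le> (2 * m + 1) ^ s"
proof -
  have "{p \<in> words m. length p \<le> s} = {p. set p \<subseteq> letters m \<and> length p \<le> s}"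
    by (auto simp: words_def)
  then have "card {p \<in> words m. length p \<le> s} = (\<Sum>i\<le>s. (2 * m) ^ i)"
    using card_lists_length_le[OF finite_letters, of m s] card_letters[of m] by simp
  also have "\<dots> \<le> (2 * m + 1) ^ s"
  proof (induction s)
    case (Suc s)
    have "(2 * m) ^ Suc s \<le> 2 * m * (2 * m + 1) ^ s"
      unfolding power_Suc by (intro mult_le_mono2 power_mono) auto
    then have "(\<Sum>i\<le>s. (2 * m) ^ i) + (2 * m) ^ Suc s \<le> (2 * m + 1) ^ s + 2 * m * (2 * m + 1) ^ s"
      using Suc by (rule add_mono[rotated])
    then show ?case unfolding sum.atMost_Suc by simp
  qed simp
  finally show ?thesis .
qed

text \<open>Since \<open>\<beta> \<ge> 1/2\<close>, replacing a trivial word by one that is \<open>2 * k\<close> letters shorter gains at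
  least the factor \<open>(2 * m - 1) ^ k\<close>. Padding up to \<open>M + 2\<close> instead of \<open>M\<close> avoids rounding when
  the cut produces a part that is slightly shorter than a quarter of the word.\<close>

lemma padded_bound:
  assumes R: "R \<subseteq> words m" and m: "m \<ge> 2" and \<beta>: "\<beta> \<ge> 1 / 2" and nk: "n + 2 * k = M"
    and bnd: "real (card (trivial_words m R (M + 2))) \<le> real (2 * m - 1) powr (\<beta> * real (M + 2))"
  shows "real (2 * m - 1) ^ k * real (card (trivial_words m R n)) \<le>
    real (2 * m - 1) powr (1 + \<beta> * real (M + 2))"
proof -
  let ?q = "real (2 * m - 1)"
  have q: "?q \<ge> 3" using m by linarith
  show ?thesis
  \<comment> \<open>The empty word has no reduced conjugates of positive length; here the power
    \<open>(2 * m - 1) ^ k\<close> itself is compared with the bound, using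
    \<open>\<beta> \<ge> 1 / 2\<close>.\<close>
  proof (cases "n = 0")
    case True
    have "trivial_words m R 0 \<subseteq> {[]}" by (auto simp: trivial_words_def)
    then have "card (trivial_words m R 0) \<le> 1" using card_mono[of "{[]}" "trivial_words m R 0"] by simp
    then have "?q ^ k * real (card (trivial_words m R n)) \<le> ?q ^ k * 1"
      using True by (intro mult_left_mono) auto
    also have "\<dots> = ?q powr real k" using q by (simp add: powr_realpow)
    also have "\<dots> \<le> ?q powr (1 + \<beta> * real (M + 2))"
    proof (rule powr_mono)
      have "1 / 2 * real (M + 2) \<le> \<beta> * real (M + 2)" using \<beta> by (intro mult_right_mono) auto
      moreover have "real k = 1 / 2 * real M" using nk True by simp
      moreover have "1 / 2 * real (M + 2) = 1 / 2 * real M + 1" by simp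
      ultimately show "real k \<le> 1 + \<beta> * real (M + 2)" by linarith
    qed (use q in simp)
    finally show ?thesis .
  next
    case False
    have "(2 * m - 1) ^ k * card (trivial_words m R n) \<le> (2 * m - 1) ^ Suc k * card (trivial_words m R n)"
      using m by (intro mult_le_mono1 power_increasing) auto
    also have "\<dots> \<le> (2 * m - 1) * card (trivial_words m R (n + 2 * Suc k))"
      using False by (intro padding[OF R m]) simp
    also have "n + 2 * Suc k = M + 2" using nk by simp
    finally have "real ((2 * m - 1) ^ k * card (trivial_words m R n)) \<le>
        real ((2 * m - 1) * card (trivial_words m R (M + 2)))"
      by (rule of_nat_mono)
    then have "?q ^ k * real (card (trivial_words m R n)) \<le> ?q * real (card (trivial_words m R (M + 2)))"
      by (simp only: of_nat_mult of_nat_power)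
    also have "\<dots> \<le> ?q * ?q powr (\<beta> * real (M + 2))"
      using bnd by (intro mult_left_mono) auto
    also have "\<dots> = ?q powr (1 + \<beta> * real (M + 2))" using q by (simp add: powr_add)
    finally show ?thesis .
  qed
qed

text \<open>Write \<open>w = x @ y @ z\<close> with \<open>y\<close> equal to \<open>p\<close> in
  the group. Then \<open>y @ word_inv p\<close> and \<open>x @ p @ z\<close> are trivial; the latter
  is rotated to \<open>z @ x @ p\<close>, so that the short word comes last in both.\<close>

lemma cut_decomposition:
  assumes R: "R \<subseteq> words m" and w: "w \<in> trivial_words m R l" and ij: "i \<le> j" "j \<le> l"
    and p: "p \<in> words m" "word_val m R (take j w) = word_val m R (take i w @ p)"
  shows "w \<in> (\<lambda>(y, z, x). x @ y @ z) `
    (completions m R (j - i) (word_inv p) \<times> pair_completions m R i (l - j) p)"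
proof -
  interpret group "presented_group m R" by (rule group_presented_group[OF R])
  define x y z where "x = take i w" "y = drop i (take j w)" "z = drop j w"
  note defs = this
  have xy: "take j w = x @ y" using ij by (simp add: defs) (metis append_take_drop_id min.absorb1 take_take)
  then have xyz: "w = x @ y @ z" by (metis append.assoc append_take_drop_id defs(3))
  have tr: "trivial m R w" "reduced w" "length w = l" using w by (auto simp: trivial_words_eq)
  have ww: "x \<in> words m" "y \<in> words m" "z \<in> words m" using tr(1) xyz by (auto simp: trivial_def)
  have red: "reduced x" "reduced y" "reduced z" using tr(2) xyz by (auto simp: reduced_append)
  have eq: "word_val m R (x @ y) = word_val m R (x @ p)" using p(2) xy by (simp add: defs(1))
  then have yp: "word_val m R y = word_val m R p"
    using ww p(1) by (simp add: word_val_append[OF R])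
  have "trivial m R (p @ word_inv p)"
    using pres_rel_word_inv[of "word_inv p" m R] p(1) trivial_iff_pres_rel[OF R] by simp
  then have "trivial m R (y @ word_inv p)"
    using yp ww(2) p(1) by (auto simp: trivial_def word_val_append[OF R])
  then have "y \<in> completions m R (j - i) (word_inv p)"
    using ww(2) red(2) tr(3) ij by (simp add: completions_def defs(2))
  moreover have "trivial m R ((x @ p) @ z)"
  proof -
    have "word_val m R ((x @ p) @ z) = word_val m R (x @ y) \<otimes>\<^bsub>presented_group m R\<^esub> word_val m R z"
      using word_val_append[OF R, of "x @ p" z] ww p(1) eq by simp
    also have "\<dots> = word_val m R w" using word_val_append[OF R, of "x @ y" z] ww xyz by simp
    finally show ?thesis using tr(1) ww p(1) by (simp add: trivial_def)
  qed
  then have "trivial m R (z @ x @ p)" by (rule trivial_append_commute[OF R])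
  then have "(z, x) \<in> pair_completions m R i (l - j) p"
    using ww red tr(3) ij by (simp add: pair_completions_def defs(1,3))
  ultimately have "(y, z, x) \<in> completions m R (j - i) (word_inv p) \<times> pair_completions m R i (l - j) p"
    by blast
  then show ?thesis using xyz by (metis (no_types, lifting) case_prod_conv image_eqI)
qed

text \<open>In powers of \<open>2 * m - 1\<close>, the choice of \<open>p\<close> costs
  \<open>2 * s\<close> and moving its letters into the two parts costs \<open>s\<close> each.
  \<open>padded_bound\<close> costs 1 for each part, and \<open>1 + i * (2 * m - 1)\<close> another
  1 together with a factor \<open>l + 1\<close>; the choice of \<open>i\<close> and \<open>j\<close>
  gives the other two factors \<open>l + 1\<close>. The padded lengths of the two parts add up to at
  most \<open>l + 2 * s + 4\<close>.\<close>

lemma counting_step: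
  assumes R: "R \<subseteq> words m" and m: "m \<ge> 2" and \<beta>: "\<beta> \<ge> 1 / 2"
    and cut: "\<And>w. w \<in> trivial_words m R l \<Longrightarrow>
      \<exists>i j p. i \<le> j \<and> j \<le> l \<and> l div 4 \<le> j - i \<and> l div 4 \<le> l - (j - i) \<and>
        p \<in> words m \<and> length p \<le> s \<and> word_val m R (take j w) = word_val m R (take i w @ p)"
    and bnd: "\<And>n. l div 4 + 2 \<le> n \<Longrightarrow> n \<le> l - l div 4 + s + 2 \<Longrightarrow>
      real (card (trivial_words m R n)) \<le> real (2 * m - 1) powr (\<beta> * real n)"
  shows "real (card (trivial_words m R l)) \<le>
    (real l + 1) ^ 3 * real (2 * m - 1) powr (4 * real s + 3 + \<beta> * (real l + 2 * real s + 4))"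
proof -
  let ?q = "real (2 * m - 1)"
  have q: "?q \<ge> 3" using m by linarith
  let ?I = "{(i, j). i \<le> j \<and> j \<le> l \<and> l div 4 \<le> j - i \<and> l div 4 \<le> l - (j - i)}"
  let ?U = "{p \<in> words m. length p \<le> s}"
  let ?A = "\<lambda>((i, j), p). (\<lambda>(y, z, x). x @ y @ z) `
    (completions m R (j - i) (word_inv p) \<times> pair_completions m R i (l - j) p)"
  define T where "T = ?q powr (2 * real s + 3 + \<beta> * (real l + 2 * real s + 4)) * (real l + 1)"
  have finI: "finite ?I" by (rule finite_subset[of _ "{..l} \<times> {..l}"]) auto
  have finU: "finite ?U"
    using finite_lists_length_le[OF finite_letters, of m s]
    by (rule finite_subset[rotated]) (auto simp: words_def)
  have "trivial_words m R l \<subseteq> (\<Union>t\<in>?I \<times> ?U. ?A t)"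
  proof
    fix w assume w: "w \<in> trivial_words m R l"
    then obtain i j p where ijp: "(i, j) \<in> ?I" "p \<in> ?U"
      "word_val m R (take j w) = word_val m R (take i w @ p)"
      using cut by blast
    then have "w \<in> ?A ((i, j), p)" using cut_decomposition[OF R w, of i j p] by simp
    then show "w \<in> (\<Union>t\<in>?I \<times> ?U. ?A t)" using ijp by blast
  qed
  then have "card (trivial_words m R l) \<le> card (\<Union>t\<in>?I \<times> ?U. ?A t)"
    using finI finU by (intro card_mono finite_UN_I) (auto simp: finite_completions finite_pair_completions)
  also have "\<dots> \<le> (\<Sum>t\<in>?I \<times> ?U. card (?A t))" using finI finU by (intro card_UN_le) simp
  finally have "real (card (trivial_words m R l)) \<le> (\<Sum>t\<in>?I \<times> ?U. real (card (?A t)))"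
    by (simp flip: of_nat_sum)
  also have "\<dots> \<le> (\<Sum>t\<in>?I \<times> ?U. T)"
  proof (rule sum_mono)
    fix t assume "t \<in> ?I \<times> ?U"
    then obtain i j p where t: "t = ((i, j), p)" "i \<le> j" "j \<le> l" "l div 4 \<le> j - i" "l div 4 \<le> l - (j - i)"
      "p \<in> words m" "length p \<le> s" by auto
    let ?n1 = "j - i + length p" and ?n2 = "l - (j - i) + length p"
    have q4: "(2::real) ^ length p \<le> ?q powr real s"
    proof -
      have "(2::real) ^ length p \<le> 2 ^ s" using t(7) by (intro power_increasing) auto
      also have "\<dots> \<le> ?q ^ s" using q by (intro power_mono) auto
      finally show ?thesis using q by (simp add: powr_realpow)
    qed
    have len: "length (word_inv p) = length p" by (simp add: word_inv_def)
    have b1: "real (card (completions m R (j - i) (word_inv p))) \<le>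
        ?q powr real s * ?q powr (1 + \<beta> * real (?n1 + 2))"
    proof -
      have "?q ^ 0 * real (card (completions m R (j - i) (word_inv p))) \<le>
          2 ^ length (word_inv p) * ?q powr (1 + \<beta> * real (?n1 + 2))"
      proof (rule card_completions_le[OF R m])
        show "?q ^ k * real (card (trivial_words m R n)) \<le> ?q powr (1 + \<beta> * real (?n1 + 2))"
          if "n + 2 * k = ?n1" for n k
          using that t by (intro padded_bound[OF R m \<beta>] bnd) auto
      qed (use t len in auto)
      also have "\<dots> \<le> ?q powr real s * ?q powr (1 + \<beta> * real (?n1 + 2))"
        unfolding len using q4 by (intro mult_right_mono) auto
      finally show ?thesis by simp
    qed
    have b2: "real (card (pair_completions m R i (l - j) p)) \<le>
        (1 + real i * ?q) * (?q powr real s * ?q powr (1 + \<beta> * real (?n2 + 2)))"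
    proof -
      have "?q ^ 0 * real (card (pair_completions m R i (l - j) p)) \<le>
          (1 + real i * ?q) * (2 ^ length p * ?q powr (1 + \<beta> * real (?n2 + 2)))"
      proof (rule card_pair_completions_le[OF R m])
        show "?q ^ k * real (card (trivial_words m R n)) \<le> ?q powr (1 + \<beta> * real (?n2 + 2))"
          if "n + 2 * k = ?n2" for n k
          using that t by (intro padded_bound[OF R m \<beta>] bnd) auto
      qed (use t in auto)
      also have "\<dots> \<le> (1 + real i * ?q) * (?q powr real s * ?q powr (1 + \<beta> * real (?n2 + 2)))"
        using q4 q by (intro mult_left_mono mult_right_mono) auto
      finally show ?thesis by simp
    qed
    have "card (?A t) \<le> card (completions m R (j - i) (word_inv p) \<times> pair_completions m R i (l - j) p)"
      unfolding t(1) prod.case by (intro card_image_le) (auto simp: finite_completions finite_pair_completions)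
    then have "real (card (?A t)) \<le> real (card (completions m R (j - i) (word_inv p))) *
        real (card (pair_completions m R i (l - j) p))"
      by (simp add: card_cartesian_product flip: of_nat_mult)
    also have "\<dots> \<le> (?q powr real s * ?q powr (1 + \<beta> * real (?n1 + 2))) *
        ((1 + real i * ?q) * (?q powr real s * ?q powr (1 + \<beta> * real (?n2 + 2))))"
      using b1 b2 by (intro mult_mono) auto
    also have "\<dots> = ?q powr (2 * real s + 2 + \<beta> * (real l + 2 * real (length p) + 4)) * (1 + real i * ?q)"
    proof -
      define e1 e2 where "e1 = real (?n1 + 2)" "e2 = real (?n2 + 2)"
      have "e1 + e2 = real l + 2 * real (length p) + 4" using t by (simp add: e1_e2_def)
      then have "2 * real s + 2 + \<beta> * (real l + 2 * real (length p) + 4) = 2 * real s + 2 + \<beta> * (e1 + e2)"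
        by simp
      also have "\<dots> = (real s + (1 + \<beta> * e1)) + (real s + (1 + \<beta> * e2))" by (simp add: algebra_simps)
      finally show ?thesis unfolding e1_e2_def[symmetric] by (simp only: powr_add mult_ac)
    qed
    also have "\<dots> \<le> ?q powr (2 * real s + 2 + \<beta> * (real l + 2 * real s + 4)) * (?q * (real l + 1))"
    proof (intro mult_mono powr_mono)
      show "2 * real s + 2 + \<beta> * (real l + 2 * real (length p) + 4) \<le>
          2 * real s + 2 + \<beta> * (real l + 2 * real s + 4)"
        using t(7) \<beta> by (intro add_left_mono mult_left_mono) auto
      have "real i * ?q \<le> real l * ?q" using t q by (intro mult_right_mono) auto
      then show "1 + real i * ?q \<le> ?q * (real l + 1)" using q by (simp add: algebra_simps)
    qed (use q in auto)
    also have "\<dots> = T"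
    proof -
      have "?q powr (2 * real s + 3 + \<beta> * (real l + 2 * real s + 4)) =
          ?q powr (2 * real s + 2 + \<beta> * (real l + 2 * real s + 4)) * ?q powr 1"
        unfolding powr_add[symmetric] by (simp add: algebra_simps)
      then show ?thesis using q by (simp add: T_def)
    qed
    finally show "real (card (?A t)) \<le> T" .
  qed
  also have "\<dots> = real (card ?I) * real (card ?U) * T" by (simp add: card_cartesian_product)
  also have "\<dots> \<le> (real l + 1) ^ 2 * ?q powr (2 * real s) * T"
  proof (intro mult_right_mono mult_mono)
    have "card ?I \<le> card ({..l} \<times> {..l})" by (intro card_mono) auto
    also have "\<dots> = (l + 1) ^ 2" by (simp add: card_cartesian_product power2_eq_square)
    finally have "real (card ?I) \<le> real ((l + 1) ^ 2)" by (rule of_nat_mono)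
    then show "real (card ?I) \<le> (real l + 1) ^ 2" by (simp only: of_nat_power of_nat_add of_nat_1)
    have "2 * real m + 1 = ?q + 2" using m by simp
    also have "\<dots> \<le> ?q * 3" using q by linarith
    also have "\<dots> \<le> ?q * ?q" using q by (intro mult_left_mono) auto
    finally have "2 * real m + 1 \<le> ?q * ?q" .
    then have "(2 * real m + 1) ^ s \<le> (?q * ?q) ^ s" by (rule power_mono) simp
    moreover have "real (card ?U) \<le> real ((2 * m + 1) ^ s)"
      using card_words_le[of m s] by (rule of_nat_mono)
    moreover have "real ((2 * m + 1) ^ s) = (2 * real m + 1) ^ s" by (simp add: add.commute)
    moreover have "(?q * ?q) ^ s = ?q powr (2 * real s)"
    proof -
      have "?q powr (2 * real s) = ?q powr real (2 * s)" by simp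
      also have "\<dots> = ?q ^ (2 * s)" using q by (intro powr_realpow) auto
      finally show ?thesis by (simp add: power_mult power2_eq_square)
    qed
    ultimately show "real (card ?U) \<le> ?q powr (2 * real s)" by linarith
    show "0 \<le> T" using q by (simp add: T_def)
  qed auto
  also have "\<dots> = (real l + 1) ^ 3 * ?q powr (4 * real s + 3 + \<beta> * (real l + 2 * real s + 4))"
  proof -
    have "?q powr (4 * real s + 3 + \<beta> * (real l + 2 * real s + 4)) =
        ?q powr (2 * real s) * ?q powr (2 * real s + 3 + \<beta> * (real l + 2 * real s + 4))"
      unfolding powr_add[symmetric] by (simp add: algebra_simps)
    then show ?thesis by (simp add: T_def power2_eq_square power3_eq_cube)
  qed
  finally show ?thesis .
qed

section \<open>Free groups\<close>

text \<open>\<open>foldr cons_reduce w []\<close> is the free reduction of \<open>w\<close>, an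
  invariant of \<open>pres_rel\<close> if no relator is nonempty. This settles maximal relator
  length zero, where the counting hypothesis speaks of length zero only, while all lengths have to
  be bounded.\<close>

fun cons_reduce :: "letter \<Rightarrow> word \<Rightarrow> word" where
  "cons_reduce x [] = [x]"
| "cons_reduce x (y # w) = (if y = letter_inv x then w else x # y # w)"

lemma reduced_cons_reduce: "reduced w \<Longrightarrow> reduced (cons_reduce x w)"
  by (cases w) auto

lemma reduced_foldr_cons_reduce: "reduced (foldr cons_reduce w [])"
  by (induction w) (auto simp: reduced_cons_reduce)

lemma cons_reduce_cancel: "reduced w \<Longrightarrow> cons_reduce x (cons_reduce (letter_inv x) w) = w"
proof (cases w)
  case (Cons y v)
  assume "reduced w"
  then show ?thesis using Cons by (cases v) auto
qed simp

lemma foldr_cons_reduce_reduced: "reduced w \<Longrightarrow> foldr cons_reduce w [] = w"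
proof (induction w)
  case (Cons x w)
  then show ?case by (cases w) auto
qed simp

lemma pres_rel_free:
  assumes "(v, w) \<in> pres_rel m R" "R \<subseteq> {[]}"
  shows "foldr cons_reduce v [] = foldr cons_reduce w []"
  using assms(1)
proof induction
  case (cancel u v x)
  then show ?case using cons_reduce_cancel[OF reduced_foldr_cons_reduce, of x v] by simp
qed (use assms(2) in auto)

lemma trivial_words_free:
  assumes "R \<subseteq> {[]}" "l > 0"
  shows "trivial_words m R l = {}"
proof -
  have "w = []" if "trivial m R w" "reduced w" for w
  proof -
    have "R \<subseteq> words m" using assms(1) by auto
    then have "(w, []) \<in> pres_rel m R" using that(1) trivial_iff_pres_rel by (auto simp: trivial_def)
    then show ?thesis using pres_rel_free[OF _ assms(1)] foldr_cons_reduce_reduced[OF that(2)] by fastforce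
  qed
  then show ?thesis using assms(2) by (auto simp: trivial_words_eq)
qed

section \<open>Growth of the number of trivial words\<close>

lemma cut_exists:
  assumes R: "R \<subseteq> words m" "finite R" and C: "C > 0"
    and iso: "\<And>D. minimal_diagram m R D \<Longrightarrow> real (boundary_length D) \<ge> C * real (area D)"
    and w: "w \<in> trivial_words m R l"
    and s: "real (max_relator_length R) * real l / C + real l < (real s + 1)\<^sup>2"
  shows "\<exists>i j p. i \<le> j \<and> j \<le> l \<and> l div 4 \<le> j - i \<and> l div 4 \<le> l - (j - i) \<and>
    p \<in> words m \<and> length p \<le> s \<and> word_val m R (take j w) = word_val m R (take i w @ p)"
proof -
  have tr: "trivial m R w" "length w = l" using w by (auto simp: trivial_words_eq)
  then have "(w, []) \<in> pres_rel m R" using trivial_iff_pres_rel[OF R(1)] by (auto simp: trivial_def)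
  then obtain D where D: "minimal_diagram m R D" "boundary_word D = w"
    using minimal_diagram_exists[OF R(1)] by blast
  show ?thesis
  proof (cases "darts D = {}")
    case True
    then have "l = 0" using D(2) tr(2) by (simp add: boundary_word_def)
    then show ?thesis by (intro exI[of _ 0] exI[of _ "[]"]) simp
  next
    case False
    interpret vk m R D using R D(1) False by unfold_locales (auto simp: minimal_diagram_def)
    have "C * real (area D) \<le> real l" using iso[OF D(1)] D(2) tr(2) by (simp add: boundary_length_def)
    then have "real (area D) \<le> real l / C" using C by (simp add: field_simps)
    then have "real (max_relator_length R) * real (area D) \<le> real (max_relator_length R) * (real l / C)"
      by (rule mult_left_mono) simp
    then have "real (max_relator_length R * area D + l) < (real s + 1)\<^sup>2" using s by simp
    also have "\<dots> = real ((s + 1) * (s + 1))" by (simp add: power2_eq_square algebra_simps)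
    finally have "max_relator_length R * area D + l < (s + 1) * (s + 1)" by (simp only: of_nat_less_iff)
    then show ?thesis using vk_cut[of "max_relator_length R" s] card_inner_face[OF assms(2)] D(2) tr(2) by simp
  qed
qed

text \<open>This is crude, but it lets \<open>(l + 1) ^ 3\<close> contribute only
  \<open>6 * sqrt l\<close> to the exponent, within the order \<open>sqrt (\<lambda> * l)\<close> of
  the cutting path.\<close>

lemma Suc_le_powr_sqrt:
  fixes q :: real
  assumes "q \<ge> 3"
  shows "real l + 1 \<le> q powr (2 * sqrt (real l))"
proof -
  let ?t = "sqrt (real l)"
  have "exp 1 \<le> q" using exp_le assms by linarith
  then have "1 \<le> ln q" using assms by (subst ln_ge_iff) auto
  have "real l + 1 = 1 + ?t\<^sup>2" by simp
  also have "\<dots> \<le> (1 + ?t)\<^sup>2" by (simp add: power2_eq_square algebra_simps)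
  also have "\<dots> \<le> (exp ?t)\<^sup>2" by (intro power_mono exp_ge_add_one_self) auto
  also have "\<dots> = exp (2 * ?t)" by (simp add: exp_double)
  also have "\<dots> \<le> exp (2 * ?t * ln q)" using mult_left_mono[OF \<open>1 \<le> ln q\<close>, of "2 * ?t"] by simp
  also have "\<dots> = q powr (2 * ?t)" using assms by (simp add: powr_def)
  finally show ?thesis .
qed

text \<open>Here \<open>t\<close> is \<open>sqrt (\<lambda> * l)\<close>, \<open>r\<close> is
  \<open>sqrt l\<close> and \<open>s\<close> bounds the length of the path. The terms without
  \<open>\<beta>\<close> are at most \<open>13 * c * t\<close> and are multiplied by
  \<open>2 * \<beta> \<ge> 1\<close>; the rest, \<open>\<beta> * (2 * s + 4)\<close>, is at most
  \<open>6 * \<beta> * c * t\<close>. Hence \<open>32 = 2 * 13 + 6\<close>.\<close>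

lemma exponent_bound:
  fixes \<beta> c t L s :: real
  assumes "\<beta> \<ge> 1 / 2" "c \<ge> 1" "t \<ge> 1" "0 \<le> s" "s \<le> c * t" "r \<le> t"
  shows "6 * r + (4 * s + 3 + \<beta> * (L + 2 * s + 4)) \<le> \<beta> * (L + 32 * c * t)"
proof -
  have ct: "t \<le> c * t" using assms mult_right_mono[of 1 c t] by simp
  have *: "x \<le> 2 * \<beta> * x" if "x \<ge> 0" for x
    using mult_right_mono[of 1 "2 * \<beta>" x] assms(1) that by simp
  have "6 * r + 4 * s + 3 \<le> 13 * (c * t)" using assms ct by linarith
  also have "\<dots> \<le> 2 * \<beta> * (13 * (c * t))" using assms ct by (intro *) auto
  finally have 1: "6 * r + 4 * s + 3 \<le> 26 * (\<beta> * (c * t))" by simp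
  have "2 * s + 4 \<le> 6 * (c * t)" using assms ct by linarith
  then have "\<beta> * (2 * s + 4) \<le> \<beta> * (6 * (c * t))" using assms(1) by (intro mult_left_mono) auto
  then have 2: "\<beta> * (2 * s + 4) \<le> 6 * (\<beta> * (c * t))" by simp
  have "\<beta> * (L + 2 * s + 4) = \<beta> * L + \<beta> * (2 * s + 4)" by (simp add: algebra_simps)
  moreover have "\<beta> * (L + 32 * c * t) = \<beta> * L + 32 * (\<beta> * (c * t))" by (simp add: algebra_simps)
  ultimately show ?thesis using 1 2 by linarith
qed

text \<open>Here \<open>u = sqrt (\<lambda> / l)\<close> and \<open>v = sqrt (\<lambda> / (7 / 8 * l))\<close>, so that \<open>17 / 16 * u \<le> v\<close> as
  \<open>(17 / 16)^2 < 8 / 7\<close>.\<close>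

lemma rate_step:
  fixes c u v :: real
  assumes "c \<ge> 1" "u \<ge> 0" "17 / 16 * u \<le> v"
  shows "exp (512 * c * (a - v)) * (1 + 32 * c * u) \<le> exp (512 * c * (a - u))"
proof -
  have "exp (512 * c * (a - v)) * (1 + 32 * c * u) \<le> exp (512 * c * (a - v)) * exp (32 * c * u)"
    by (intro mult_left_mono exp_ge_add_one_self) auto
  \<comment> \<open>The origin of \<open>512 = 16 * 32\<close>: \<open>v\<close> exceeds
    \<open>u\<close> by at least \<open>u / 16\<close>, and this pays for the loss
    \<open>32 * c * u\<close> of one cut.\<close>
  also have "\<dots> = exp (512 * c * (a - v + u / 16))"
    unfolding exp_add[symmetric] by (rule arg_cong[of _ _ exp]) (simp add: algebra_simps)
  also have "\<dots> \<le> exp (512 * c * (a - u))"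
  proof -
    have "512 * c * (a - v + u / 16) \<le> 512 * c * (a - u)"
      using assms by (intro mult_left_mono) auto
    then show ?thesis by simp
  qed
  finally show ?thesis .
qed

text \<open>The rate depends on \<open>l\<close> so that the induction closes: it is at least 1 from
  \<open>A * lam / 4\<close> on, because there \<open>sqrt (lam / l) \<le> 2 / sqrt A\<close>, and
  it grows enough between \<open>7 / 8 * l\<close> and \<open>l\<close> to pay for one cut. The
  condition \<open>16 * c \<le> sqrt A\<close> keeps the cutting path below \<open>l / 16\<close>,
  so the padded parts have length at most \<open>7 / 8 * l\<close>.\<close>

lemma card_trivial_words_le:
  fixes C A \<eta> :: real and m :: nat and R :: "word set"
  defines "c \<equiv> sqrt (1 + 1 / C)" and "lam \<equiv> real (max_relator_length R)"
  assumes R: "R \<subseteq> words m" "finite R" and m: "m \<ge> 2" and C: "C > 0"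
    and iso: "\<And>D. minimal_diagram m R D \<Longrightarrow> real (boundary_length D) \<ge> C * real (area D)"
    and A: "16 * c \<le> sqrt A" and \<eta>: "\<eta> \<ge> 1 / 2" and lam: "lam \<ge> 1"
    and base: "\<And>l. A * lam / 4 \<le> real l \<Longrightarrow> real l \<le> A * lam \<Longrightarrow>
      real (card (trivial_words m R l)) \<le> real (2 * m - 1) powr (\<eta> * real l)"
    and l: "A * lam / 4 \<le> real l"
  shows "real (card (trivial_words m R l)) \<le>
    real (2 * m - 1) powr (\<eta> * exp (512 * c * (2 / sqrt A - sqrt (lam / real l))) * real l)"
  using l
proof (induction l rule: less_induct)
  case (less l)
  let ?q = "real (2 * m - 1)" and ?u = "\<lambda>x. sqrt (lam / x)"
  let ?rate = "\<lambda>x. exp (512 * c * (2 / sqrt A - ?u x))"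
  have q: "?q \<ge> 3" using m by linarith
  have c: "c \<ge> 1" using C by (simp add: c_def)
  then have "sqrt A \<ge> 16" using A by linarith
  then have "sqrt A > 0" by linarith
  then have "A > 0" by simp
  have A256: "A \<ge> 256"
    using real_le_rsqrt[of 16 A] power_mono[of 16 "sqrt A" 2] \<open>sqrt A \<ge> 16\<close> \<open>A > 0\<close> by simp
  have u_le: "?u x \<le> 2 / sqrt A" if "A * lam / 4 \<le> x" for x
  proof -
    have "x > 0" using that \<open>A > 0\<close> lam by (smt (verit) divide_pos_pos mult_pos_pos)
    then have "lam / x \<le> 4 / A" using that \<open>A > 0\<close> by (simp add: field_simps)
    then have "?u x \<le> sqrt (4 / A)" by simp
    then show ?thesis by (simp add: real_sqrt_divide)
  qed
  have rate_ge: "?rate x \<ge> 1" if "A * lam / 4 \<le> x" for x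
    using u_le[OF that] c by simp
  show ?case
  proof (cases "real l \<le> A * lam")
    case True
    have "real (card (trivial_words m R l)) \<le> ?q powr (\<eta> * real l)"
      by (rule base[OF less.prems True])
    also have "\<dots> \<le> ?q powr (\<eta> * ?rate (real l) * real l)"
    proof (rule powr_mono)
      have "\<eta> * 1 \<le> \<eta> * ?rate (real l)" using rate_ge[OF less.prems] \<eta> by (intro mult_left_mono) auto
      then show "\<eta> * real l \<le> \<eta> * ?rate (real l) * real l" by (intro mult_right_mono) auto
    qed (use q in simp)
    finally show ?thesis .
  next
    case False
    define L where "L = real l"
    have L: "A * lam < L" using False by (simp add: L_def)
    have "256 * 1 \<le> A * lam" using A256 lam by (intro mult_mono) auto
    then have L256: "L > 256" using L by linarith
    define t where "t = sqrt (lam * L)"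
    \<comment> \<open>Rounding down is harmless, since \<open>cut_exists\<close> compares with
      \<open>(s + 1)\<^sup>2\<close> and \<open>c * t < s + 1\<close>; the square of
      \<open>c * t\<close> is \<open>(1 + 1 / C) * lam * L\<close>.\<close>
    define s where "s = nat \<lfloor>c * t\<rfloor>"
    have "1 * 1 \<le> lam * L" using lam L256 by (intro mult_mono) auto
    then have t1: "t \<ge> 1" by (simp add: t_def)
    have "1 * L \<le> lam * L" using lam L256 by (intro mult_right_mono) auto
    then have rt: "sqrt L \<le> t" by (simp add: t_def)
    have ct: "c * t \<ge> 0" using c t1 by simp
    have s: "real s \<le> c * t" "c * t < real s + 1" using ct by (auto simp: s_def)
    have tu: "t = L * ?u L"
      using L256 lam by (simp add: t_def real_sqrt_mult real_sqrt_divide real_div_sqrt field_simps)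
    have ct16: "c * t \<le> L / 16"
    proof -
      have "lam * L \<le> L\<^sup>2 / A"
        using L L256 \<open>A > 0\<close> by (simp add: field_simps power2_eq_square)
      then have "t \<le> sqrt (L\<^sup>2 / A)" by (simp add: t_def)
      also have "\<dots> = L / sqrt A" using L256 by (simp add: real_sqrt_divide)
      finally have "c * t \<le> c * (L / sqrt A)" using c by (intro mult_left_mono) auto
      also have "\<dots> \<le> L / 16" using A L256 \<open>sqrt A > 0\<close> by (simp add: field_simps)
      finally show ?thesis .
    qed
    \<comment> \<open>A common rate for both parts: the rate increases with the length, and no
      padded part exceeds \<open>7 / 8 * L\<close>.\<close>
    define \<beta> where "\<beta> = \<eta> * ?rate (7 / 8 * L)"
    have "A * lam / 4 \<le> 7 / 8 * L" using L L256 by simp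
    from rate_ge[OF this] have "1 / 2 * 1 \<le> \<eta> * ?rate (7 / 8 * L)"
      using \<eta> by (intro mult_mono) auto
    then have \<beta>: "\<beta> \<ge> 1 / 2" by (simp add: \<beta>_def)
    have cnt: "real (card (trivial_words m R l)) \<le>
        (real l + 1) ^ 3 * ?q powr (4 * real s + 3 + \<beta> * (real l + 2 * real s + 4))"
    proof (rule counting_step[OF R(1) m \<beta>])
      fix w assume w: "w \<in> trivial_words m R l"
      show "\<exists>i j p. i \<le> j \<and> j \<le> l \<and> l div 4 \<le> j - i \<and> l div 4 \<le> l - (j - i) \<and>
        p \<in> words m \<and> length p \<le> s \<and> word_val m R (take j w) = word_val m R (take i w @ p)"
      proof (rule cut_exists[OF R C iso w])
        have "lam * L / C + L \<le> lam * L / C + lam * L"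
          using lam L256 by simp
        also have "\<dots> = (c * t)\<^sup>2"
          using C lam L256 by (simp add: c_def t_def power_mult_distrib field_simps)
        also have "\<dots> < (real s + 1)\<^sup>2" using s ct by (intro power_strict_mono) auto
        finally show "real (max_relator_length R) * real l / C + real l < (real s + 1)\<^sup>2"
          by (simp add: lam_def L_def)
      qed
    next
      fix n assume n: "l div 4 + 2 \<le> n" "n \<le> l - l div 4 + s + 2"
      \<comment> \<open>The extra padding by two letters compensates for the rounding in
        \<open>l div 4\<close> and keeps \<open>n\<close> in the range of the induction
        hypothesis.\<close>
      have "real l / 4 \<le> real (l div 4) + 1" by linarith
      then have lo: "A * lam / 4 \<le> real n" using n(1) L by (simp add: L_def)
      have "real (l - l div 4) \<le> 3 / 4 * L + 3 / 4" by (simp add: L_def)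
      then have hi: "real n \<le> 7 / 8 * L" using n(2) s(1) ct16 L256 by linarith
      then have "n < l" using L256 by (simp add: L_def)
      from less.IH[OF this lo]
      have "real (card (trivial_words m R n)) \<le> ?q powr (\<eta> * ?rate (real n) * real n)" .
      also have "\<dots> \<le> ?q powr (\<beta> * real n)"
      proof (rule powr_mono)
        have "real n > 0" using n(1) by simp
        then have "lam / (7 / 8 * L) \<le> lam / real n" using hi lam by (intro divide_left_mono) auto
        then have "?u (7 / 8 * L) \<le> ?u (real n)" by (rule real_sqrt_le_mono)
        then have "?rate (real n) \<le> ?rate (7 / 8 * L)" using c by simp
        then show "\<eta> * ?rate (real n) * real n \<le> \<beta> * real n"
          unfolding \<beta>_def using \<eta> by (intro mult_right_mono mult_left_mono) auto
      qed (use q in simp)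
      finally show "real (card (trivial_words m R n)) \<le> ?q powr (\<beta> * real n)" .
    qed
    also have "\<dots> \<le> ?q powr (6 * sqrt L) * ?q powr (4 * real s + 3 + \<beta> * (real l + 2 * real s + 4))"
    proof (rule mult_right_mono)
      have "(real l + 1) ^ 3 \<le> (?q powr (2 * sqrt L)) ^ 3"
        using Suc_le_powr_sqrt[OF q, of l] by (intro power_mono) (auto simp: L_def)
      also have "\<dots> = ?q powr (6 * sqrt L)"
        using q by (simp add: powr_powr flip: powr_realpow)
      finally show "(real l + 1) ^ 3 \<le> ?q powr (6 * sqrt L)" .
    qed simp
    also have "\<dots> = ?q powr (6 * sqrt L + (4 * real s + 3 + \<beta> * (L + 2 * real s + 4)))"
      by (simp only: powr_add L_def)
    also have "\<dots> \<le> ?q powr (\<beta> * (L + 32 * c * t))"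
      using exponent_bound[OF \<beta> c t1 _ s(1) rt, of L] q by (intro powr_mono) auto
    also have "\<dots> \<le> ?q powr (\<eta> * ?rate L * L)"
    proof (rule powr_mono)
      have "17 / 16 * ?u L \<le> ?u (7 / 8 * L)"
      proof -
        have "(17 / 16)\<^sup>2 * (lam / L) \<le> 8 / 7 * (lam / L)"
          using lam L256 by (intro mult_right_mono) (auto simp: power2_eq_square)
        also have "\<dots> = lam / (7 / 8 * L)" by simp
        finally have "sqrt ((17 / 16)\<^sup>2 * (lam / L)) \<le> ?u (7 / 8 * L)" by (rule real_sqrt_le_mono)
        then show ?thesis by (simp only: real_sqrt_mult real_sqrt_abs)
      qed
      then have "?rate (7 / 8 * L) * (1 + 32 * c * ?u L) \<le> ?rate L"
        using c lam L256 by (intro rate_step) auto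
      then have "\<eta> * (?rate (7 / 8 * L) * (1 + 32 * c * ?u L)) * L \<le> \<eta> * ?rate L * L"
        using \<eta> L256 by (intro mult_right_mono mult_left_mono) auto
      moreover have "\<beta> * (L + 32 * c * t) = \<eta> * (?rate (7 / 8 * L) * (1 + 32 * c * ?u L)) * L"
        unfolding \<beta>_def tu by (simp add: algebra_simps)
      ultimately show "\<beta> * (L + 32 * c * t) \<le> \<eta> * ?rate L * L" by simp
    qed (use q in simp)
    finally show ?thesis by (simp add: L_def)
  qed
qed

lemma card_trivial_words_le_all:
  assumes "m \<ge> 2"
  shows "real (card (trivial_words m R l)) \<le> real (2 * m - 1) powr (2 * real l)"
proof -
  let ?q = "real (2 * m - 1)"
  have q: "?q \<ge> 3" using assms by linarith
  have "trivial_words m R l \<subseteq> {w. set w \<subseteq> letters m \<and> length w = l}"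
    by (auto simp: trivial_words_def words_def)
  then have "card (trivial_words m R l) \<le> card {w. set w \<subseteq> letters m \<and> length w = l}"
    by (rule card_mono[OF finite_lists_length_eq[OF finite_letters]])
  also have "\<dots> = (2 * m) ^ l" by (simp add: card_lists_length_eq[OF finite_letters] card_letters)
  finally have "real (card (trivial_words m R l)) \<le> real ((2 * m) ^ l)" by (rule of_nat_mono)
  also have "\<dots> = (?q + 1) ^ l" using assms by simp
  also have "\<dots> \<le> (?q * ?q) ^ l"
  proof (rule power_mono)
    have "?q + 1 \<le> ?q * 3" using q by linarith
    also have "\<dots> \<le> ?q * ?q" using q by (intro mult_left_mono) auto
    finally show "?q + 1 \<le> ?q * ?q" .
  qed simp
  also have "\<dots> = ?q ^ (2 * l)" by (simp add: power_mult power2_eq_square)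
  also have "\<dots> = ?q powr real (2 * l)" using q by (intro powr_realpow[symmetric]) auto
  finally show ?thesis by simp
qed

text \<open>For large \<open>A\<close> the rate of \<open>card_trivial_words_le\<close> is bounded
  uniformly in \<open>l\<close>. For \<open>sqrt A < 16 * c\<close> no diagram is cut: the
  exponential is at least 4, and \<open>4 * \<eta> \<ge> 2\<close> puts the claim above a bound for
  the number of all words of length \<open>l\<close>. Relators of length zero leave a free
  group.\<close>

lemma card_trivial_words_growth:
  fixes C A \<eta> :: real and m :: nat and R :: "word set"
  defines "c \<equiv> sqrt (1 + 1 / C)" and "lam \<equiv> real (max_relator_length R)"
  assumes R: "R \<subseteq> words m" "finite R" and m: "m \<ge> 2" and C: "C > 0"
    and iso: "\<And>D. minimal_diagram m R D \<Longrightarrow> real (boundary_length D) \<ge> C * real (area D)"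
    and A: "A > 1" and \<eta>: "\<eta> \<ge> 1 / 2"
    and base: "\<And>l. A * lam / 4 \<le> real l \<Longrightarrow> real l \<le> A * lam \<Longrightarrow>
      real (card (trivial_words m R l)) \<le> real (2 * m - 1) powr (\<eta> * real l)"
    and l: "A * lam / 4 \<le> real l"
  shows "real (card (trivial_words m R l)) \<le>
    real (2 * m - 1) powr (\<eta> * real l * exp (1024 * c / sqrt A))"
proof -
  let ?q = "real (2 * m - 1)"
  have q: "?q \<ge> 3" using m by linarith
  have c: "c \<ge> 1" using C by (simp add: c_def)
  have \<eta>l: "0 \<le> \<eta> * real l" using \<eta> by simp
  consider "max_relator_length R = 0" | "max_relator_length R > 0" "16 * c \<le> sqrt A" | "sqrt A < 16 * c"
    by linarith
  then show ?thesis
  proof cases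
    case 1
    have "length r \<le> max_relator_length R" if "r \<in> R" for r
      unfolding max_relator_length_def using R(2) that by (intro Max_ge) auto
    then have "R \<subseteq> {[]}" using 1 by fastforce
    show ?thesis
    proof (cases "l = 0")
      case True
      then show ?thesis using card_trivial_words_le_all[OF m, of R 0] q by simp
    qed (simp add: trivial_words_free[OF \<open>R \<subseteq> {[]}\<close>])
  next
    case 2
    have lam: "lam \<ge> 1" using 2(1) by (simp add: lam_def)
    have "real (card (trivial_words m R l)) \<le>
        ?q powr (\<eta> * exp (512 * c * (2 / sqrt A - sqrt (lam / real l))) * real l)"
      using card_trivial_words_le[OF R m C iso _ \<eta>, of A l] 2(2) lam base l
      unfolding c_def lam_def by blast
    also have "\<dots> \<le> ?q powr (\<eta> * real l * exp (1024 * c / sqrt A))"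
    proof (rule powr_mono)
      have "512 * c * (2 / sqrt A - sqrt (lam / real l)) \<le> 512 * c * (2 / sqrt A)"
        using c lam by (intro mult_left_mono) auto
      then have "\<eta> * real l * exp (512 * c * (2 / sqrt A - sqrt (lam / real l))) \<le>
          \<eta> * real l * exp (1024 * c / sqrt A)"
        using \<eta>l by (intro mult_left_mono) auto
      then show "\<eta> * exp (512 * c * (2 / sqrt A - sqrt (lam / real l))) * real l \<le>
          \<eta> * real l * exp (1024 * c / sqrt A)" by (simp add: mult_ac)
    qed (use q in simp)
    finally show ?thesis .
  next
    case 3
    have "real (card (trivial_words m R l)) \<le> ?q powr (2 * real l)"
      by (rule card_trivial_words_le_all[OF m])
    also have "\<dots> \<le> ?q powr (\<eta> * real l * exp (1024 * c / sqrt A))"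
    proof (rule powr_mono)
      have "1 / 2 * real l \<le> \<eta> * real l" using \<eta> by (rule mult_right_mono) simp
      have "sqrt A > 0" using A by simp
      then have "64 \<le> 1024 * c / sqrt A" using 3 by (simp add: field_simps)
      then have "4 \<le> exp (1024 * c / sqrt A)"
        using exp_ge_add_one_self[of "1024 * c / sqrt A"] by linarith
      then have "\<eta> * real l * 4 \<le> \<eta> * real l * exp (1024 * c / sqrt A)"
        using \<eta>l by (rule mult_left_mono)
      then show "2 * real l \<le> \<eta> * real l * exp (1024 * c / sqrt A)"
        using \<open>1 / 2 * real l \<le> \<eta> * real l\<close> by linarith
    qed (use q in simp)
    finally show ?thesis .
  qed
qed

theorem proposition8:
  fixes C :: real
  assumes "C > 0"
  shows "\<exists>\<delta> :: real \<Rightarrow> real.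
    (\<forall>A>1. \<delta> A \<ge> 0) \<and> (\<delta> \<longlongrightarrow> 0) at_top \<and>
    (\<forall>(m::nat) (R :: word set) (A::real) (\<eta>::real).
       m \<ge> 2 \<and> finite R \<and> R \<subseteq> words m \<and>
       (\<forall>D. minimal_diagram m R D \<longrightarrow> real (boundary_length D) \<ge> C * real (area D)) \<and>
       A > 1 \<and> \<eta> \<ge> 1 / 2 \<and>
       (\<forall>l::nat. A * real (max_relator_length R) / 4 \<le> real l \<and>
                 real l \<le> A * real (max_relator_length R) \<longrightarrow>
          real (card (trivial_words m R l)) \<le> (2 * real m - 1) powr (\<eta> * real l))
       \<longrightarrow>
       (\<forall>l::nat. A * real (max_relator_length R) / 4 \<le> real l \<longrightarrow>
          real (card (trivial_words m R l)) \<le> (2 * real m - 1) powr (\<eta> * real l * (1 + \<delta> A))))"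
proof -
  define \<delta> where "\<delta> = (\<lambda>A. exp (1024 * sqrt (1 + 1 / C) / sqrt A) - 1)"
  have "((\<lambda>A. 1024 * sqrt (1 + 1 / C) / sqrt A) \<longlongrightarrow> 0) at_top"
    by (rule tendsto_divide_0[OF tendsto_const filterlim_at_top_imp_at_infinity[OF sqrt_at_top]])
  then have "(\<delta> \<longlongrightarrow> exp 0 - 1) at_top"
    unfolding \<delta>_def by (intro tendsto_intros)
  moreover have "\<forall>A>1. \<delta> A \<ge> 0"
    using assms by (simp add: \<delta>_def)
  moreover have "real (card (trivial_words m R l)) \<le> (2 * real m - 1) powr (\<eta> * real l * (1 + \<delta> A))"
    if hyps: "m \<ge> 2 \<and> finite R \<and> R \<subseteq> words m \<and>
         (\<forall>D. minimal_diagram m R D \<longrightarrow> real (boundary_length D) \<ge> C * real (area D)) \<and>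
         A > 1 \<and> \<eta> \<ge> 1 / 2 \<and>
         (\<forall>l::nat. A * real (max_relator_length R) / 4 \<le> real l \<and>
                   real l \<le> A * real (max_relator_length R) \<longrightarrow>
            real (card (trivial_words m R l)) \<le> (2 * real m - 1) powr (\<eta> * real l))"
      and l: "A * real (max_relator_length R) / 4 \<le> real l"
    for m l :: nat and R :: "word set" and A \<eta> :: real
  proof -
    have q: "2 * real m - 1 = real (2 * m - 1)" using hyps by simp
    have "real (card (trivial_words m R l)) \<le>
        real (2 * m - 1) powr (\<eta> * real l * exp (1024 * sqrt (1 + 1 / C) / sqrt A))"
      by (rule card_trivial_words_growth) (use hyps l assms in \<open>auto simp only: q\<close>)
    then show ?thesis by (simp only: q \<delta>_def) simp
  qed
  ultimately show ?thesis by (intro exI[of _ \<delta>]) auto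
qed

end
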